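(* Let $m\ge2$, $n\ge 0$, $0\le k\le n$, let $\rho=|\vec n_0\rangle\langle\vec n_0|$ with $\vec n_0\in\mathcal H_n^m$ a Fock state, and $N_0=N(\vec n_0)$. For $g\in\mathrm{SU}(m)$ and an outcome $\vec n\in\mathbb N^m$ with $|\vec n|=n$, the PNR filter function is $$f_{\lambda_k}(\vec n,g)=\frac{1}{s_{\lambda_k}}\,\frac{(-1)^{\varphi(N_0)}}{\vec n!}\sum_{M\in\mathrm{GT}(\lambda_k)}C^{M}_{N_0,\bar N_0}\sum_{N'\in\mathrm{GT}(\tau_n^m)}\frac{(-1)^{\varphi(N')}}{\vec n'!}\,C^{M}_{N',\bar N'}\,\big|\mathrm{per}(g_{\vec n,\vec n'})\big|^2 ,$$ where $\vec n'$ is the Fock occupation vector with $N'=N(\vec n')$, $s_{\lambda_k}=\frac{m-1}{2k+m-1}\binom{k+m-2}{k}^{-1}$, and only terms with $M$ of zero weight contribute.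
   Context: Fix integers $m\ge 2$, $n\ge0$. $\mathcal H_n^m$ is the span of Fock states $|\vec n\rangle=|n_1,\dots,n_m\rangle$, $\vec n\in\mathbb N^m$, $\sum_in_i=n$. $\tau_n^m$ is the totally symmetric irrep of $\mathrm{SU}(m)$ on $\mathcal H_n^m$ given by passive transformations; $\bar\tau_n^m$ its complex conjugate in the Fock basis; $\omega_n^m(g)(X)=\tau_n^m(g)X\tau_n^m(g)^\dagger\cong\tau_n^m\otimes\bar\tau_n^m$ via vectorization $|A\rangle\!\rangle=\sum\langle\vec n|A|\vec m\rangle|\vec n\rangle\otimes|\vec m\rangle$. $\lambda_k$ is the irrep with Young diagram $(2k,k,\dots,k,0)$ (first row $2k$ boxes, rows $2,\dots,m-1$ with $k$ boxes, empty last row), $d_{\lambda_k}$ its dimension; $\tau_n^m\otimes\bar\tau_n^m\cong\bigoplus_{k=0}^n\lambda_k$ multiplicity-free, and $P_{\lambda_k}$ is the orthogonal projector onto the $\lambda_k$ component. Gelfand–Tsetlin (GT) patterns: for an irrep $\lambda=(\lambda_1,\dots,\lambda_m)$, $\lambda_m=0$, a GT pattern $M=(M_{i,j})_{1\le i\le j\le m}$ has $M_{i,m}=\lambda_i$ and $M_{i,j+1}\ge M_{i,j}\ge M_{i+1,j+1}$; $\mathrm{GT}(\lambda)$ is the set of such patterns and $\{|M\rangle\}$ the orthonormal GT basis of $\lambda$ (Condon–Shortley convention). The Fock state $|\vec n\rangle$ is identified with the GT basis vector $|N\rangle$ of $\tau_n^m$ with $N_{1,j}=n_1+\dots+n_j$,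 $N_{i,j}=0$ for $i\ge2$; write $N=N(\vec n)$. The dual pattern of $M$ is $\bar M_{i,l}:=M_{1,m}-M_{l-i+1,l}$, a GT basis label of the dual irrep. With $s_M(k)=\sum_{j=1}^k\sum_{i=1}^jM_{i,j}$ and $M_{\max}$ the highest-weight pattern ($M_{i,j}=M_{i,m}$), set $\varphi(M):=s_M(m-1)-s_{M_{\max}}(m-1)\in\mathbb Z$; then, regarding the Fock basis vector as a basis vector of $\bar\tau_n^m$, $|N\rangle=(-1)^{\varphi(N)}|\bar N\rangle$. For $N_1,N_2\in\mathrm{GT}(\tau_n^m)$ and $M\in\mathrm{GT}(\lambda_k)$, the real SU($m$) Clebsch–Gordan coefficients are $C^M_{N_1,\bar N_2}:=\langle N_1,\bar N_2|M\rangle$, i.e. $|N_1\rangle\otimes|\bar N_2\rangle=\sum_k\sum_{M\in\mathrm{GT}(\lambda_k)}C^M_{N_1,\bar N_2}|M\rangle$; they vanish unless the weight of $M$ is the sum of the weights of $N_1$ and $\bar N_2$. Filter function: for input $\rho=|\vec n_0\rangle\langle\vec n_0|$, $f_{\lambda}(\vec n,g):=s_{\lambda}^{-1}\langle\vec n|\tau_n^m(g)\,[P_{\lambda}(\rho)]\,\tau_n^m(g)^\dagger|\vec n\rangle$, with $s_\lambda:=d_\lambda^{-1}\sum_{\vec n\in\mathbb N^m}\langle\!\langle\vec n,\vec n|P_\lambda|\vec n,\vec n\rangle\!\rangle$. Multi-index factorial $\vec n!:=n_1!\cdots n_m!$. For an $m\times m$ matrix $g$, $g_{\vec n,\vec n'}$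 is the $n\times n$ matrix obtained by taking $n'_j$ copies of the $j$-th column of $g$ and then $n_i$ copies of the $i$-th row of the result; $\mathrm{per}(A)=\sum_{\pi\in S_n}\prod_{i}A_{i,\pi(i)}$. *)

theory Defs
  imports "HOL-Analysis.Analysis" "HOL-Combinatorics.Permutations"
begin

text \<open>Conventions: modes are indexed 1..m; Fock occupation vectors are functions
nat => nat vanishing outside 1..m; m x m matrices are functions nat => nat => complex
vanishing outside 1..m.  GT patterns are functions nat => nat => nat, M i j for
1 <= i <= j <= m, zero elsewhere.\<close>

definition fock :: "nat \<Rightarrow> nat \<Rightarrow> (nat \<Rightarrow> nat) set" where
  "fock m n = {v. (\<forall>i. i \<notin> {1..m} \<longrightarrow> v i = 0) \<and> (\<Sum>i\<in>{1..m}. v i) = n}"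

definition mfact :: "nat \<Rightarrow> (nat \<Rightarrow> nat) \<Rightarrow> nat" where
  "mfact m v = (\<Prod>i\<in>{1..m}. fact (v i))"

type_synonym cmat = "nat \<Rightarrow> nat \<Rightarrow> complex"

definition detm :: "nat \<Rightarrow> cmat \<Rightarrow> complex" where
  "detm m g = (\<Sum>p\<in>{p. p permutes {1..m}}. of_int (sign p) * (\<Prod>i\<in>{1..m}. g i (p i)))"

definition SU :: "nat \<Rightarrow> cmat set" where
  "SU m = {g. (\<forall>i j. (i \<notin> {1..m} \<or> j \<notin> {1..m}) \<longrightarrow> g i j = 0)
            \<and> (\<forall>i\<in>{1..m}. \<forall>j\<in>{1..m}. (\<Sum>l\<in>{1..m}. g i l * cnj (g j l)) = (if i = j then 1 else 0))
            \<and> detm m g = 1}"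

definition words :: "nat \<Rightarrow> nat \<Rightarrow> (nat \<Rightarrow> nat) \<Rightarrow> (nat \<Rightarrow> nat) set" where
  "words m n v = {w \<in> {0..<n} \<rightarrow>\<^sub>E {1..m}. \<forall>i\<in>{1..m}. card {t \<in> {0..<n}. w t = i} = v i}"

text \<open>Passive transformation tau_n^m(g) in the Fock basis: restriction of g^{\<otimes>n} to the
symmetric subspace, |v> being the normalised symmetrisation of the words with occupation v.
(Defined for arbitrary matrices g, i.e. the polynomial extension to gl(m).)\<close>
definition tau :: "nat \<Rightarrow> nat \<Rightarrow> cmat \<Rightarrow> (nat \<Rightarrow> nat) \<Rightarrow> (nat \<Rightarrow> nat) \<Rightarrow> complex" where
  "tau m n g x y = (\<Sum>w\<in>words m n x. \<Sum>w'\<in>words m n y. \<Prod>t\<in>{0..<n}. g (w t) (w' t))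
                   / complex_of_real (sqrt (real (card (words m n x) * card (words m n y))))"

text \<open>Permanent of g_{x,x'}: rows = copies (i,a), a < x i; columns = copies (j,b), b < x' j.\<close>
definition perm_sub :: "nat \<Rightarrow> cmat \<Rightarrow> (nat \<Rightarrow> nat) \<Rightarrow> (nat \<Rightarrow> nat) \<Rightarrow> complex" where
  "perm_sub m g x x' =
     (let R = {(i, a). i \<in> {1..m} \<and> a < x i}; C = {(j, b). j \<in> {1..m} \<and> b < x' j}
      in (\<Sum>\<pi>\<in>{\<pi> \<in> R \<rightarrow>\<^sub>E C. bij_betw \<pi> R C}. \<Prod>r\<in>R. g (fst r) (fst (\<pi> r))))"

type_synonym cvec = "(nat \<Rightarrow> nat) \<times> (nat \<Rightarrow> nat) \<Rightarrow> complex"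

definition dom2 :: "nat \<Rightarrow> nat \<Rightarrow> ((nat \<Rightarrow> nat) \<times> (nat \<Rightarrow> nat)) set" where
  "dom2 m n = fock m n \<times> fock m n"

definition cinner :: "nat \<Rightarrow> nat \<Rightarrow> cvec \<Rightarrow> cvec \<Rightarrow> complex" where
  "cinner m n u v = (\<Sum>z\<in>dom2 m n. cnj (u z) * v z)"

definition unitE :: "nat \<Rightarrow> nat \<Rightarrow> nat \<Rightarrow> complex \<Rightarrow> cmat" where
  "unitE m a b t = (\<lambda>i j. (if i = j \<and> i \<in> {1..m} then 1 else 0) + (if i = a \<and> j = b then t else 0))"

definition dtau :: "nat \<Rightarrow> nat \<Rightarrow> nat \<Rightarrow> nat \<Rightarrow> (nat \<Rightarrow> nat) \<Rightarrow> (nat \<Rightarrow> nat) \<Rightarrow> complex" where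
  "dtau m n a b x y = deriv (\<lambda>t. tau m n (unitE m a b t) x y) 0"

text \<open>Complexified Lie algebra action of E_ab on the vectorised space (tau \<otimes> conj tau):
 d tau(E_ab) \<otimes> 1 - 1 \<otimes> d tau(E_ab)^T.\<close>
definition dRho :: "nat \<Rightarrow> nat \<Rightarrow> nat \<Rightarrow> nat \<Rightarrow> cvec \<Rightarrow> cvec" where
  "dRho m n a b v = (\<lambda>(x, y). if (x, y) \<in> dom2 m n then
      (\<Sum>x'\<in>fock m n. dtau m n a b x x' * v (x', y)) - (\<Sum>y'\<in>fock m n. dtau m n b a y y' * v (x, y'))
    else 0)"

definition hw :: "nat \<Rightarrow> nat \<Rightarrow> nat \<Rightarrow> (nat \<Rightarrow> int) \<Rightarrow> cvec \<Rightarrow> bool" where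
  "hw m n j mu v \<longleftrightarrow> (\<forall>z. z \<notin> dom2 m n \<longrightarrow> v z = 0)
     \<and> (\<forall>a\<in>{1..j}. dRho m n a a v = (\<lambda>z. of_int (mu a) * v z))
     \<and> (\<forall>a b. 1 \<le> a \<longrightarrow> a < b \<longrightarrow> b \<le> j \<longrightarrow> dRho m n a b v = (\<lambda>z. 0))"

inductive_set isocomp :: "nat \<Rightarrow> nat \<Rightarrow> nat \<Rightarrow> (nat \<Rightarrow> int) \<Rightarrow> cvec set"
  for m n j mu where
  base: "hw m n j mu v \<Longrightarrow> v \<in> isocomp m n j mu"
| zero: "(\<lambda>z. 0) \<in> isocomp m n j mu"
| add: "u \<in> isocomp m n j mu \<Longrightarrow> v \<in> isocomp m n j mu \<Longrightarrow> (\<lambda>z. u z + v z) \<in> isocomp m n j mu"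
| smult: "v \<in> isocomp m n j mu \<Longrightarrow> (\<lambda>z. c * v z) \<in> isocomp m n j mu"
| lie: "v \<in> isocomp m n j mu \<Longrightarrow> a \<in> {1..j} \<Longrightarrow> b \<in> {1..j} \<Longrightarrow> dRho m n a b v \<in> isocomp m n j mu"

definition proj :: "nat \<Rightarrow> nat \<Rightarrow> cvec set \<Rightarrow> cvec \<Rightarrow> cvec" where
  "proj m n W x = (THE y. y \<in> W \<and> (\<forall>w\<in>W. cinner m n w (\<lambda>z. x z - y z) = 0))"

definition cindep :: "cvec set \<Rightarrow> bool" where
  "cindep S \<longleftrightarrow> (\<forall>c. (\<forall>z. (\<Sum>v\<in>S. c v * v z) = 0) \<longrightarrow> (\<forall>v\<in>S. c v = 0))"

definition cdim :: "cvec set \<Rightarrow> nat" where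
  "cdim W = (GREATEST c. \<exists>S. S \<subseteq> W \<and> finite S \<and> card S = c \<and> cindep S)"

definition lamk :: "nat \<Rightarrow> nat \<Rightarrow> nat \<Rightarrow> nat" where
  "lamk m k i = (if i = 1 then 2 * k else if 2 \<le> i \<and> i \<le> m - 1 then k else 0)"

text \<open>The lambda_k component of tau \<otimes> conj tau: as a gl(m)-module its highest weight is
lambda_k - k(1,...,1) = (k,0,...,0,-k).\<close>
definition Vlam :: "nat \<Rightarrow> nat \<Rightarrow> nat \<Rightarrow> cvec set" where
  "Vlam m n k = isocomp m n m (\<lambda>i. int (lamk m k i) - int k)"

definition Plam :: "nat \<Rightarrow> nat \<Rightarrow> nat \<Rightarrow> cvec \<Rightarrow> cvec" where
  "Plam m n k = proj m n (Vlam m n k)"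

definition dlam :: "nat \<Rightarrow> nat \<Rightarrow> nat \<Rightarrow> nat" where
  "dlam m n k = cdim (Vlam m n k)"

definition basisv :: "(nat \<Rightarrow> nat) \<Rightarrow> (nat \<Rightarrow> nat) \<Rightarrow> cvec" where
  "basisv x y = (\<lambda>z. if z = (x, y) then 1 else 0)"

definition slam :: "nat \<Rightarrow> nat \<Rightarrow> nat \<Rightarrow> complex" where
  "slam m n k = (\<Sum>x\<in>fock m n. Plam m n k (basisv x x) (x, x)) / of_nat (dlam m n k)"

definition filt :: "nat \<Rightarrow> nat \<Rightarrow> nat \<Rightarrow> (nat \<Rightarrow> nat) \<Rightarrow> (nat \<Rightarrow> nat) \<Rightarrow> cmat \<Rightarrow> complex" where
  "filt m n k n0 x g = (let X = Plam m n k (basisv n0 n0) in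
     (\<Sum>a\<in>fock m n. \<Sum>b\<in>fock m n. tau m n g x a * X (a, b) * cnj (tau m n g x b)) / slam m n k)"

definition GT :: "nat \<Rightarrow> (nat \<Rightarrow> nat) \<Rightarrow> (nat \<Rightarrow> nat \<Rightarrow> nat) set" where
  "GT m lam = {M. (\<forall>i j. \<not> (1 \<le> i \<and> i \<le> j \<and> j \<le> m) \<longrightarrow> M i j = 0)
      \<and> (\<forall>i\<in>{1..m}. M i m = lam i)
      \<and> (\<forall>i j. 1 \<le> i \<longrightarrow> i \<le> j \<longrightarrow> j < m \<longrightarrow> M i j \<le> M i (j + 1) \<and> M (i + 1) (j + 1) \<le> M i j)}"

definition tauhw :: "nat \<Rightarrow> nat \<Rightarrow> nat" where
  "tauhw n i = (if i = 1 then n else 0)"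

definition Npat :: "nat \<Rightarrow> (nat \<Rightarrow> nat) \<Rightarrow> nat \<Rightarrow> nat \<Rightarrow> nat" where
  "Npat m v = (\<lambda>i j. if i = 1 \<and> 1 \<le> j \<and> j \<le> m then (\<Sum>l\<in>{1..j}. v l) else 0)"

definition fockOf :: "nat \<Rightarrow> (nat \<Rightarrow> nat \<Rightarrow> nat) \<Rightarrow> nat \<Rightarrow> nat" where
  "fockOf m N = (\<lambda>j. if 1 \<le> j \<and> j \<le> m then N 1 j - N 1 (j - 1) else 0)"

definition spat :: "(nat \<Rightarrow> nat \<Rightarrow> nat) \<Rightarrow> nat \<Rightarrow> int" where
  "spat M k = (\<Sum>j\<in>{1..k}. \<Sum>i\<in>{1..j}. int (M i j))"

definition Mmax :: "nat \<Rightarrow> (nat \<Rightarrow> nat \<Rightarrow> nat) \<Rightarrow> nat \<Rightarrow> nat \<Rightarrow> nat" where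
  "Mmax m M = (\<lambda>i j. if 1 \<le> i \<and> i \<le> j \<and> j \<le> m then M i m else 0)"

definition phi :: "nat \<Rightarrow> (nat \<Rightarrow> nat \<Rightarrow> nat) \<Rightarrow> int" where
  "phi m M = spat M (m - 1) - spat (Mmax m M) (m - 1)"

definition sgn1 :: "int \<Rightarrow> complex" where
  "sgn1 z = (if even z then 1 else -1)"

text \<open>GT basis vector |M> of lambda_k inside tau \<otimes> conj tau: a unit vector of the lambda_k
component lying, for every j < m, in the gl(j)-component of highest weight
(M_{1,j},...,M_{j,j}) - k (the shift by k accounts for the factor det^{-k}).  Its phase is
fixed to be real in the Fock basis, in accordance with real Condon-Shortley CG coefficients
(the remaining overall sign of |M> does not affect products C^M C^M).\<close>
definition gtvec :: "nat \<Rightarrow> nat \<Rightarrow> nat \<Rightarrow> (nat \<Rightarrow> nat \<Rightarrow> nat) \<Rightarrow> cvec" where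
  "gtvec m n k M = (SOME v. v \<in> Vlam m n k
      \<and> (\<forall>j\<in>{1..m-1}. v \<in> isocomp m n j (\<lambda>i. int (M i j) - int k))
      \<and> cinner m n v v = 1 \<and> (\<forall>z. Im (v z) = 0))"

text \<open>CG coefficient C^M_{N1, bar N2} = <N1, bar N2 | M>, using |N> = (-1)^phi(N) |bar N>.\<close>
definition CG :: "nat \<Rightarrow> nat \<Rightarrow> nat \<Rightarrow> (nat \<Rightarrow> nat \<Rightarrow> nat) \<Rightarrow> (nat \<Rightarrow> nat \<Rightarrow> nat) \<Rightarrow> (nat \<Rightarrow> nat \<Rightarrow> nat) \<Rightarrow> complex" where
  "CG m n k M N1 N2 = cinner m n (\<lambda>z. sgn1 (phi m N2) * basisv (fockOf m N1) (fockOf m N2) z) (gtvec m n k M)"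

definition ptwt :: "(nat \<Rightarrow> nat \<Rightarrow> nat) \<Rightarrow> nat \<Rightarrow> int" where
  "ptwt M j = (\<Sum>i\<in>{1..j}. int (M i j)) - (\<Sum>i\<in>{1..j-1}. int (M i (j - 1)))"

end

theory Submission
  imports Defs "HOL-Library.Function_Algebras"
begin

text \<open>
  The vectorised space is the space of polynomials of bidegree \<open>(n, n)\<close> in \<open>z\<^sub>1, \<dots>, z\<^sub>m\<close> and
  \<open>w\<^sub>1, \<dots>, w\<^sub>m\<close>, with \<open>E\<^sub>a\<^sub>b = z\<^sub>a \<partial>/\<partial>z\<^sub>b - w\<^sub>b \<partial>/\<partial>w\<^sub>a\<close>. The quadratic Casimir operators of the chain
  \<open>gl(1) \<subset> \<dots> \<subset> gl(m)\<close> are self-adjoint, and together with the traces they separate the patterns.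
  For \<open>gl(j)\<close> they are governed by \<open>C\<^sub>j = z\<^sub>1 w\<^sub>1 + \<dots> + z\<^sub>j w\<^sub>j\<close> and the Laplacian
  \<open>\<Delta>\<^sub>j\<close>: on \<open>C\<^sub>j\<^sup>s h\<close> with \<open>h\<close> harmonic of bidegree \<open>(p, q)\<close> the eigenvalues are those of the
  highest weight \<open>(p, 0, \<dots>, 0, -q)\<close>. Harmonic polynomials extended by one pair of variables at a time
  give a real joint eigenvector for every pattern, and these span. Conversely a joint eigenvector lies in the
  corresponding isotypic components, because highest weight vectors generate all polynomials modulo
  \<open>C\<^sub>j\<close>. So the vectors \<open>|M\<rangle>\<close> are an orthonormal basis, unique up to phases, and
  \<open>P \<rho>\<close> is the sum of \<open>\<langle>M|n\<^sub>0,n\<^sub>0\<rangle> |M\<rangle>\<close>, supported on the diagonal. Finally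
  \<open>|\<tau>(g)\<^bsub>x,y\<^esub>|\<^sup>2 = |per|\<^sup>2 / (x! y!)\<close>, and the multiplicities entering \<open>s\<^sub>\<lambda>\<close> follow from Parseval's
  identity for all \<open>n\<close>.
\<close>

section \<open>Oscillator operators\<close>

text \<open>\<open>isocomp\<close> is defined by generation from highest weight vectors,
  \<open>gtvec\<close> by a choice, and \<open>proj\<close> by a definite description, so neither
  existence nor uniqueness of anything is given at the start; eigenvalue equations replace these
  notions. Quadratic Casimirs suffice because only weights of the form (p, 0, ..., 0, -q) occur:
  once the trace p - q is fixed, the eigenvalue is strictly increasing in p. That every joint
  eigenvector lies in its isotypic component is shown without complete reducibility, by an
  orthogonality argument on top of the generation statement. Dimensions come from counting: the
  change of basis from Fock vectors to patterns is unitary for every n, so there are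
  \<open>card (fock m n)\<close> squared patterns with k at most n, and
  \<open>card (fock m n)\<close> of zero weight; subtracting the counts for n = k and n = k - 1
  isolates one k. The free sign of \<open>gtvec\<close> and the signs (-1)^phi enter the filter
  function only in pairs.\<close>

lemma sum_fun_apply: "(\<Sum>i\<in>A. f i) x = (\<Sum>i\<in>A. f i x)"
  for f :: "'a \<Rightarrow> 'b \<Rightarrow> 'c::comm_monoid_add"
  by (induction A rule: infinite_finite_induct) auto

type_synonym occs = "(nat \<Rightarrow> nat) \<times> (nat \<Rightarrow> nat)"

definition csc :: "complex \<Rightarrow> cvec \<Rightarrow> cvec" where
  "csc c f = (\<lambda>z. c * f z)"

lemma csc_apply [simp]: "csc c f z = c * f z"
  by (simp add: csc_def)

interpretation cv: vector_space csc
  by unfold_locales (auto simp: csc_def fun_eq_iff algebra_simps)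

text \<open>Multiplication by \<open>z\<^sub>i\<close>, \<open>\<partial>/\<partial>z\<^sub>i\<close>, multiplication by \<open>w\<^sub>i\<close> and \<open>\<partial>/\<partial>w\<^sub>i\<close>, in terms of the coefficients
with respect to the normalised monomials \<open>z\<^sup>x w\<^sup>y / sqrt (x! y!)\<close>. At \<open>x i = 0\<close> the vanishing square root
hides the truncated subtraction.\<close>

definition Zr :: "nat \<Rightarrow> cvec \<Rightarrow> cvec" where
  "Zr i f = (\<lambda>(x, y). complex_of_real (sqrt (real (x i))) * f (x(i := x i - 1), y))"
definition Dr :: "nat \<Rightarrow> cvec \<Rightarrow> cvec" where
  "Dr i f = (\<lambda>(x, y). complex_of_real (sqrt (real (x i + 1))) * f (x(i := x i + 1), y))"
definition Wr :: "nat \<Rightarrow> cvec \<Rightarrow> cvec" where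
  "Wr i f = (\<lambda>(x, y). complex_of_real (sqrt (real (y i))) * f (x, y(i := y i - 1)))"
definition Br :: "nat \<Rightarrow> cvec \<Rightarrow> cvec" where
  "Br i f = (\<lambda>(x, y). complex_of_real (sqrt (real (y i + 1))) * f (x, y(i := y i + 1)))"

definition lin :: "(cvec \<Rightarrow> cvec) \<Rightarrow> bool" where
  "lin T \<longleftrightarrow> (\<forall>f g. T (f + g) = T f + T g) \<and> (\<forall>c f. T (csc c f) = csc c (T f))"

lemma lin_add: "lin T \<Longrightarrow> T (f + g) = T f + T g"
  by (simp add: lin_def)
lemma lin_csc: "lin T \<Longrightarrow> T (csc c f) = csc c (T f)"
  by (simp add: lin_def)
lemma lin_zero: "lin T \<Longrightarrow> T 0 = 0"
  using lin_csc[of T 0 0] by (simp)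
lemma lin_minus: "lin T \<Longrightarrow> T (- f) = - T f"
  using lin_csc[of T "-1" f] by (simp)
lemma lin_diff: "lin T \<Longrightarrow> T (f - g) = T f - T g"
  using lin_add[of T f "-g"] lin_minus[of T g] by simp
lemma lin_sum: "lin T \<Longrightarrow> T (\<Sum>i\<in>A. f i) = (\<Sum>i\<in>A. T (f i))"
  by (induction A rule: infinite_finite_induct) (auto simp: lin_zero lin_add)

lemma lin_Zr: "lin (Zr i)" and lin_Dr: "lin (Dr i)" and lin_Wr: "lin (Wr i)" and lin_Br: "lin (Br i)"
  by (auto simp: lin_def fun_eq_iff Zr_def Dr_def Wr_def Br_def algebra_simps)

lemma lin_comp: "lin S \<Longrightarrow> lin T \<Longrightarrow> lin (\<lambda>f. S (T f))"
  by (simp add: lin_def)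
lemma lin_sub: "lin S \<Longrightarrow> lin T \<Longrightarrow> lin (\<lambda>f. S f - T f)"
  by (simp add: lin_def cv.scale_right_diff_distrib algebra_simps)
lemma lin_setsum: "(\<And>i. i \<in> A \<Longrightarrow> lin (T i)) \<Longrightarrow> lin (\<lambda>f. \<Sum>i\<in>A. T i f)"
  by (simp add: lin_def cv.scale_sum_right sum.distrib)
lemma lin_pow: "lin T \<Longrightarrow> lin (T ^^ s)"
  by (induction s) (auto simp: lin_def)

lemma Zr_commute: "Zr a (Zr b f) = Zr b (Zr a f)"
  by (cases "a = b") (auto simp: fun_eq_iff Zr_def fun_upd_twist)
lemma Wr_commute: "Wr a (Wr b f) = Wr b (Wr a f)"
  by (cases "a = b") (auto simp: fun_eq_iff Wr_def fun_upd_twist)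
lemma Dr_commute: "Dr a (Dr b f) = Dr b (Dr a f)"
  by (cases "a = b") (auto simp: fun_eq_iff Dr_def fun_upd_twist)
lemma Br_commute: "Br a (Br b f) = Br b (Br a f)"
  by (cases "a = b") (auto simp: fun_eq_iff Br_def fun_upd_twist)
lemma Wr_Zr: "Wr a (Zr b f) = Zr b (Wr a f)"
  and Wr_Dr: "Wr a (Dr b f) = Dr b (Wr a f)"
  and Br_Zr: "Br a (Zr b f) = Zr b (Br a f)"
  and Br_Dr: "Br a (Dr b f) = Dr b (Br a f)"
  by (auto simp: fun_eq_iff Zr_def Dr_def Wr_def Br_def)

lemma sqrt_sq: "complex_of_real (sqrt (real k)) * (complex_of_real (sqrt (real k)) * c) = of_nat k * c"
  by (simp add: mult.assoc[symmetric] flip: of_real_mult)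

lemma Dr_Zr: "Dr a (Zr b f) = Zr b (Dr a f) + (if a = b then f else 0)"
proof (cases "a = b")
  case True
  have "Dr a (Zr a f) (x, y) = (Zr a (Dr a f) + f) (x, y)" for x y
    using sqrt_sq[of "x a + 1" "f (x,y)"] sqrt_sq[of "x a" "f (x,y)"]
    by (cases "x a = 0") (auto simp: Zr_def Dr_def algebra_simps)
  then show ?thesis using True by auto
qed (auto simp: fun_eq_iff Zr_def Dr_def fun_upd_twist)

lemma Br_Wr: "Br a (Wr b f) = Wr b (Br a f) + (if a = b then f else 0)"
proof (cases "a = b")
  case True
  have "Br a (Wr a f) (x, y) = (Wr a (Br a f) + f) (x, y)" for x y
    using sqrt_sq[of "y a + 1" "f (x,y)"] sqrt_sq[of "y a" "f (x,y)"]
    by (cases "y a = 0") (auto simp: Wr_def Br_def algebra_simps)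
  then show ?thesis using True by auto
qed (auto simp: fun_eq_iff Wr_def Br_def fun_upd_twist)

lemma ZD_apply: "Zr a (Dr a f) (x, y) = of_nat (x a) * f (x, y)"
  using sqrt_sq[of "x a" "f (x,y)"]
  by (cases "x a = 0") (auto simp: Zr_def Dr_def)
lemma WB_apply: "Wr a (Br a f) (x, y) = of_nat (y a) * f (x, y)"
  using sqrt_sq[of "y a" "f (x,y)"]
  by (cases "y a = 0") (auto simp: Wr_def Br_def)

section \<open>The gl(m) action, its Casimir operators and the Laplacians\<close>

definition Eop :: "nat \<Rightarrow> nat \<Rightarrow> cvec \<Rightarrow> cvec" where
  "Eop a b f = Zr a (Dr b f) - Wr b (Br a f)"
definition Cop :: "nat \<Rightarrow> cvec \<Rightarrow> cvec" where
  "Cop j f = (\<Sum>i\<in>{1..j}. Zr i (Wr i f))"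
definition Lap :: "nat \<Rightarrow> cvec \<Rightarrow> cvec" where
  "Lap j f = (\<Sum>i\<in>{1..j}. Dr i (Br i f))"
definition Nz :: "nat \<Rightarrow> cvec \<Rightarrow> cvec" where
  "Nz j f = (\<Sum>i\<in>{1..j}. Zr i (Dr i f))"
definition Nw :: "nat \<Rightarrow> cvec \<Rightarrow> cvec" where
  "Nw j f = (\<Sum>i\<in>{1..j}. Wr i (Br i f))"
definition Cas :: "nat \<Rightarrow> cvec \<Rightarrow> cvec" where
  "Cas j f = (\<Sum>a\<in>{1..j}. \<Sum>b\<in>{1..j}. Eop a b (Eop b a f))"
definition C1 :: "nat \<Rightarrow> cvec \<Rightarrow> cvec" where
  "C1 j f = (\<Sum>a\<in>{1..j}. Eop a a f)"

lemma lin_Eop: "lin (Eop a b)"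
  unfolding Eop_def by (intro lin_sub lin_comp[OF lin_Zr] lin_comp[OF lin_Wr] lin_Dr lin_Br)
lemma lin_Cop: "lin (Cop j)"
  unfolding Cop_def by (intro lin_setsum lin_comp[OF lin_Zr] lin_Wr)
lemma lin_Lap: "lin (Lap j)"
  unfolding Lap_def by (intro lin_setsum lin_comp[OF lin_Dr] lin_Br)
lemma lin_Cas: "lin (Cas j)"
  unfolding Cas_def by (intro lin_setsum lin_comp[OF lin_Eop] lin_Eop)
lemma lin_C1: "lin (C1 j)"
  unfolding C1_def by (intro lin_setsum lin_Eop)
lemma lin_Nz: "lin (Nz j)"
  unfolding Nz_def by (intro lin_setsum lin_comp[OF lin_Zr] lin_Dr)
lemma lin_Nw: "lin (Nw j)"
  unfolding Nw_def by (intro lin_setsum lin_comp[OF lin_Wr] lin_Br)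

lemmas lins = lin_Zr lin_Dr lin_Wr lin_Br lin_Eop lin_Cop lin_Lap lin_Cas lin_C1 lin_Nz lin_Nw
lemmas linear_simps =
  lins[THEN lin_add] lins[THEN lin_csc] lins[THEN lin_zero] lins[THEN lin_diff] lins[THEN lin_sum]

lemma Eop_commutator: "Eop a b (Eop c d f) = Eop c d (Eop a b f)
   + (if b = c then Eop a d f else 0) - (if a = d then Eop c b f else 0)"
  unfolding Eop_def
  by (simp add: linear_simps Dr_Zr Br_Wr Wr_Zr Wr_Dr Br_Zr Br_Dr Zr_commute[of a c] Wr_commute[of b d] Dr_commute[of b d] Br_commute[of a c])

lemma Eop_Zr: "Eop a b (Zr i f) = Zr i (Eop a b f) + (if b = i then Zr a f else 0)"
  unfolding Eop_def by (simp add: linear_simps Dr_Zr Br_Zr Wr_Zr Zr_commute[of a i])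
lemma Eop_Wr: "Eop a b (Wr i f) = Wr i (Eop a b f) - (if a = i then Wr b f else 0)"
  unfolding Eop_def by (simp add: linear_simps Br_Wr Wr_Dr Wr_Zr Wr_commute[of b i] flip: Wr_Zr Wr_Dr)

lemma Eop_Cop:
  assumes "a \<in> {1..j}" "b \<in> {1..j}"
  shows "Eop a b (Cop j f) = Cop j (Eop a b f)"
proof -
  have "Eop a b (Cop j f) = (\<Sum>i\<in>{1..j}. Eop a b (Zr i (Wr i f)))"
    by (simp add: Cop_def linear_simps)
  also have "\<dots> = (\<Sum>i\<in>{1..j}. Zr i (Wr i (Eop a b f)) + ((if b = i then Zr a (Wr i f) else 0)
      - (if a = i then Zr i (Wr b f) else 0)))"
    by (intro sum.cong refl) (simp add: Eop_Zr Eop_Wr linear_simps)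
  also have "\<dots> = Cop j (Eop a b f)"
    using assms by (simp add: sum.distrib sum_subtractf Cop_def)
  finally show ?thesis .
qed

lemma Eop_Cas:
  assumes "c \<in> {1..j}" "d \<in> {1..j}"
  shows "Eop c d (Cas j f) = Cas j (Eop c d f)"
proof -
  have "Eop c d (Eop a b (Eop b a f)) = Eop a b (Eop b a (Eop c d f))
     + (if d = b then Eop a b (Eop c a f) else 0) - (if c = a then Eop a b (Eop b d f) else 0)
     + (if d = a then Eop c b (Eop b a f) else 0) - (if c = b then Eop a d (Eop b a f) else 0)" for a b
    by (subst Eop_commutator[of c d]) (auto simp: Eop_commutator[of c d] linear_simps)
  then have "Eop c d (Cas j f) = (\<Sum>a\<in>{1..j}. \<Sum>b\<in>{1..j}. Eop a b (Eop b a (Eop c d f))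
     + (if d = b then Eop a b (Eop c a f) else 0) - (if c = a then Eop a b (Eop b d f) else 0)
     + (if d = a then Eop c b (Eop b a f) else 0) - (if c = b then Eop a d (Eop b a f) else 0))"
    by (simp add: Cas_def linear_simps)
  also have "\<dots> = Cas j (Eop c d f) + (\<Sum>a\<in>{1..j}. Eop a d (Eop c a f))
      - (\<Sum>a\<in>{1..j}. \<Sum>b\<in>{1..j}. if c = a then Eop a b (Eop b d f) else 0)
      + (\<Sum>a\<in>{1..j}. \<Sum>b\<in>{1..j}. if d = a then Eop c b (Eop b a f) else 0)
      - (\<Sum>a\<in>{1..j}. Eop a d (Eop c a f))"
    using assms by (simp add: sum.distrib sum_subtractf Cas_def)
  also have "\<dots> = Cas j (Eop c d f)"
    \<comment> \<open>Both remaining double sums collapse to the sum over b of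
      \<open>Eop c b (Eop b d f)\<close>, with opposite signs.\<close>
    using assms by (subst (1 2) sum.swap) simp
  finally show ?thesis .
qed

lemma Eop_C1:
  assumes "c \<in> {1..j}" "d \<in> {1..j}"
  shows "Eop c d (C1 j f) = C1 j (Eop c d f)"
  using assms by (simp add: C1_def linear_simps Eop_commutator[of c d] sum.distrib sum_subtractf)

lemma Cas_Cop: "i \<le> j \<Longrightarrow> Cas i (Cop j f) = Cop j (Cas i f)"
  by (auto simp: Cas_def linear_simps Eop_Cop intro!: sum.cong)
lemma C1_Cop: "i \<le> j \<Longrightarrow> C1 i (Cop j f) = Cop j (C1 i f)"
  by (auto simp: C1_def linear_simps Eop_Cop intro!: sum.cong)
lemma Cas_Zr: "j < i \<Longrightarrow> Cas j (Zr i f) = Zr i (Cas j f)"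
  by (auto simp: Cas_def linear_simps Eop_Zr intro!: sum.cong)
lemma C1_Zr: "j < i \<Longrightarrow> C1 j (Zr i f) = Zr i (C1 j f)"
  by (auto simp: C1_def linear_simps Eop_Zr intro!: sum.cong)
lemma Cas_Wr: "j < i \<Longrightarrow> Cas j (Wr i f) = Wr i (Cas j f)"
  by (auto simp: Cas_def linear_simps Eop_Wr intro!: sum.cong)
lemma C1_Wr: "j < i \<Longrightarrow> C1 j (Wr i f) = Wr i (C1 j f)"
  by (auto simp: C1_def linear_simps Eop_Wr intro!: sum.cong)

lemma C1_conv: "C1 j f = Nz j f - Nw j f"
  by (simp add: C1_def Nz_def Nw_def Eop_def sum_subtractf)

lemma Nz_apply: "Nz j f (x, y) = of_nat (\<Sum>i\<in>{1..j}. x i) * f (x, y)"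
  by (simp add: Nz_def sum_fun_apply ZD_apply sum_distrib_right)
lemma Nw_apply: "Nw j f (x, y) = of_nat (\<Sum>i\<in>{1..j}. y i) * f (x, y)"
  by (simp add: Nw_def sum_fun_apply WB_apply sum_distrib_right)

lemma csc_of_nat_sum: "(\<Sum>i\<in>A. f) = csc (of_nat (card A)) f" for f :: cvec
  by (auto simp: fun_eq_iff sum_fun_apply)

text \<open>Normal ordering. The number operators stay grouped as \<open>Zr a (Dr a _)\<close> and
  \<open>Wr a (Br a _)\<close>, so that summation over a and b produces iterates of
  \<open>Nz\<close> and \<open>Nw\<close>, while the mixed terms assemble to \<open>Cop\<close>
  after \<open>Lap\<close>.\<close>

lemma Eop_Eop: "Eop a b (Eop b a f) = Zr a (Dr a (Zr b (Dr b f))) - (if a = b then Zr a (Dr a f) else 0) + Zr a (Dr a f)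
   + (Wr a (Br a (Wr b (Br b f))) - (if a = b then Wr a (Br a f) else 0) + Wr b (Br b f))
   - Zr a (Wr a (Dr b (Br b f))) - Zr b (Wr b (Dr a (Br a f)))"
proof -
  have "Eop a b (Eop b a f) = Zr a (Dr b (Zr b (Dr a f))) - Zr a (Dr b (Wr a (Br b f)))
      - Wr b (Br a (Zr b (Dr a f))) + Wr b (Br a (Wr a (Br b f)))"
    by (simp add: Eop_def linear_simps algebra_simps)
  moreover have "Zr a (Dr b (Zr b (Dr a f))) = Zr a (Dr a (Zr b (Dr b f))) - (if a = b then Zr a (Dr a f) else 0) + Zr a (Dr a f)"
    by (simp add: Dr_Zr linear_simps Dr_commute[of b a])
  moreover have "Wr b (Br a (Wr a (Br b f))) = Wr a (Br a (Wr b (Br b f))) - (if a = b then Wr a (Br a f) else 0) + Wr b (Br b f)"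
    by (simp add: Br_Wr linear_simps Br_commute[of b a] Wr_commute[of b a])
  moreover have "Zr a (Dr b (Wr a (Br b f))) = Zr a (Wr a (Dr b (Br b f)))"
    by (simp flip: Wr_Dr)
  moreover have "Wr b (Br a (Zr b (Dr a f))) = Zr b (Wr b (Dr a (Br a f)))"
    by (simp add: Br_Zr Br_Dr Wr_Zr)
  ultimately show ?thesis by simp
qed

text \<open>A Capelli-type identity: on the kernel of the Laplacian the Casimir is a function of the
  bidegree alone, which is why harmonic polynomials are Casimir eigenvectors.\<close>

lemma Cas_conv:
  "Cas j f = Nz j (Nz j f) + csc (of_nat j - 1) (Nz j f) + (Nw j (Nw j f) + csc (of_nat j - 1) (Nw j f))
     - csc 2 (Cop j (Lap j f))"
proof -
  have sw: "(\<Sum>a\<in>{1..j}. \<Sum>b\<in>{1..j}. Zr b (Wr b (Dr a (Br a f)))) = Cop j (Lap j f)"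
    by (subst sum.swap) (simp add: Cop_def Lap_def linear_simps)
  have c: "(\<Sum>a\<in>{1..j}. \<Sum>b\<in>{1..j}. Zr a (Dr a f)) = csc (of_nat j) (Nz j f)"
    by (simp add: Nz_def csc_of_nat_sum cv.scale_sum_right del: sum_constant)
  have "Cas j f = Nz j (Nz j f) - Nz j f + csc (of_nat j) (Nz j f)
      + (Nw j (Nw j f) - Nw j f + csc (of_nat j) (Nw j f)) - Cop j (Lap j f) - Cop j (Lap j f)"
    unfolding Cas_def Eop_Eop sum.distrib sum_subtractf sw c
    by (simp add: csc_of_nat_sum del: sum_constant) (simp add: Nz_def Nw_def Cop_def Lap_def linear_simps)
  then show ?thesis
    by (simp add: fun_eq_iff algebra_simps)
qed

text \<open>Multiplication by C_j and the Laplacian generate an sl(2) commuting with gl(j); the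
  commutator is the total degree shifted by j.\<close>

lemma Lap_Cop: "Lap j (Cop j f) = Cop j (Lap j f) + Nz j f + Nw j f + csc (of_nat j) f"
proof -
  have "Dr i (Br i (Zr l (Wr l f))) = Zr l (Wr l (Dr i (Br i f)))
     + (if i = l then Zr i (Dr i f) + Wr i (Br i f) + f else 0)" for i l
    by (simp add: Br_Zr Br_Wr Dr_Zr Wr_Dr[symmetric] linear_simps)
  then have "Lap j (Cop j f) = (\<Sum>i\<in>{1..j}. \<Sum>l\<in>{1..j}. Zr l (Wr l (Dr i (Br i f)))
     + (if i = l then Zr i (Dr i f) + Wr i (Br i f) + f else 0))"
    by (simp add: Lap_def Cop_def linear_simps)
  also have "\<dots> = (\<Sum>l\<in>{1..j}. \<Sum>i\<in>{1..j}. Zr l (Wr l (Dr i (Br i f)))) + Nz j f + Nw j f + csc (of_nat j) f"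
    by (subst sum.swap) (simp add: sum.distrib Nz_def Nw_def csc_of_nat_sum del: sum_constant)
  finally show ?thesis by (simp add: Cop_def Lap_def linear_simps)
qed

lemma Cop_Zr: "Cop j (Zr i f) = Zr i (Cop j f)"
  by (auto simp: Cop_def linear_simps Zr_commute[of _ i] Wr_Zr intro!: sum.cong)
lemma Cop_Wr: "Cop j (Wr i f) = Wr i (Cop j f)"
  by (auto simp: Cop_def linear_simps Wr_commute[of _ i] Wr_Zr intro!: sum.cong)
lemma Cop_Suc: "Cop (Suc j) f = Cop j f + Zr (Suc j) (Wr (Suc j) f)"
  by (simp add: Cop_def)
lemma Lap_Suc: "Lap (Suc j) f = Lap j f + Dr (Suc j) (Br (Suc j) f)"
  by (simp add: Lap_def)
lemma Lap_Zr: "j < i \<Longrightarrow> Lap j (Zr i f) = Zr i (Lap j f)"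
  by (auto simp: Lap_def linear_simps Dr_Zr Br_Zr intro!: sum.cong)
lemma Lap_Wr: "j < i \<Longrightarrow> Lap j (Wr i f) = Wr i (Lap j f)"
  by (auto simp: Lap_def linear_simps Br_Wr Wr_Dr[symmetric] intro!: sum.cong)

text \<open>As a polynomial, \<open>f\<close> has bidegree \<open>(p, q)\<close> and involves only \<open>z\<^sub>1, \<dots>, z\<^sub>j, w\<^sub>1, \<dots>, w\<^sub>j\<close>.\<close>

definition homp :: "nat \<Rightarrow> nat \<Rightarrow> nat \<Rightarrow> cvec \<Rightarrow> bool" where
  "homp j p q f \<longleftrightarrow> (\<forall>x y. f (x, y) \<noteq> 0 \<longrightarrow> x \<in> fock j p \<and> y \<in> fock j q)"

lemma homp_zero: "homp j p q 0"
  and homp_add: "homp j p q f \<Longrightarrow> homp j p q g \<Longrightarrow> homp j p q (f + g)"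
  and homp_diff: "homp j p q f \<Longrightarrow> homp j p q g \<Longrightarrow> homp j p q (f - g)"
  and homp_csc: "homp j p q f \<Longrightarrow> homp j p q (csc c f)"
  by (auto simp: homp_def) (metis add_cancel_right_left diff_0_right)+

lemma homp_sum: "(\<And>i. i \<in> A \<Longrightarrow> homp j p q (f i)) \<Longrightarrow> homp j p q (\<Sum>i\<in>A. f i)"
  by (induction A rule: infinite_finite_induct) (auto simp: homp_zero homp_add)

lemma fock_mono: "x \<in> fock j p \<Longrightarrow> j \<le> j' \<Longrightarrow> x \<in> fock j' p"
proof -
  assume a: "x \<in> fock j p" "j \<le> j'"
  have "(\<Sum>i\<in>{1..j'}. x i) = (\<Sum>i\<in>{1..j}. x i)"
    using a by (intro sum.mono_neutral_right) (auto simp: fock_def)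
  then show ?thesis using a by (auto simp: fock_def)
qed

lemma homp_mono: "homp j p q f \<Longrightarrow> j \<le> j' \<Longrightarrow> homp j' p q f"
  unfolding homp_def by (meson fock_mono)

lemma sum_fun_upd:
  fixes x :: "nat \<Rightarrow> nat"
  assumes "i \<in> {1..j}"
  shows "(\<Sum>l\<in>{1..j}. (x(i := c)) l) + x i = (\<Sum>l\<in>{1..j}. x l) + c"
proof -
  have "sum (x(i := c)) {1..j} = c + sum x ({1..j} - {i})"
    using assms by (subst sum.remove[of _ i]) auto
  then show ?thesis using assms by (simp add: sum.remove[of "{Suc 0..j}" i x])
qed

lemma fock_dec:
  assumes "x(i := x i - 1) \<in> fock j p" "x i > 0" "i \<in> {1..j}"
  shows "x \<in> fock j (Suc p)"
  using assms sum_fun_upd[of i j x "x i - 1"] by (auto simp: fock_def split: if_splits)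

lemma homp_Zr: "homp j p q f \<Longrightarrow> i \<in> {1..j} \<Longrightarrow> homp j (Suc p) q (Zr i f)"
  using fock_dec by (fastforce simp: homp_def Zr_def)
lemma homp_Wr: "homp j p q f \<Longrightarrow> i \<in> {1..j} \<Longrightarrow> homp j p (Suc q) (Wr i f)"
  using fock_dec by (fastforce simp: homp_def Wr_def)

lemma homp_Nz: "homp j p q f \<Longrightarrow> Nz j f = csc (of_nat p) f"
  by (force simp: fun_eq_iff Nz_apply homp_def fock_def simp del: of_nat_sum)
lemma homp_Nw: "homp j p q f \<Longrightarrow> Nw j f = csc (of_nat q) f"
  by (force simp: fun_eq_iff Nw_apply homp_def fock_def simp del: of_nat_sum)

text \<open>Reality is tracked through all constructions because the choice in \<open>gtvec\<close>
  asks for a vector with real coefficients.\<close>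

definition rl :: "cvec \<Rightarrow> bool" where "rl f \<longleftrightarrow> (\<forall>z. Im (f z) = 0)"

lemma rl_zero: "rl 0" and rl_add: "rl f \<Longrightarrow> rl g \<Longrightarrow> rl (f + g)"
  and rl_csc: "rl f \<Longrightarrow> rl (csc (of_real c) f)"
  and rl_Zr: "rl f \<Longrightarrow> rl (Zr i f)" and rl_Wr: "rl f \<Longrightarrow> rl (Wr i f)"
  by (auto simp: rl_def Zr_def Wr_def)
lemma rl_sum: "(\<And>i. i \<in> A \<Longrightarrow> rl (f i)) \<Longrightarrow> rl (\<Sum>i\<in>A. f i)"
  by (induction A rule: infinite_finite_induct) (auto simp: rl_zero rl_add)
lemma rl_Cop: "rl f \<Longrightarrow> rl (Cop j f)"
  unfolding Cop_def by (intro rl_sum rl_Zr rl_Wr)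

lemma Zr_inj: "Zr i f = 0 \<Longrightarrow> f = 0"
proof (rule ext)
  fix z :: occs assume a: "Zr i f = 0"
  obtain x y where z: "z = (x, y)" by force
  have "Zr i f (x(i := Suc (x i)), y) = 0" using a by simp
  then show "f z = 0 z" by (simp add: Zr_def z)
qed
lemma Wr_inj: "Wr i f = 0 \<Longrightarrow> f = 0"
proof (rule ext)
  fix z :: occs assume a: "Wr i f = 0"
  obtain x y where z: "z = (x, y)" by force
  have "Wr i f (x, y(i := Suc (y i))) = 0" using a by simp
  then show "f z = 0 z" by (simp add: Wr_def z)
qed

section \<open>Words, permanents and the derivative of \<open>\<tau>\<close>\<close>

lemma finite_words: "finite (words m n v)"
  unfolding words_def by (rule finite_subset[of _ "{0..<n} \<rightarrow>\<^sub>E {1..m}"]) (auto intro: finite_PiE)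

lemma words_range: "w \<in> words m n v \<Longrightarrow> t < n \<Longrightarrow> w t \<in> {1..m}"
  unfolding words_def by (auto simp: PiE_iff)

lemma words_count: "w \<in> words m n v \<Longrightarrow> i \<in> {1..m} \<Longrightarrow> card {t\<in>{0..<n}. w t = i} = v i"
  unfolding words_def by auto

lemma card_bij_funcset:
  assumes "finite A" "finite B" "card A = card B"
  shows "card {f \<in> A \<rightarrow>\<^sub>E B. bij_betw f A B} = fact (card A)"
proof -
  have "{f \<in> A \<rightarrow>\<^sub>E B. bij_betw f A B} = {f \<in> A \<rightarrow>\<^sub>E B. inj_on f A}"
  proof -
    have "f ` A = B" if "f \<in> A \<rightarrow>\<^sub>E B" "inj_on f A" for f
      using that assms by (intro card_subset_eq) (auto simp: card_image)
    then show ?thesis by (auto simp: bij_betw_def)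
  qed
  also have "card \<dots> = fact (card A)"
    using card_inj_on_subset_funcset[OF assms(1,2) subset_refl] assms(3) by (simp add: fact_prod_rev)
  finally show ?thesis .
qed

text \<open>The letter \<open>t\<close> of a word is to be sent to a copy \<open>(w t, _)\<close> of itself; choosing these copies
amounts to numbering, for every \<open>i\<close>, the \<open>v i\<close> occurrences of \<open>i\<close>.\<close>

lemma card_word_lifts:
  assumes w: "w \<in> words m n v"
  defines "C \<equiv> {(i, a). i \<in> {1..m} \<and> a < v i}"
  shows "card {\<gamma> \<in> {0..<n} \<rightarrow>\<^sub>E C. bij_betw \<gamma> {0..<n} C \<and> (\<forall>t<n. fst (\<gamma> t) = w t)} = mfact m v"
proof -
  define T where "T i = {t\<in>{0..<n}. w t = i}" for i
  define B where "B i = {f \<in> T i \<rightarrow>\<^sub>E {..<v i}. bij_betw f (T i) {..<v i}}" for i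
  have cardB: "card (B i) = fact (v i)" if "i \<in> {1..m}" for i
    using card_bij_funcset[of "T i" "{..<v i}"] words_count[OF w that] by (simp add: B_def T_def)
  have wr: "w t \<in> {1..m}" if "t < n" for t using words_range[OF w that] .
  let ?F = "{\<gamma> \<in> {0..<n} \<rightarrow>\<^sub>E C. bij_betw \<gamma> {0..<n} C \<and> (\<forall>t<n. fst (\<gamma> t) = w t)}"
  let ?enc = "\<lambda>\<gamma>. \<lambda>i\<in>{1..m}. \<lambda>t\<in>T i. snd (\<gamma> t)"
  let ?dec = "\<lambda>\<beta>. \<lambda>t\<in>{0..<n}. (w t, \<beta> (w t) t)"
  have "bij_betw ?enc ?F (PiE {1..m} B)"
  proof (rule bij_betw_byWitness[where f' = ?dec])
    show "\<forall>\<gamma>\<in>?F. ?dec (?enc \<gamma>) = \<gamma>"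
    proof
      fix \<gamma> assume g: "\<gamma> \<in> ?F"
      show "?dec (?enc \<gamma>) = \<gamma>"
      proof
        fix t show "?dec (?enc \<gamma>) t = \<gamma> t"
          using g wr[of t] by (cases "t < n") (auto simp: T_def PiE_iff extensional_def prod_eq_iff)
      qed
    qed
    show "\<forall>\<beta>\<in>PiE {1..m} B. ?enc (?dec \<beta>) = \<beta>"
    proof
      fix \<beta> assume b: "\<beta> \<in> PiE {1..m} B"
      show "?enc (?dec \<beta>) = \<beta>"
      proof (intro ext)
        fix i t show "?enc (?dec \<beta>) i t = \<beta> i t"
        proof (cases "i \<in> {1..m}")
          case True
          then have "\<beta> i \<in> extensional (T i)" using b by (auto simp: PiE_iff B_def)
          then show ?thesis using True by (auto simp: T_def extensional_def)
        qed (use b in \<open>auto simp: PiE_iff extensional_def\<close>)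
      qed
    qed
    show "?enc ` ?F \<subseteq> PiE {1..m} B"
    proof (rule image_subsetI)
      fix \<gamma> assume g: "\<gamma> \<in> ?F"
      have "(\<lambda>t\<in>T i. snd (\<gamma> t)) \<in> B i" if i: "i \<in> {1..m}" for i
      proof -
        have mem: "snd (\<gamma> t) < v i" if "t \<in> T i" for t
        proof -
          have "\<gamma> t \<in> C" "fst (\<gamma> t) = i" using that g by (auto simp: T_def PiE_iff)
          then show ?thesis by (auto simp: C_def)
        qed
        have "bij_betw (\<lambda>t. snd (\<gamma> t)) (T i) {..<v i}"
          unfolding bij_betw_def
        proof
          have inj: "inj_on \<gamma> {0..<n}" using g by (auto simp: bij_betw_def)
          show "inj_on (\<lambda>t. snd (\<gamma> t)) (T i)"
          proof (rule inj_onI)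
            fix s t assume st: "s \<in> T i" "t \<in> T i" "snd (\<gamma> s) = snd (\<gamma> t)"
            then have "\<gamma> s = \<gamma> t" using g by (auto simp: T_def prod_eq_iff)
            then show "s = t" using inj st by (auto simp: inj_on_def T_def)
          qed
          show "(\<lambda>t. snd (\<gamma> t)) ` T i = {..<v i}"
          proof
            show "{..<v i} \<subseteq> (\<lambda>t. snd (\<gamma> t)) ` T i"
            proof
              fix a assume "a \<in> {..<v i}"
              then have "(i, a) \<in> C" using i by (auto simp: C_def)
              then obtain t where t: "t \<in> {0..<n}" "\<gamma> t = (i, a)" using g by (auto simp: bij_betw_def image_iff)
              then have "t \<in> T i" using g by (auto simp: T_def)
              then show "a \<in> (\<lambda>t. snd (\<gamma> t)) ` T i" using t by force
            qed
          qed (use mem in auto)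
        qed
        then show ?thesis using mem by (auto simp: B_def cong: bij_betw_cong)
      qed
      then show "?enc \<gamma> \<in> PiE {1..m} B" by auto
    qed
    show "?dec ` PiE {1..m} B \<subseteq> ?F"
    proof (rule image_subsetI)
      fix \<beta> assume b: "\<beta> \<in> PiE {1..m} B"
      have bb: "bij_betw (\<beta> i) (T i) {..<v i}" if "i \<in> {1..m}" for i
        using b that by (auto simp: PiE_iff B_def)
      let ?g = "\<lambda>t\<in>{0..<n}. (w t, \<beta> (w t) t)"
      have tT: "t \<in> T (w t)" if "t < n" for t using that by (auto simp: T_def)
      have mem: "?g t \<in> C" if "t < n" for t
        using bb[OF wr[OF that]] wr[OF that] tT[OF that] that by (auto simp: C_def bij_betw_def)
      have "bij_betw ?g {0..<n} C"
        unfolding bij_betw_def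
      proof
        show "inj_on ?g {0..<n}"
        proof (rule inj_onI)
          fix s t assume st: "s \<in> {0..<n}" "t \<in> {0..<n}" "?g s = ?g t"
          then have e: "w s = w t" "\<beta> (w t) s = \<beta> (w t) t" by auto
          have "inj_on (\<beta> (w t)) (T (w t))" using bb wr st by (auto simp: bij_betw_def)
          then show "s = t" using e st tT by (metis atLeastLessThan_iff inj_onD)
        qed
        show "?g ` {0..<n} = C"
        proof
          show "C \<subseteq> ?g ` {0..<n}"
          proof
            fix z assume "z \<in> C"
            then obtain i a where z: "z = (i, a)" "i \<in> {1..m}" "a < v i" by (auto simp: C_def)
            then obtain t where "t \<in> T i" "\<beta> i t = a" using bb[of i] by (auto simp: bij_betw_def image_iff) (metis imageE lessThan_iff)
            then show "z \<in> ?g ` {0..<n}" using z by (force simp: T_def image_iff)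
          qed
        qed (use mem in auto)
      qed
      then show "?g \<in> ?F" using mem by auto
    qed
  qed
  then have "card ?F = card (PiE {1..m} B)" by (rule bij_betw_same_card)
  also have "\<dots> = (\<Prod>i\<in>{1..m}. fact (v i))"
    by (simp only: card_PiE finite_atLeastAtMost cardB cong: prod.cong)
  finally show ?thesis by (simp add: mfact_def)
qed

lemma fst_bij_word:
  assumes v: "v \<in> fock m n"
  defines "C \<equiv> {(i, a). i \<in> {1..m} \<and> a < v i}"
  assumes g: "\<gamma> \<in> {0..<n} \<rightarrow>\<^sub>E C" "bij_betw \<gamma> {0..<n} C"
  shows "(\<lambda>t\<in>{0..<n}. fst (\<gamma> t)) \<in> words m n v"
proof -
  have mem: "\<gamma> t \<in> C" if "t < n" for t using g that by auto
  have "card {t\<in>{0..<n}. fst (\<gamma> t) = i} = v i" if i: "i \<in> {1..m}" for i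
  proof -
    have "bij_betw \<gamma> {t\<in>{0..<n}. fst (\<gamma> t) = i} ({i} \<times> {..<v i})"
    proof (rule bij_betw_subset[OF g(2)])
      show "\<gamma> ` {t\<in>{0..<n}. fst (\<gamma> t) = i} = {i} \<times> {..<v i}"
      proof
        show "\<gamma> ` {t\<in>{0..<n}. fst (\<gamma> t) = i} \<subseteq> {i} \<times> {..<v i}"
        proof (rule image_subsetI)
          fix t assume "t \<in> {t\<in>{0..<n}. fst (\<gamma> t) = i}"
          then show "\<gamma> t \<in> {i} \<times> {..<v i}" using mem[of t] by (cases "\<gamma> t") (auto simp: C_def)
        qed
        show "{i} \<times> {..<v i} \<subseteq> \<gamma> ` {t\<in>{0..<n}. fst (\<gamma> t) = i}"
        proof
          fix z assume z: "z \<in> {i} \<times> {..<v i}"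
          then have "z \<in> \<gamma> ` {0..<n}" using i g(2) by (auto simp: C_def bij_betw_def)
          then obtain t where "z = \<gamma> t" "t \<in> {0..<n}" by auto
          then have "z = \<gamma> t" "t \<in> {t\<in>{0..<n}. fst (\<gamma> t) = i}" using z by auto
          then show "z \<in> \<gamma> ` {t\<in>{0..<n}. fst (\<gamma> t) = i}" by (rule image_eqI)
        qed
      qed
    qed auto
    then show ?thesis by (auto dest: bij_betw_same_card)
  qed
  moreover have "{t \<in> {0..<n}. (\<lambda>t\<in>{0..<n}. fst (\<gamma> t)) t = i} = {t\<in>{0..<n}. fst (\<gamma> t) = i}" for i by auto
  ultimately show ?thesis using mem by (fastforce simp: words_def C_def simp del: restrict_apply)
qed

lemma card_copies:
  assumes v: "v \<in> fock m n"
  shows "finite {(i, a). i \<in> {1..m} \<and> a < v i}" "card {(i, a). i \<in> {1..m} \<and> a < v i} = n"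
proof -
  have e: "{(i, a). i \<in> {1..m} \<and> a < v i} = Sigma {1..m} (\<lambda>i. {..<v i})" by auto
  show "finite {(i, a). i \<in> {1..m} \<and> a < v i}" unfolding e by auto
  show "card {(i, a). i \<in> {1..m} \<and> a < v i} = n" unfolding e using v by (subst card_SigmaI) (auto simp: fock_def)
qed

text \<open>Bijections onto the copies are grouped by the word they spell; by
  \<open>card_word_lifts\<close> each fibre has \<open>mfact m v\<close> elements. This is where the
  factorials of the final formula originate.\<close>

lemma sum_bij_words:
  fixes F :: "(nat \<Rightarrow> nat) \<Rightarrow> complex"
  assumes v: "v \<in> fock m n"
  defines "C \<equiv> {(i, a). i \<in> {1..m} \<and> a < v i}"
  shows "(\<Sum>\<gamma>\<in>{\<gamma> \<in> {0..<n} \<rightarrow>\<^sub>E C. bij_betw \<gamma> {0..<n} C}. F (\<lambda>t\<in>{0..<n}. fst (\<gamma> t)))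
     = of_nat (mfact m v) * (\<Sum>w\<in>words m n v. F w)"
proof -
  let ?G = "{\<gamma> \<in> {0..<n} \<rightarrow>\<^sub>E C. bij_betw \<gamma> {0..<n} C}"
  let ?h = "\<lambda>\<gamma>. \<lambda>t\<in>{0..<n}. fst (\<gamma> t)"
  have finC: "finite C" using card_copies[OF v] by (simp add: C_def)
  have fin: "finite ?G" using finC by (intro finite_subset[of ?G "{0..<n} \<rightarrow>\<^sub>E C"] finite_PiE) auto
  have sub: "?h ` ?G \<subseteq> words m n v" using fst_bij_word[OF v] by (auto simp: C_def)
  have "(\<Sum>\<gamma>\<in>?G. F (?h \<gamma>)) = (\<Sum>w\<in>words m n v. \<Sum>\<gamma>\<in>{\<gamma>\<in>?G. ?h \<gamma> = w}. F (?h \<gamma>))"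
    by (rule sum.group[symmetric, OF fin finite_words sub])
  also have "\<dots> = (\<Sum>w\<in>words m n v. of_nat (mfact m v) * F w)"
  proof (rule sum.cong[OF refl])
    fix w assume w: "w \<in> words m n v"
    then have ext: "w \<in> extensional {0..<n}" by (auto simp: words_def PiE_iff)
    have "{\<gamma>\<in>?G. ?h \<gamma> = w} = {\<gamma> \<in> {0..<n} \<rightarrow>\<^sub>E C. bij_betw \<gamma> {0..<n} C \<and> (\<forall>t<n. fst (\<gamma> t) = w t)}"
      using ext by (auto simp: fun_eq_iff restrict_def extensional_def)
    then have "card {\<gamma>\<in>?G. ?h \<gamma> = w} = mfact m v"
      using card_word_lifts[OF w] by (simp add: C_def)
    then show "(\<Sum>\<gamma>\<in>{\<gamma>\<in>?G. ?h \<gamma> = w}. F (?h \<gamma>)) = of_nat (mfact m v) * F w"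
      by simp
  qed
  finally show ?thesis by (simp add: sum_distrib_left)
qed

text \<open>The case F = 1 of \<open>sum_bij_words\<close>: there are n! bijections in
  total.\<close>

lemma card_words:
  assumes v: "v \<in> fock m n"
  shows "mfact m v * card (words m n v) = fact n"
proof -
  let ?C = "{(i, a). i \<in> {1..m} \<and> a < v i}"
  have "of_nat (mfact m v * card (words m n v)) = (of_nat (fact n) :: complex)"
    using sum_bij_words[OF v, of "\<lambda>_. 1"] card_bij_funcset[of "{0..<n}" ?C] card_copies[OF v] by simp
  then show ?thesis using of_nat_eq_iff by blast
qed

lemma card_words_pos: "v \<in> fock m n \<Longrightarrow> card (words m n v) > 0"
  using card_words[of v m n] by (metis fact_nonzero mult_0_right neq0_conv)

text \<open>A fixed word w of type x numbers the rows of the submatrix by the positions 0, ..., n -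
  1. The permanent then runs over bijections from positions to column copies, and grouping these by
  their words yields the factor y!. In particular the inner sum in \<open>tau\<close> does not
  depend on w.\<close>

lemma perm_sub_words:
  assumes x: "x \<in> fock m n" and y: "y \<in> fock m n" and w: "w \<in> words m n x"
  shows "perm_sub m g x y = of_nat (mfact m y) * (\<Sum>w'\<in>words m n y. \<Prod>t\<in>{0..<n}. g (w t) (w' t))"
proof -
  let ?N = "{0..<n}"
  define R where "R = {(i, a). i \<in> {1..m} \<and> a < x i}"
  define C where "C = {(i, a). i \<in> {1..m} \<and> a < y i}"
  \<comment> \<open>A numbering of the rows compatible with w exists because the number of such
    numberings is x!, hence not zero.\<close>
  have "card {\<gamma> \<in> ?N \<rightarrow>\<^sub>E R. bij_betw \<gamma> ?N R \<and> (\<forall>t<n. fst (\<gamma> t) = w t)} \<noteq> 0"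
    using card_word_lifts[OF w] by (simp add: mfact_def R_def)
  then have "{\<gamma> \<in> ?N \<rightarrow>\<^sub>E R. bij_betw \<gamma> ?N R \<and> (\<forall>t<n. fst (\<gamma> t) = w t)} \<noteq> {}"
    by (metis card.empty)
  then obtain \<beta> where b: "\<beta> \<in> ?N \<rightarrow>\<^sub>E R" "bij_betw \<beta> ?N R" "\<forall>t<n. fst (\<beta> t) = w t" by auto
  let ?P = "{\<pi> \<in> R \<rightarrow>\<^sub>E C. bij_betw \<pi> R C}" and ?G = "{\<gamma> \<in> ?N \<rightarrow>\<^sub>E C. bij_betw \<gamma> ?N C}"
  let ?inv = "inv_into ?N \<beta>"
  have binv: "bij_betw ?inv R ?N" using b(2) by (rule bij_betw_inv_into)
  have i1: "?inv (\<beta> t) = t" if "t < n" for t using b(2) that by (simp add: bij_betw_inv_into_left)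
  have i2: "\<beta> (?inv r) = r" if "r \<in> R" for r using b(2) that by (simp add: bij_betw_inv_into_right)
  have i3: "?inv r < n" if "r \<in> R" for r using binv that by (auto simp: bij_betw_def)
  have b4: "\<beta> t \<in> R" if "t < n" for t using b(1) that by auto
  have bij: "bij_betw (\<lambda>\<pi>. \<lambda>t\<in>?N. \<pi> (\<beta> t)) ?P ?G"
  proof (rule bij_betw_byWitness[where f' = "\<lambda>\<gamma>. \<lambda>r\<in>R. \<gamma> (?inv r)"])
    show "\<forall>\<pi>\<in>?P. (\<lambda>r\<in>R. (\<lambda>t\<in>?N. \<pi> (\<beta> t)) (?inv r)) = \<pi>"
      by (auto simp: fun_eq_iff restrict_def i2 i3 PiE_iff extensional_def)
    show "\<forall>\<gamma>\<in>?G. (\<lambda>t\<in>?N. (\<lambda>r\<in>R. \<gamma> (?inv r)) (\<beta> t)) = \<gamma>"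
      by (auto simp: fun_eq_iff restrict_def i1 b4 PiE_iff extensional_def)
    show "(\<lambda>\<pi>. \<lambda>t\<in>?N. \<pi> (\<beta> t)) ` ?P \<subseteq> ?G"
    proof (rule image_subsetI)
      fix \<pi> assume p: "\<pi> \<in> ?P"
      have "bij_betw (\<lambda>t. \<pi> (\<beta> t)) ?N C" using p bij_betw_trans[OF b(2), of \<pi> C] by (simp add: comp_def)
      then have "bij_betw (\<lambda>t\<in>?N. \<pi> (\<beta> t)) ?N C" by (rule bij_betw_cong[THEN iffD1, rotated]) simp
      then show "(\<lambda>t\<in>?N. \<pi> (\<beta> t)) \<in> ?G" using p b4 by auto
    qed
    show "(\<lambda>\<gamma>. \<lambda>r\<in>R. \<gamma> (?inv r)) ` ?G \<subseteq> ?P"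
    proof (rule image_subsetI)
      fix \<gamma> assume p: "\<gamma> \<in> ?G"
      have "bij_betw (\<lambda>r. \<gamma> (?inv r)) R C" using p bij_betw_trans[OF binv, of \<gamma> C] by (simp add: comp_def)
      then have "bij_betw (\<lambda>r\<in>R. \<gamma> (?inv r)) R C" by (rule bij_betw_cong[THEN iffD1, rotated]) simp
      then show "(\<lambda>r\<in>R. \<gamma> (?inv r)) \<in> ?P" using p i3 by auto
    qed
  qed
  let ?F = "\<lambda>w'. \<Prod>t\<in>?N. g (w t) (w' t)"
  have "perm_sub m g x y = (\<Sum>\<pi>\<in>?P. \<Prod>r\<in>R. g (fst r) (fst (\<pi> r)))"
    by (simp add: perm_sub_def R_def C_def Let_def)
  also have "\<dots> = (\<Sum>\<pi>\<in>?P. ?F (\<lambda>t\<in>?N. fst ((\<lambda>t\<in>?N. \<pi> (\<beta> t)) t)))"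
  proof (rule sum.cong[OF refl])
    fix \<pi>
    have "(\<Prod>r\<in>R. g (fst r) (fst (\<pi> r))) = (\<Prod>t\<in>?N. g (fst (\<beta> t)) (fst (\<pi> (\<beta> t))))"
      by (rule prod.reindex_bij_betw[OF b(2), symmetric])
    also have "\<dots> = ?F (\<lambda>t\<in>?N. fst ((\<lambda>t\<in>?N. \<pi> (\<beta> t)) t))"
      using b(3) by (intro prod.cong) auto
    finally show "(\<Prod>r\<in>R. g (fst r) (fst (\<pi> r))) = ?F (\<lambda>t\<in>?N. fst ((\<lambda>t\<in>?N. \<pi> (\<beta> t)) t))" .
  qed
  also have "\<dots> = (\<Sum>\<gamma>\<in>?G. ?F (\<lambda>t\<in>?N. fst (\<gamma> t)))"
    by (rule sum.reindex_bij_betw[OF bij])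
  also have "\<dots> = of_nat (mfact m y) * (\<Sum>w'\<in>words m n y. ?F w')"
    unfolding C_def by (rule sum_bij_words[OF y])
  finally show ?thesis .
qed

lemma mfact_pos: "mfact m v > 0"
  unfolding mfact_def by (rule prod_pos) simp

text \<open>All words of type x contribute equally to \<open>tau\<close>, and x! times the number of
  words of type x equals n!, as for y; this eliminates both word counts from the
  normalisation.\<close>

lemma cmod_tau_sq:
  assumes x: "x \<in> fock m n" and y: "y \<in> fock m n"
  shows "(cmod (tau m n g x y))\<^sup>2 = (cmod (perm_sub m g x y))\<^sup>2 / (real (mfact m x) * real (mfact m y))"
proof -
  let ?X = "real (card (words m n x))" and ?Y = "real (card (words m n y))"
  let ?fx = "real (mfact m x)" and ?fy = "real (mfact m y)"
  have pos: "?X > 0" "?Y > 0" "?fx > 0" "?fy > 0" using card_words_pos x y by (auto simp: mfact_pos)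
  have e: "?fx * ?X = ?fy * ?Y" using card_words[OF x] card_words[OF y] by (metis of_nat_mult)
  have "(\<Sum>w'\<in>words m n y. \<Prod>t\<in>{0..<n}. g (w t) (w' t)) = perm_sub m g x y / of_nat (mfact m y)" if "w \<in> words m n x" for w
    using perm_sub_words[OF x y that, of g] pos by simp
  then have "tau m n g x y = of_real (?X / ?fy / sqrt (?X * ?Y)) * perm_sub m g x y"
    by (simp add: tau_def)
  then have "(cmod (tau m n g x y))\<^sup>2 = (?X / ?fy / sqrt (?X * ?Y))\<^sup>2 * (cmod (perm_sub m g x y))\<^sup>2"
    by (simp only: norm_mult norm_of_real power_mult_distrib power2_abs)
  also have "(?X / ?fy / sqrt (?X * ?Y))\<^sup>2 = ?X\<^sup>2 / ?fy\<^sup>2 / (?X * ?Y)"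
    using pos by (simp add: power_divide power_mult_distrib)
  also have "\<dots> = ?X / (?fy * (?fy * ?Y))" using pos by (simp add: power2_eq_square field_simps)
  also have "\<dots> = 1 / (?fx * ?fy)" using pos by (simp add: e[symmetric])
  finally show ?thesis by simp
qed

section \<open>Matrix elements of the Lie algebra action\<close>

definition shift :: "nat \<Rightarrow> nat \<Rightarrow> (nat \<Rightarrow> nat) \<Rightarrow> nat \<Rightarrow> nat" where
  "shift a b x = (x(a := x a - 1))(b := (x(a := x a - 1)) b + 1)"

lemma shift_fock:
  assumes "x \<in> fock m n" "x a > 0" "a \<in> {1..m}" "b \<in> {1..m}"
  shows "shift a b x \<in> fock m n"
proof -
  have "sum (shift a b x) {1..m} = n"
    using sum_fun_upd[OF assms(3), of x "x a - 1"] sum_fun_upd[OF assms(4), of "x(a := x a - 1)" "(x(a := x a - 1)) b + 1"]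
      assms by (auto simp: shift_def fock_def)
  then show ?thesis using assms by (auto simp: fock_def shift_def)
qed

text \<open>The increment in \<open>shift\<close> reads the already decremented vector, so the case
  a = b is covered: there \<open>shift\<close> returns x itself.\<close>

lemma shift_shift: "x a > 0 \<Longrightarrow> shift b a (shift a b x) = x"
  by (auto simp: shift_def fun_eq_iff)

lemma shift_flip:
  assumes "x a > 0 \<and> y = shift a b x"
  shows "y b > 0 \<and> x = shift b a y"
proof -
  have "shift a b x b > 0" by (simp add: shift_def)
  then show ?thesis using assms shift_shift[of x a b] by simp
qed

lemma words_upd:
  assumes w: "w \<in> words m n x" and s: "s < n" "w s = a" and b: "b \<in> {1..m}"
  shows "w(s := b) \<in> words m n (shift a b x)"
proof -
  have "card {t\<in>{0..<n}. (w(s := b)) t = i} = shift a b x i" if i: "i \<in> {1..m}" for i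
  proof -
    define S where "S = {t\<in>{0..<n}. w t = i}"
    have c: "card S = x i" unfolding S_def by (rule words_count[OF w i])
    have fin: "finite S" by (simp add: S_def)
    have sS: "s \<in> S \<longleftrightarrow> a = i" using s by (simp add: S_def)
    have "{t\<in>{0..<n}. (w(s := b)) t = i} = (if i = b then insert s (S - {s}) else S - {s})"
      unfolding S_def using s(1) by (cases "i = b") auto
    then have "card {t\<in>{0..<n}. (w(s := b)) t = i} = card (S - {s}) + (if i = b then 1 else 0)"
      using fin by (simp only: card_insert_disjoint finite_Diff Diff_iff singletonI simp_thms split: if_split) simp
    moreover have "card (S - {s}) = (if i = a then x i - 1 else x i)"
      using sS c fin by (simp add: card_Diff_singleton_if)
    ultimately show ?thesis unfolding shift_def by simp
  qed
  moreover have "w(s := b) \<in> {0..<n} \<rightarrow>\<^sub>E {1..m}"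
  proof -
    have "w \<in> {0..<n} \<rightarrow>\<^sub>E {1..m}" using w unfolding words_def by blast
    then show ?thesis using s b by (auto simp: PiE_iff extensional_def)
  qed
  ultimately show ?thesis unfolding words_def by blast
qed

lemma words_disjoint:
  assumes "w \<in> words m n x" "w \<in> words m n y" "x \<in> fock m n" "y \<in> fock m n"
  shows "x = y"
proof
  fix i show "x i = y i"
    using words_count[OF assms(1), of i] words_count[OF assms(2), of i] assms by (cases "i \<in> {1..m}") (auto simp: fock_def)
qed

text \<open>The unnormalised derivative of \<open>tau\<close> at the identity: the product rule
  selects one position s at which the matrix unit replaces the identity, and elsewhere the two words
  must agree.\<close>

definition jumps :: "nat \<Rightarrow> nat \<Rightarrow> nat \<Rightarrow> nat \<Rightarrow> (nat \<Rightarrow> nat) \<Rightarrow> (nat \<Rightarrow> nat) \<Rightarrow> complex" where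
  "jumps m n a b x y = (\<Sum>w\<in>words m n x. \<Sum>w'\<in>words m n y. \<Sum>s\<in>{0..<n}.
     (if w s = a \<and> w' s = b then 1 else 0) * (\<Prod>r\<in>{0..<n}-{s}. if w r = w' r then 1 else 0))"

lemma jumps_swap: "jumps m n a b x y = jumps m n b a y x"
  unfolding jumps_def by (subst sum.swap) (intro sum.cong arg_cong2[where f = "(*)"] prod.cong refl, auto)

text \<open>Given w and a position s with \<open>w s = a\<close>, the only partner is
  \<open>w(s := b)\<close>, whose type is \<open>shift a b x\<close>; a word of type x has
  \<open>x a\<close> such positions.\<close>

lemma jumps_eq:
  assumes x: "x \<in> fock m n" and y: "y \<in> fock m n" and a: "a \<in> {1..m}" and b: "b \<in> {1..m}"
  shows "jumps m n a b x y = (if x a > 0 \<and> y = shift a b x then of_nat (card (words m n x) * x a) else 0)"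
proof -
  let ?D = "\<lambda>w w' s. \<Prod>r\<in>{0..<n}-{s}. if w r = w' r then 1 else 0 :: complex"
  have inner: "(\<Sum>w'\<in>words m n y. (if w s = a \<and> w' s = b then 1 else 0) * ?D w w' s)
     = (if w s = a then (if y = shift a b x then 1 else 0) else 0)" if w: "w \<in> words m n x" and s: "s < n" for w s
  proof (cases "w s = a")
    case True
    have ws: "w(s := b) \<in> words m n (shift a b x)" using words_upd[OF w s True b] .
    have "s \<in> {t\<in>{0..<n}. w t = a}" using True s by simp
    then have "card {t\<in>{0..<n}. w t = a} \<noteq> 0" by (subst card_0_eq) auto
    then have "x a > 0" unfolding words_count[OF w a] by blast
    then have sf: "shift a b x \<in> fock m n" using shift_fock x a b by blast
    have t: "(if w s = a \<and> w' s = b then 1 else 0) * ?D w w' s = (if w' = w(s := b) then 1 else 0 :: complex)"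
      if w': "w' \<in> words m n y" for w'
    proof -
      have "w' = w(s := b) \<longleftrightarrow> w' s = b \<and> (\<forall>r\<in>{0..<n}-{s}. w r = w' r)"
      proof
        assume r: "w' s = b \<and> (\<forall>r\<in>{0..<n}-{s}. w r = w' r)"
        have "w \<in> extensional {0..<n}" "w' \<in> extensional {0..<n}"
          using w w' unfolding words_def PiE_iff by blast+
        then have "w' r = (w(s := b)) r" for r
          using r s by (cases "r < n") (auto simp: extensional_def)
        then show "w' = w(s := b)" by blast
      qed simp
      moreover have "?D w w' s = (if \<forall>r\<in>{0..<n}-{s}. w r = w' r then 1 else 0)"
      proof (cases "\<forall>r\<in>{0..<n}-{s}. w r = w' r")
        case False
        then obtain r where "r \<in> {0..<n}-{s}" "w r \<noteq> w' r" by blast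
        then have "?D w w' s = 0"
          by (intro prod_zero bexI[of _ r]) auto
        then show ?thesis using False by (simp only: if_False)
      qed (simp add: prod.neutral)
      ultimately show ?thesis using True by (simp only: simp_thms split: if_split) simp
    qed
    have "(\<Sum>w'\<in>words m n y. (if w s = a \<and> w' s = b then 1 else 0) * ?D w w' s)
      = (\<Sum>w'\<in>words m n y. if w' = w(s := b) then 1 else 0)"
      by (intro sum.cong refl t)
    also have "\<dots> = (if w(s := b) \<in> words m n y then 1 else 0)"
      by (rule sum.delta[OF finite_words])
    also have "\<dots> = (if y = shift a b x then 1 else 0)"
    proof -
      have "w(s := b) \<in> words m n y \<longleftrightarrow> y = shift a b x"
        using ws words_disjoint[OF ws _ sf y] by blast
      then show ?thesis by (simp only:)
    qed
    finally show ?thesis using True by simp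
  qed simp
  have "jumps m n a b x y = (\<Sum>w\<in>words m n x. \<Sum>s\<in>{0..<n}. if w s = a then (if y = shift a b x then 1 else 0) else 0)"
    unfolding jumps_def by (subst sum.swap[of _ "{0..<n}"]) (intro sum.cong refl, simp only: inner atLeastLessThan_iff)
  also have "\<dots> = (\<Sum>w\<in>words m n x. of_nat (x a) * (if y = shift a b x then 1 else 0))"
  proof (rule sum.cong[OF refl])
    fix w assume w: "w \<in> words m n x"
    have "(\<Sum>s\<in>{0..<n}. if w s = a then (if y = shift a b x then 1 else 0) else 0 :: complex) =
       (\<Sum>s\<in>{s\<in>{0..<n}. w s = a}. (if y = shift a b x then 1 else 0))"
      by (rule sum.inter_filter[symmetric]) simp
    then show "(\<Sum>s\<in>{0..<n}. if w s = a then (if y = shift a b x then 1 else 0) else 0 :: complex) = of_nat (x a) * (if y = shift a b x then 1 else 0)"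
      using words_count[OF w a] by simp
  qed
  finally show ?thesis by auto
qed

lemma dtau_jumps:
  assumes "x \<in> fock m n" "y \<in> fock m n"
  shows "dtau m n a b x y = jumps m n a b x y / complex_of_real (sqrt (real (card (words m n x) * card (words m n y))))"
proof -
  let ?c = "complex_of_real (sqrt (real (card (words m n x) * card (words m n y))))"
  let ?u = "\<lambda>w w' s. (if w s = w' s then 1 else 0 :: complex)"
  let ?v = "\<lambda>w w' s. (if w s = a \<and> w' s = b then 1 else 0 :: complex)"
  have "tau m n (unitE m a b t) x y = (\<Sum>w\<in>words m n x. \<Sum>w'\<in>words m n y. \<Prod>s\<in>{0..<n}. ?u w w' s + ?v w w' s * t) / ?c" for t
    unfolding tau_def unitE_def
    by (intro arg_cong2[where f = "(/)"] sum.cong prod.cong refl) (use words_range in auto)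
  then have eq: "(\<lambda>t. tau m n (unitE m a b t) x y) = (\<lambda>t. (\<Sum>w\<in>words m n x. \<Sum>w'\<in>words m n y. \<Prod>s\<in>{0..<n}. ?u w w' s + ?v w w' s * t) / ?c)"
    by blast
  have "((\<lambda>t. (\<Prod>s\<in>{0..<n}. ?u w w' s + ?v w w' s * t)) has_field_derivative
      (\<Sum>s\<in>{0..<n}. ?v w w' s * (\<Prod>r\<in>{0..<n}-{s}. ?u w w' r + ?v w w' r * 0))) (at 0)" for w w'
    by (rule has_field_derivative_prod) (auto intro!: derivative_eq_intros)
  then have d: "((\<lambda>t. (\<Prod>s\<in>{0..<n}. ?u w w' s + ?v w w' s * t)) has_field_derivative
      (\<Sum>s\<in>{0..<n}. ?v w w' s * (\<Prod>r\<in>{0..<n}-{s}. ?u w w' r))) (at 0)" for w w'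
    by simp
  have "((\<lambda>t. tau m n (unitE m a b t) x y) has_field_derivative jumps m n a b x y / ?c) (at 0)"
    unfolding eq jumps_def by (intro DERIV_cdivide DERIV_sum d)
  then show ?thesis unfolding dtau_def by (rule DERIV_imp_deriv)
qed

lemma dtau_eq:
  assumes x: "x \<in> fock m n" and y: "y \<in> fock m n" and a: "a \<in> {1..m}" and b: "b \<in> {1..m}"
  shows "dtau m n a b x y = (if x a > 0 \<and> y = shift a b x then of_real (sqrt (real (x a) * real (y b))) else 0)"
proof (cases "x a > 0 \<and> y = shift a b x")
  case True
  let ?X = "real (card (words m n x))" and ?Y = "real (card (words m n y))"
  \<comment> \<open>Counting the same pairs from the side of y gives a second expression for
    \<open>jumps\<close>. Their geometric mean absorbs the normalisation and leaves the usual
    creation-annihilation element, the root of \<open>x a * y b\<close>.\<close>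
  have xy: "y b > 0 \<and> x = shift b a y" using True shift_flip by blast
  have "complex_of_nat (card (words m n x) * x a) = jumps m n a b x y"
    unfolding jumps_eq[OF x y a b] by (rule if_P[OF True, symmetric])
  also have "\<dots> = of_nat (card (words m n y) * y b)"
    unfolding jumps_swap[of m n a b] jumps_eq[OF y x b a] by (rule if_P[OF xy])
  finally have "complex_of_nat (card (words m n x) * x a) = of_nat (card (words m n y) * y b)" .
  then have "card (words m n x) * x a = card (words m n y) * y b" by (simp only: of_nat_eq_iff)
  then have e: "?X * real (x a) = ?Y * real (y b)" by (metis of_nat_mult)
  have pos: "?X > 0" "?Y > 0" using card_words_pos x y by auto
  have "sqrt (real (x a) * real (y b)) * sqrt (?X * ?Y) = sqrt ((?X * real (x a)) * (?Y * real (y b)))"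
    by (simp add: real_sqrt_mult mult_ac)
  also have "\<dots> = ?X * real (x a)" unfolding e[symmetric] by simp
  finally have "?X * real (x a) / sqrt (?X * ?Y) = sqrt (real (x a) * real (y b))"
    using pos by (simp add: field_simps)
  moreover have "dtau m n a b x y = of_real (?X * real (x a) / sqrt (?X * ?Y))"
    unfolding dtau_jumps[OF x y] jumps_eq[OF x y a b] if_P[OF True] by simp
  ultimately show ?thesis unfolding if_P[OF True] by (simp only:)
next
  case False
  then show ?thesis unfolding dtau_jumps[OF x y] jumps_eq[OF x y a b] by (simp only: if_False div_0)
qed

lemma dtau_transpose:
  assumes x: "x \<in> fock m n" and y: "y \<in> fock m n" and a: "a \<in> {1..m}" and b: "b \<in> {1..m}"
  shows "dtau m n a b x y = dtau m n b a y x" "cnj (dtau m n a b x y) = dtau m n a b x y"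
proof -
  have "x a > 0 \<and> y = shift a b x \<longleftrightarrow> y b > 0 \<and> x = shift b a y"
    using shift_flip by blast
  then show "dtau m n a b x y = dtau m n b a y x"
    unfolding dtau_eq[OF x y a b] dtau_eq[OF y x b a] by (simp only: mult.commute)
  show "cnj (dtau m n a b x y) = dtau m n a b x y" by (simp add: dtau_eq[OF x y a b])
qed

lemma cnj_dtau:
  assumes "x \<in> fock m n" "y \<in> fock m n" "a \<in> {1..m}" "b \<in> {1..m}"
  shows "cnj (dtau m n a b x y) = dtau m n b a y x"
  using dtau_transpose[OF assms] by (simp only:)

section \<open>The space of bidegree (n, n) and its inner product\<close>

lemma finite_fock: "finite (fock m n)"
proof (rule finite_subset)
  show "fock m n \<subseteq> {f. \<forall>i. (i \<in> {1..m} \<longrightarrow> f i \<in> {..n}) \<and> (i \<notin> {1..m} \<longrightarrow> f i = 0)}"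
    by (auto simp: fock_def intro: member_le_sum[of _ "{1..m}", simplified])
  show "finite {f. \<forall>i. (i \<in> {1..m} \<longrightarrow> f i \<in> {..n}) \<and> (i \<notin> {1..m} \<longrightarrow> f i = (0::nat))}"
    by (rule finite_set_of_finite_funs) auto
qed

abbreviation VV :: "nat \<Rightarrow> nat \<Rightarrow> cvec \<Rightarrow> bool" where "VV m n \<equiv> homp m n n"

lemma VV_iff: "VV m n v \<longleftrightarrow> (\<forall>z. z \<notin> dom2 m n \<longrightarrow> v z = 0)"
  by (auto simp: homp_def dom2_def)

text \<open>\<open>dRho\<close> is cut off outside \<open>dom2\<close> while \<open>Eop\<close> is
  not. They agree on vectors supported in \<open>dom2\<close> because moving one particle preserves
  the particle number, in both directions.\<close>

lemma dRho_Eop: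
  assumes v: "VV m n v" and a: "a \<in> {1..m}" and b: "b \<in> {1..m}"
  shows "dRho m n a b v = Eop a b v"
proof
  fix z :: occs
  obtain x y where z: "z = (x, y)" by force
  have unshift: "x a > 0 \<Longrightarrow> shift a b x \<in> fock m n \<Longrightarrow> x \<in> fock m n" if "a \<in> {1..m}" "b \<in> {1..m}" for x a b
    using shift_fock[of "shift a b x" m n b a] that shift_shift[of x a b] by (simp add: shift_def)
  let ?ZD = "if x a > 0 then of_real (sqrt (real (x a) * real (shift a b x b))) * v (shift a b x, y) else 0"
  let ?WB = "if y b > 0 then of_real (sqrt (real (y b) * real (shift b a y a))) * v (x, shift b a y) else 0"
  have ZD: "Zr a (Dr b v) (x, y) = ?ZD"
    by (simp add: Zr_def Dr_def shift_def real_sqrt_mult)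
  have WB: "Wr b (Br a v) (x, y) = ?WB"
    by (simp add: Wr_def Br_def shift_def real_sqrt_mult)
  show "dRho m n a b v z = Eop a b v z"
  proof (cases "(x, y) \<in> dom2 m n")
    case True
    then have x: "x \<in> fock m n" and y: "y \<in> fock m n" by (auto simp: dom2_def)
    have "(\<Sum>x'\<in>fock m n. dtau m n a b x x' * v (x', y)) = (\<Sum>x'\<in>fock m n. if x' = shift a b x then
        ?ZD else 0)"
      by (intro sum.cong refl) (auto simp: dtau_eq[OF x _ a b])
    also have "\<dots> = Zr a (Dr b v) (x, y)"
      unfolding ZD using shift_fock[OF x _ a b] by (simp add: finite_fock)
    finally have 1: "(\<Sum>x'\<in>fock m n. dtau m n a b x x' * v (x', y)) = Zr a (Dr b v) (x, y)" .
    have "(\<Sum>y'\<in>fock m n. dtau m n b a y y' * v (x, y')) = (\<Sum>y'\<in>fock m n. if y' = shift b a y then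
        ?WB else 0)"
      by (intro sum.cong refl) (auto simp: dtau_eq[OF y _ b a])
    also have "\<dots> = Wr b (Br a v) (x, y)"
      unfolding WB using shift_fock[OF y _ b a] by (simp add: finite_fock)
    finally show ?thesis using 1 True by (simp add: dRho_def z Eop_def)
  next
    case False
    have "Zr a (Dr b v) (x, y) = 0"
      using False unshift[OF a b, of x] v unfolding ZD by (auto simp: homp_def dom2_def)
    moreover have "Wr b (Br a v) (x, y) = 0"
      using False unshift[OF b a, of y] v unfolding WB by (auto simp: homp_def dom2_def)
    ultimately show ?thesis using False by (simp add: dRho_def z Eop_def)
  qed
qed

lemma VV_dRho: "VV m n (dRho m n a b v)"
  by (auto simp: VV_iff dRho_def)

lemma VV_Eop: "VV m n v \<Longrightarrow> a \<in> {1..m} \<Longrightarrow> b \<in> {1..m} \<Longrightarrow> VV m n (Eop a b v)"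
  using VV_dRho dRho_Eop by metis

lemma finite_dom2: "finite (dom2 m n)"
  by (simp add: dom2_def finite_fock)

lemma cinner_add_right: "cinner m n u (v + w) = cinner m n u v + cinner m n u w"
  and cinner_diff_right: "cinner m n u (v - w) = cinner m n u v - cinner m n u w"
  and cinner_csc_right: "cinner m n u (csc c v) = c * cinner m n u v"
  and cinner_csc_left: "cinner m n (csc c u) v = cnj c * cinner m n u v"
  and cinner_zero_right: "cinner m n u 0 = 0"
  and cinner_cnj: "cnj (cinner m n u v) = cinner m n v u"
  by (simp_all add: cinner_def algebra_simps sum.distrib sum_subtractf sum_distrib_left)

lemma cinner_sum_right: "cinner m n u (\<Sum>i\<in>A. v i) = (\<Sum>i\<in>A. cinner m n u (v i))"
  by (induction A rule: infinite_finite_induct)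
    (simp_all only: sum.infinite sum.empty sum.insert cinner_zero_right cinner_add_right not_False_eq_True)

lemma cinner_add_left: "cinner m n (v + w) u = cinner m n v u + cinner m n w u"
  and cinner_zero_left: "cinner m n 0 u = 0"
  by (simp_all add: cinner_def algebra_simps sum.distrib sum_subtractf)

lemma cinner_sum_left: "cinner m n (\<Sum>i\<in>A. v i) u = (\<Sum>i\<in>A. cinner m n (v i) u)"
  by (induction A rule: infinite_finite_induct)
    (simp_all only: sum.infinite sum.empty sum.insert cinner_zero_left cinner_add_left not_False_eq_True)

lemma cinner_self: "cinner m n v v = of_real (\<Sum>z\<in>dom2 m n. (cmod (v z))\<^sup>2)"
  by (simp add: cinner_def mult.commute flip: complex_norm_square)

lemma cinner_self_zero: "VV m n v \<Longrightarrow> cinner m n v v = 0 \<Longrightarrow> v = 0"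
  unfolding cinner_self VV_iff
  by (simp only: of_real_eq_0_iff) (subst (asm) sum_nonneg_eq_0_iff, auto simp: finite_dom2 fun_eq_iff)

lemma sum_swap13: "(\<Sum>x\<in>A. \<Sum>y\<in>B. \<Sum>z\<in>A. G x y z) = (\<Sum>x\<in>A. \<Sum>y\<in>B. \<Sum>z\<in>A. G z y x)"
  for G :: "'a \<Rightarrow> 'b \<Rightarrow> 'a \<Rightarrow> 'c::comm_monoid_add"
proof -
  have "(\<Sum>x\<in>A. \<Sum>y\<in>B. \<Sum>z\<in>A. G x y z) = (\<Sum>y\<in>B. \<Sum>x\<in>A. \<Sum>z\<in>A. G x y z)"
    by (rule sum.swap)
  also have "\<dots> = (\<Sum>y\<in>B. \<Sum>x\<in>A. \<Sum>z\<in>A. G z y x)"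
    by (intro sum.cong refl sum.swap)
  also have "\<dots> = (\<Sum>x\<in>A. \<Sum>y\<in>B. \<Sum>z\<in>A. G z y x)"
    by (rule sum.swap)
  finally show ?thesis .
qed

text \<open>The matrix of \<open>dtau\<close> is real, and exchanging a and b transposes it; hence
  the adjoint of E_ab is E_ba. The two sums are relabelled to move the matrix to the left
  factor.\<close>

lemma cinner_dRho:
  assumes a: "a \<in> {1..m}" and b: "b \<in> {1..m}"
  shows "cinner m n u (dRho m n a b v) = cinner m n (dRho m n b a u) v"
proof -
  let ?F = "fock m n"
  have "cinner m n u (dRho m n a b v) = (\<Sum>x\<in>?F. \<Sum>y\<in>?F. cnj (u (x, y)) *
     ((\<Sum>x'\<in>?F. dtau m n a b x x' * v (x', y)) - (\<Sum>y'\<in>?F. dtau m n b a y y' * v (x, y'))))"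
    unfolding cinner_def dom2_def sum.cartesian_product
    by (intro sum.cong refl) (auto simp: dRho_def dom2_def)
  also have "\<dots> = (\<Sum>x\<in>?F. \<Sum>y\<in>?F. \<Sum>x'\<in>?F. cnj (u (x, y)) * dtau m n a b x x' * v (x', y))
     - (\<Sum>x\<in>?F. \<Sum>y\<in>?F. \<Sum>y'\<in>?F. cnj (u (x, y)) * dtau m n b a y y' * v (x, y'))"
    by (simp add: sum_subtractf right_diff_distrib sum_distrib_left mult.assoc)
  also have "(\<Sum>x\<in>?F. \<Sum>y\<in>?F. \<Sum>x'\<in>?F. cnj (u (x, y)) * dtau m n a b x x' * v (x', y))
     = (\<Sum>x\<in>?F. \<Sum>y\<in>?F. \<Sum>x'\<in>?F. cnj (u (x', y)) * dtau m n a b x' x * v (x, y))"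
    by (rule sum_swap13)
  also have "\<dots> = (\<Sum>x\<in>?F. \<Sum>y\<in>?F. \<Sum>x'\<in>?F. cnj (dtau m n b a x x' * u (x', y)) * v (x, y))"
    by (intro sum.cong refl) (simp add: cnj_dtau[OF _ _ a b] cnj_dtau[OF _ _ b a] mult.commute)
  also have "(\<Sum>x\<in>?F. \<Sum>y\<in>?F. \<Sum>y'\<in>?F. cnj (u (x, y)) * dtau m n b a y y' * v (x, y'))
     = (\<Sum>x\<in>?F. \<Sum>y\<in>?F. \<Sum>y'\<in>?F. cnj (u (x, y')) * dtau m n b a y' y * v (x, y))"
    by (intro sum.cong refl sum.swap)
  also have "\<dots> = (\<Sum>x\<in>?F. \<Sum>y\<in>?F. \<Sum>y'\<in>?F. cnj (dtau m n a b y y' * u (x, y')) * v (x, y))"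
    by (intro sum.cong refl) (simp add: cnj_dtau[OF _ _ a b] cnj_dtau[OF _ _ b a] mult.commute)
  also have "(\<Sum>x\<in>?F. \<Sum>y\<in>?F. \<Sum>x'\<in>?F. cnj (dtau m n b a x x' * u (x', y)) * v (x, y)) - \<dots>
     = cinner m n (dRho m n b a u) v"
  proof -
    have "cinner m n (dRho m n b a u) v = (\<Sum>x\<in>?F. \<Sum>y\<in>?F. cnj ((\<Sum>x'\<in>?F. dtau m n b a x x' * u (x', y))
        - (\<Sum>y'\<in>?F. dtau m n a b y y' * u (x, y'))) * v (x, y))"
      unfolding cinner_def dom2_def sum.cartesian_product
      by (intro sum.cong refl) (auto simp: dRho_def dom2_def)
    then show ?thesis by (simp add: sum_subtractf sum_distrib_right left_diff_distrib)
  qed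
  finally show ?thesis .
qed

lemma cinner_Eop:
  assumes "VV m n u" "VV m n v" "a \<in> {1..m}" "b \<in> {1..m}"
  shows "cinner m n u (Eop a b v) = cinner m n (Eop b a u) v"
  unfolding dRho_Eop[OF assms(2,3,4), symmetric] dRho_Eop[OF assms(1,4,3), symmetric]
  by (rule cinner_dRho[OF assms(3,4)])

section \<open>Isotypic components and Casimir eigenspaces\<close>

lemma isocomp_VV: "v \<in> isocomp m n j mu \<Longrightarrow> VV m n v"
proof (induction rule: isocomp.induct)
  case (base v)
  then show ?case by (auto simp: hw_def VV_iff)
next
  case (lie v a b)
  show ?case by (rule VV_dRho)
qed (auto simp: VV_iff)

lemma isocomp_cong:
  assumes "\<And>a. a \<in> {1..j} \<Longrightarrow> mu a = nu a"
  shows "isocomp m n j mu = isocomp m n j nu"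
proof -
  have hweq: "hw m n j mu = hw m n j nu" using assms by (auto simp: hw_def fun_eq_iff)
  have "v \<in> isocomp m n j nu" if "v \<in> isocomp m n j mu" for v
    using that by (induction rule: isocomp.induct) (auto intro: isocomp.intros simp: hweq)
  moreover have "v \<in> isocomp m n j mu" if "v \<in> isocomp m n j nu" for v
    using that by (induction rule: isocomp.induct) (auto intro: isocomp.intros simp flip: hweq)
  ultimately show ?thesis by blast
qed

lemma isocomp_plus: "u \<in> isocomp m n j mu \<Longrightarrow> v \<in> isocomp m n j mu \<Longrightarrow> u + v \<in> isocomp m n j mu"
  unfolding plus_fun_def by (rule isocomp.add)
lemma isocomp_csc: "v \<in> isocomp m n j mu \<Longrightarrow> csc c v \<in> isocomp m n j mu"
  unfolding csc_def by (rule isocomp.smult)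
lemma isocomp_0: "0 \<in> isocomp m n j mu"
  unfolding zero_fun_def by (rule isocomp.zero)
lemma isocomp_diff: "u \<in> isocomp m n j mu \<Longrightarrow> v \<in> isocomp m n j mu \<Longrightarrow> u - v \<in> isocomp m n j mu"
  using isocomp_plus[of u m n j mu "csc (-1) v"] isocomp_csc[of v m n j mu "-1"] by simp
lemma isocomp_Eop:
  assumes "v \<in> isocomp m n j mu" "a \<in> {1..j}" "b \<in> {1..j}" "j \<le> m"
  shows "Eop a b v \<in> isocomp m n j mu"
  using isocomp.lie[OF assms(1,2,3)] isocomp_VV[OF assms(1)] assms dRho_Eop[of m n v a b] by auto

definition casv :: "nat \<Rightarrow> nat \<Rightarrow> nat \<Rightarrow> nat" where
  "casv j p q = p * p + q * q + (j - 1) * (p + q)"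

text \<open>\<open>casv j p q\<close> is the quadratic Casimir eigenvalue at the \<open>gl(j)\<close>-highest weight \<open>(p, 0, \<dots>, 0, -q)\<close>.\<close>

definition Eig :: "nat \<Rightarrow> nat \<Rightarrow> nat \<Rightarrow> cvec \<Rightarrow> bool" where
  "Eig j p q f \<longleftrightarrow> C1 j f = csc (of_int (int p - int q)) f \<and> Cas j f = csc (of_nat (casv j p q)) f"

lemma Eig_zero: "Eig j p q 0"
  and Eig_add: "Eig j p q f \<Longrightarrow> Eig j p q g \<Longrightarrow> Eig j p q (f + g)"
  and Eig_diff: "Eig j p q f \<Longrightarrow> Eig j p q g \<Longrightarrow> Eig j p q (f - g)"
  and Eig_csc: "Eig j p q f \<Longrightarrow> Eig j p q (csc c f)"
  by (simp_all add: Eig_def linear_simps cv.scale_right_distrib cv.scale_right_diff_distrib mult.commute)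

lemma Eig_sum: "(\<And>i. i \<in> A \<Longrightarrow> Eig j p q (f i)) \<Longrightarrow> Eig j p q (\<Sum>i\<in>A. f i)"
  by (induction A rule: infinite_finite_induct) (auto simp: Eig_zero intro: Eig_add)

lemma Eig_Eop: "Eig j p q f \<Longrightarrow> a \<in> {1..j} \<Longrightarrow> b \<in> {1..j} \<Longrightarrow> Eig j p q (Eop a b f)"
  by (simp add: Eig_def linear_simps flip: Eop_Cas Eop_C1)

text \<open>For j = 1 both conditions hit the only entry, which becomes p - q. Its square equals p^2
  + q^2 only if p or q vanishes, hence the proviso on row 1 in the lemmas below.\<close>

definition rowmu :: "nat \<Rightarrow> nat \<Rightarrow> nat \<Rightarrow> nat \<Rightarrow> int" where
  "rowmu j p q i = (if i = 1 then int p else 0) - (if i = j then int q else 0)"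

text \<open>The summand is the scalar by which E_ab E_ba acts on a highest weight vector of weight
  mu: for a < b it comes from the commutator E_aa - E_bb, for a > b the raising operator acts first
  and kills the vector.\<close>

lemma hw_Cas_coeff:
  assumes j: "j \<ge> 1" and pq: "j = 1 \<Longrightarrow> p = 0 \<or> q = 0"
  defines "mu \<equiv> rowmu j p q"
  shows "(\<Sum>a\<in>{1..j}. \<Sum>b\<in>{1..j}. if a < b then mu a - mu b else if a = b then (mu a)\<^sup>2 else 0) = int (casv j p q)"
proof -
  let ?J = "{1..j}" and ?k = "\<lambda>a b. if a < b then mu a - mu b else if a = b then (mu a)\<^sup>2 else 0"
  have c1: "int (card {b\<in>?J. a < b}) = int j - int a" if "a \<in> ?J" for a
  proof -
    have "{b\<in>?J. a < b} = {Suc a..j}" using that by auto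
    then show ?thesis using that by simp
  qed
  have c2: "int (card {a\<in>?J. a < b}) = int b - 1" if "b \<in> ?J" for b
  proof -
    have "{a\<in>?J. a < b} = {1..<b}" using that by auto
    then show ?thesis using that by simp
  qed
  have s1: "(\<Sum>b\<in>?J. if a < b then mu a else 0) = (int j - int a) * mu a" if "a \<in> ?J" for a
    using c1[OF that] by (simp add: sum.inter_filter[symmetric])
  have s2: "(\<Sum>a\<in>?J. if a < b then mu b else 0) = (int b - 1) * mu b" if "b \<in> ?J" for b
    using c2[OF that] by (simp add: sum.inter_filter[symmetric])
  have "(\<Sum>a\<in>?J. \<Sum>b\<in>?J. ?k a b)
     = (\<Sum>a\<in>?J. \<Sum>b\<in>?J. (if a < b then mu a else 0) - (if a < b then mu b else 0) + (if a = b then (mu a)\<^sup>2 else 0))"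
    by (intro sum.cong refl) auto
  also have "\<dots> = (\<Sum>a\<in>?J. \<Sum>b\<in>?J. if a < b then mu a else 0) - (\<Sum>b\<in>?J. \<Sum>a\<in>?J. if a < b then mu b else 0) + (\<Sum>a\<in>?J. (mu a)\<^sup>2)"
    by (subst (2) sum.swap) (simp add: sum.distrib sum_subtractf)
  also have "\<dots> = (\<Sum>a\<in>?J. (int j - int a) * mu a) - (\<Sum>b\<in>?J. (int b - 1) * mu b) + (\<Sum>a\<in>?J. (mu a)\<^sup>2)"
    by (simp only: s1 s2 cong: sum.cong)
  also have "(\<Sum>a\<in>?J. (int j - int a) * mu a) = (int j - 1) * int p"
  proof -
    have "(\<Sum>a\<in>?J. (int j - int a) * mu a) = (\<Sum>a\<in>?J. if a = 1 then (int j - 1) * int p else 0)"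
      by (intro sum.cong refl) (auto simp: mu_def rowmu_def)
    then show ?thesis using j by simp
  qed
  also have "(\<Sum>a\<in>?J. (int a - 1) * mu a) = - ((int j - 1) * int q)"
  proof -
    have "(\<Sum>a\<in>?J. (int a - 1) * mu a) = (\<Sum>a\<in>?J. if a = j then - ((int j - 1) * int q) else 0)"
      by (intro sum.cong refl) (auto simp: mu_def rowmu_def)
    then show ?thesis using j by simp
  qed
  also have "(\<Sum>a\<in>?J. (mu a)\<^sup>2) = int p * int p + int q * int q"
  proof -
    have "(\<Sum>a\<in>?J. (mu a)\<^sup>2) = (\<Sum>a\<in>?J. (if a = 1 then int p * int p else 0) + (if a = j then int q * int q else 0))"
      using pq by (intro sum.cong refl) (auto simp: mu_def rowmu_def power2_eq_square)
    then show ?thesis using j by (simp add: sum.distrib)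
  qed
  finally have "(\<Sum>a\<in>?J. \<Sum>b\<in>?J. ?k a b)
    = (int j - 1) * int p - - ((int j - 1) * int q) + (int p * int p + int q * int q)" .
  moreover have "int (casv j p q) = int p * int p + int q * int q + (int j - 1) * (int p + int q)"
    using j by (simp add: casv_def of_nat_diff)
  ultimately show ?thesis by (simp only: distrib_left)
qed

lemma hw_Eig:
  assumes h: "hw m n j (rowmu j p q) f" and j: "1 \<le> j" "j \<le> m" and pq: "j = 1 \<Longrightarrow> p = 0 \<or> q = 0"
  shows "Eig j p q f"
proof -
  let ?mu = "rowmu j p q" and ?J = "{1..j}"
  let ?k = "\<lambda>a b. if a < b then ?mu a - ?mu b else if a = b then (?mu a)\<^sup>2 else 0"
  have v: "VV m n f" using h by (auto simp: hw_def VV_iff)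
  have aa: "Eop a a f = csc (of_int (?mu a)) f" if "a \<in> ?J" for a
    using h that j dRho_Eop[OF v, of a a] by (auto simp: hw_def csc_def)
  have ab: "Eop a b f = 0" if "a \<in> ?J" "b \<in> ?J" "a < b" for a b
    using h that j dRho_Eop[OF v, of a b] by (auto simp: hw_def zero_fun_def)
  have "Eop a b (Eop b a f) = csc (of_int (?k a b)) f"
    if "a \<in> ?J" "b \<in> ?J" for a b
  proof -
    consider "a < b" | "a = b" | "b < a" by linarith
    then show ?thesis
    proof cases
      case 1
      have "Eop a b (Eop b a f) = Eop b a (Eop a b f) + Eop a a f - Eop b b f"
        using Eop_commutator[of a b b a f] by simp
      then show ?thesis using 1 ab[OF that 1] aa that by (simp add: linear_simps cv.scale_left_diff_distrib)
    next
      case 2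
      then show ?thesis using aa[OF that(1)] by (simp add: linear_simps power2_eq_square)
    next
      case 3
      then show ?thesis using ab[OF that(2,1) 3] by (simp add: linear_simps)
    qed
  qed
  then have "Cas j f = (\<Sum>a\<in>?J. \<Sum>b\<in>?J. csc (of_int (?k a b)) f)"
    unfolding Cas_def by (intro sum.cong refl)
  then have "Cas j f = csc (of_int (\<Sum>a\<in>?J. \<Sum>b\<in>?J. ?k a b)) f"
    by (simp add: cv.scale_sum_left)
  then have 1: "Cas j f = csc (of_nat (casv j p q)) f"
    by (simp only: hw_Cas_coeff[OF j(1) pq] of_int_of_nat_eq)
  have "(\<Sum>a\<in>?J. ?mu a) = int p - int q"
    using j by (simp add: rowmu_def sum_subtractf)
  moreover have "C1 j f = csc (of_int (\<Sum>a\<in>?J. ?mu a)) f"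
    using aa by (simp add: C1_def cv.scale_sum_left)
  ultimately show ?thesis using 1 by (simp add: Eig_def)
qed

lemma isocomp_Eig:
  assumes "f \<in> isocomp m n j (rowmu j p q)" and j: "1 \<le> j" "j \<le> m" and pq: "j = 1 \<Longrightarrow> p = 0 \<or> q = 0"
  shows "Eig j p q f"
  using assms(1)
proof (induction rule: isocomp.induct)
  case (base v)
  then show ?case using hw_Eig j pq by blast
next
  case zero
  show ?case using Eig_zero by (simp add: zero_fun_def)
next
  case (add u v)
  then show ?case using Eig_add[of j p q u v] by (simp add: plus_fun_def)
next
  case (smult v c)
  then show ?case using Eig_csc[of j p q v c] by (simp add: csc_def)
next
  case (lie v a b)
  then have "dRho m n a b v = Eop a b v" using j dRho_Eop[OF isocomp_VV[OF lie(1)], of a b] by auto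
  then show ?case using Eig_Eop lie by simp
qed

text \<open>With p - q prescribed, p and q can only grow together, and each summand of
  \<open>casv\<close> is nondecreasing, the squares strictly so.\<close>

lemma casv_sep:
  assumes "j \<ge> 1" "int p - int q = int p' - int q'" "casv j p q = casv j p' q'"
  shows "p = p' \<and> q = q'"
proof -
  have less: "casv j p q < casv j p' q'" if "p < p'" "q < q'" for p q p' q'
  proof -
    have "p * p < p' * p'" using that by (intro mult_strict_mono) auto
    moreover have "q * q < q' * q'" using that by (intro mult_strict_mono) auto
    moreover have "(j - 1) * (p + q) \<le> (j - 1) * (p' + q')" using that by (intro mult_le_mono) auto
    ultimately show ?thesis unfolding casv_def by linarith
  qed
  consider "p < p'" "q < q'" | "p' < p" "q' < q" | "p = p'" "q = q'" using assms(2) by linarith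
  then show ?thesis using less assms(3) by cases fastforce+
qed

lemma cinner_C1: "VV m n f \<Longrightarrow> VV m n g \<Longrightarrow> j \<le> m \<Longrightarrow> cinner m n f (C1 j g) = cinner m n (C1 j f) g"
  by (auto simp: C1_def cinner_sum_left cinner_sum_right cinner_Eop intro!: sum.cong)

lemma cinner_Cas:
  assumes "VV m n f" "VV m n g" "j \<le> m"
  shows "cinner m n f (Cas j g) = cinner m n (Cas j f) g"
proof -
  have "cinner m n f (Eop a b (Eop b a g)) = cinner m n (Eop a b (Eop b a f)) g" if "a \<in> {1..j}" "b \<in> {1..j}" for a b
    using that assms by (simp add: cinner_Eop VV_Eop)
  then show ?thesis by (auto simp: Cas_def cinner_sum_left cinner_sum_right intro!: sum.cong)
qed

text \<open>Self-adjointness: a nonzero inner product would force both Casimir eigenvalues to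
  coincide, contradicting \<open>casv_sep\<close>.\<close>

lemma Eig_orth:
  assumes f: "VV m n f" "Eig j p q f" and g: "VV m n g" "Eig j p' q' g"
    and j: "1 \<le> j" "j \<le> m" and ne: "(p, q) \<noteq> (p', q')"
  shows "cinner m n f g = 0"
proof (rule ccontr)
  assume nz: "cinner m n f g \<noteq> 0"
  have "complex_of_int (int p' - int q') = of_int (int p - int q)"
    using cinner_C1[OF f(1) g(1) j(2)] f(2) g(2) nz by (simp add: Eig_def cinner_csc_left cinner_csc_right)
  then have 1: "int p - int q = int p' - int q'" using of_int_eq_iff by metis
  have "complex_of_nat (casv j p' q') = of_nat (casv j p q)"
    using cinner_Cas[OF f(1) g(1) j(2)] f(2) g(2) nz by (simp add: Eig_def cinner_csc_left cinner_csc_right)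
  then have "casv j p q = casv j p' q'" by simp
  then show False using casv_sep[OF j(1) 1] ne by simp
qed

section \<open>Monomials and their generation from highest weight vectors\<close>

definition inc :: "nat \<Rightarrow> (nat \<Rightarrow> nat) \<Rightarrow> nat \<Rightarrow> nat" where
  "inc i x = x(i := Suc (x i))"

lemma inc_same [simp]: "inc i x i = Suc (x i)" and inc_other [simp]: "l \<noteq> i \<Longrightarrow> inc i x l = x l"
  by (auto simp: inc_def)

lemma fock_inc: "x \<in> fock m d \<Longrightarrow> i \<in> {1..m} \<Longrightarrow> inc i x \<in> fock m (Suc d)"
  using sum_fun_upd[of i m x "Suc (x i)"] by (auto simp: fock_def inc_def)

lemma fock_incE:
  assumes "x \<in> fock m d" "x i > 0"
  obtains x0 d0 where "x = inc i x0" "d = Suc d0" "x0 \<in> fock m d0" "i \<in> {1..m}"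
proof -
  have i: "i \<in> {1..m}" using assms by (auto simp: fock_def intro: ccontr)
  have s: "sum (x(i := x i - 1)) {1..m} + 1 = d" "d > 0"
    using sum_fun_upd[OF i, of x "x i - 1"] assms i by (auto simp: fock_def)
  show ?thesis
  proof
    show "x = inc i (x(i := x i - 1))" using assms by (auto simp: inc_def)
    show "d = Suc (d - 1)" using s by simp
    show "x(i := x i - 1) \<in> fock m (d - 1)" using s assms i by (auto simp: fock_def)
  qed (rule i)
qed

lemma sum_inc: "i \<in> A \<Longrightarrow> finite A \<Longrightarrow> sum (inc i x) A = Suc (sum x A)"
  by (simp add: sum.remove[of A i] inc_def)
lemma sum_inc_other: "i \<notin> A \<Longrightarrow> sum (inc i x) A = sum x A"
  by (intro sum.cong) (auto simp: inc_def)

text \<open>The monomial z^x w^y without normalisation. Its single coefficient cancels the square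
  roots, so multiplication and differentiation take their elementary form.\<close>

definition zwmon :: "nat \<Rightarrow> (nat \<Rightarrow> nat) \<Rightarrow> (nat \<Rightarrow> nat) \<Rightarrow> cvec" where
  "zwmon m x y = (\<lambda>z. if z = (x, y) then of_real (sqrt (real (mfact m x * mfact m y))) else 0)"

lemma mfact_inc: "i \<in> {1..m} \<Longrightarrow> mfact m (inc i x) = Suc (x i) * mfact m x"
  unfolding mfact_def by (subst (1 2) prod.remove[of _ i]) (auto simp: inc_def algebra_simps intro!: prod.cong)

lemma inc_inj: "inc i x = inc i y \<longleftrightarrow> x = y"
  by (auto simp: inc_def fun_eq_iff)

lemma Zr_mono: "i \<in> {1..m} \<Longrightarrow> Zr i (zwmon m x y) = zwmon m (inc i x) y"
proof
  fix z :: occs assume i: "i \<in> {1..m}"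
  obtain x' y' where z: "z = (x', y')" by force
  show "Zr i (zwmon m x y) z = zwmon m (inc i x) y z"
  proof (cases "x' i")
    case 0
    then have "x' \<noteq> inc i x" by (auto simp: inc_def)
    then show ?thesis using 0 by (simp add: Zr_def zwmon_def z)
  next
    case (Suc k)
    define w where "w = x'(i := k)"
    have x': "x' = inc i w" using Suc by (auto simp: w_def inc_def)
    have "(inc i w)(i := w i) = w" by (auto simp: inc_def)
    then show ?thesis unfolding z x' Zr_def zwmon_def
      by (auto simp: inc_inj mfact_inc[OF i] real_sqrt_mult simp del: of_nat_Suc mult_Suc mult_Suc_right)
  qed
qed

lemma Dr_mono_inc: "i \<in> {1..m} \<Longrightarrow> Dr i (zwmon m (inc i x) y) = csc (of_nat (Suc (x i))) (zwmon m x y)"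
proof
  fix z :: occs assume i: "i \<in> {1..m}"
  obtain x' y' where z: "z = (x', y')" by force
  have e: "x'(i := x' i + 1) = inc i x'" by (simp add: inc_def)
  have "sqrt (real (Suc (x i))) * sqrt (real (Suc (x i) * mfact m x * mfact m y)) = real (Suc (x i)) * sqrt (real (mfact m x * mfact m y))"
    by (simp add: real_sqrt_mult mult.assoc[symmetric] del: of_nat_Suc mult_Suc mult_Suc_right)
  then have "complex_of_real (sqrt (real (Suc (x i)))) * of_real (sqrt (real (Suc (x i) * mfact m x * mfact m y)))
     = of_nat (Suc (x i)) * of_real (sqrt (real (mfact m x * mfact m y)))"
    by (metis of_real_mult of_real_of_nat_eq)
  then show "Dr i (zwmon m (inc i x) y) z = csc (of_nat (Suc (x i))) (zwmon m x y) z"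
    unfolding Dr_def zwmon_def z prod.case e csc_apply prod.inject inc_inj mfact_inc[OF i]
    by auto
qed

lemma Dr_mono_0: "x i = 0 \<Longrightarrow> Dr i (zwmon m x y) = 0"
  by (auto simp: fun_eq_iff Dr_def zwmon_def)

text \<open>Exchanging the two components turns \<open>Zr\<close> and \<open>Dr\<close> into
  \<open>Wr\<close> and \<open>Br\<close>; thus the rules for w are read off from those for
  z.\<close>

lemma zwmon_swap: "zwmon m y x (b, a) = zwmon m x y (a, b)"
  by (auto simp: zwmon_def mult.commute)

lemma Wr_mono: "i \<in> {1..m} \<Longrightarrow> Wr i (zwmon m x y) = zwmon m x (inc i y)"
proof
  fix z :: occs assume i: "i \<in> {1..m}"
  obtain x' y' where z: "z = (x', y')" by force
  have "Zr i (zwmon m y x) (y', x') = zwmon m (inc i y) x (y', x')" using Zr_mono[OF i] by simp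
  then show "Wr i (zwmon m x y) z = zwmon m x (inc i y) z"
    by (simp only: Wr_def Zr_def prod.case z zwmon_swap[of m x y] zwmon_swap[of m x "inc i y"])
qed

lemma Br_mono_inc: "i \<in> {1..m} \<Longrightarrow> Br i (zwmon m x (inc i y)) = csc (of_nat (Suc (y i))) (zwmon m x y)"
proof
  fix z :: occs assume i: "i \<in> {1..m}"
  obtain x' y' where z: "z = (x', y')" by force
  have "Dr i (zwmon m (inc i y) x) (y', x') = csc (of_nat (Suc (y i))) (zwmon m y x) (y', x')" using Dr_mono_inc[OF i] by simp
  then show "Br i (zwmon m x (inc i y)) z = csc (of_nat (Suc (y i))) (zwmon m x y) z"
    by (simp only: Br_def Dr_def csc_apply prod.case z zwmon_swap[of m x y] zwmon_swap[of m x "inc i y"])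
qed

lemma Br_mono_0: "y i = 0 \<Longrightarrow> Br i (zwmon m x y) = 0"
  by (auto simp: fun_eq_iff Br_def zwmon_def)

lemma homp_mono_fun: "x \<in> fock m p \<Longrightarrow> y \<in> fock m q \<Longrightarrow> homp m p q (zwmon m x y)"
  by (auto simp: homp_def zwmon_def)

lemma homp_Cop: "homp m p q f \<Longrightarrow> j \<le> m \<Longrightarrow> homp m (Suc p) (Suc q) (Cop j f)"
  unfolding Cop_def by (intro homp_sum homp_Zr homp_Wr) auto

lemma homp_Cop_pow: "homp m p q f \<Longrightarrow> j \<le> m \<Longrightarrow> homp m (s + p) (s + q) ((Cop j ^^ s) f)"
  by (induction s) (auto intro: homp_Cop)

lemma Eop_Cop_pow: "a \<in> {1..j} \<Longrightarrow> b \<in> {1..j} \<Longrightarrow> Eop a b ((Cop j ^^ s) f) = (Cop j ^^ s) (Eop a b f)"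
  by (induction s) (auto simp: Eop_Cop)

lemmas Cop_pow_lin = lin_pow[OF lin_Cop]
lemmas Cop_pow_simps = Cop_pow_lin[THEN lin_add] Cop_pow_lin[THEN lin_csc] Cop_pow_lin[THEN lin_zero]
  Cop_pow_lin[THEN lin_diff] Cop_pow_lin[THEN lin_sum] Cop_pow_lin[THEN lin_minus]

text \<open>Modulo \<open>C\<^sub>j\<close> every monomial is generated from \<open>z\<^sub>1\<^sup>p w\<^sub>j\<^sup>q\<close> (times variables of index \<open>> j\<close>):
the operators \<open>E\<^sub>b\<^sub>1\<close> spread the \<open>z\<close>-exponents, and \<open>E\<^sub>j\<^sub>a\<close> then moves the \<open>w\<close>-exponents away from \<open>w\<^sub>j\<close>,
where \<open>z\<^sub>j w\<^sub>j\<close> is eliminated by means of \<open>C\<^sub>j\<close>.\<close>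

lemma hw_generate:
  assumes j: "2 \<le> j" "j \<le> m"
    and Sadd: "\<And>f g. f \<in> S \<Longrightarrow> g \<in> S \<Longrightarrow> f + g \<in> S"
    and Scsc: "\<And>c f. f \<in> S \<Longrightarrow> csc c f \<in> S"
    and SE: "\<And>a b f. a \<in> {1..j} \<Longrightarrow> b \<in> {1..j} \<Longrightarrow> f \<in> S \<Longrightarrow> Eop a b f \<in> S"
    and Shw: "\<And>s d x y. s + d = n \<Longrightarrow> x \<in> fock m d \<Longrightarrow> y \<in> fock m d \<Longrightarrow> \<forall>i\<in>{2..j}. x i = 0 \<Longrightarrow>
       \<forall>i\<in>{1..<j}. y i = 0 \<Longrightarrow> (Cop j ^^ s) (zwmon m x y) \<in> S"
  shows "s + d = n \<Longrightarrow> x \<in> fock m d \<Longrightarrow> y \<in> fock m d \<Longrightarrow> (Cop j ^^ s) (zwmon m x y) \<in> S"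
\<comment> \<open>With s + d fixed, one more factor C_j lowers the degree d of the monomial. The
  induction hypothesis therefore puts all multiples of \<open>Cop j ^^ Suc s\<close> into S, which
  makes precise what working modulo C_j means.\<close>
proof (induction d arbitrary: s x y)
  case 0
  then have "x i = 0" "y i = 0" for i by (auto simp: fock_def)
  then show ?case using 0 by (intro Shw[of s 0]) auto
next
  case (Suc d)
  let ?\<mu> = "\<lambda>x y. (Cop j ^^ s) (zwmon m x y)"
  have Sneg: "- f \<in> S" if "f \<in> S" for f using Scsc[OF that, of "-1"] by simp
  have Sdiff: "f - g \<in> S" if "f \<in> S" "g \<in> S" for f g using Sadd[OF that(1) Sneg[OF that(2)]] by simp
  have S0: "0 \<in> S" using Scsc[OF Shw[of n 0 "\<lambda>_. 0" "\<lambda>_. 0"], of 0] by (simp add: fock_def)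
  have Ssum: "(\<Sum>i\<in>A. f i) \<in> S" if "\<And>i. i \<in> A \<Longrightarrow> f i \<in> S" for f and A :: "nat set"
    using that by (induction A rule: infinite_finite_induct) (auto simp: S0 Sadd)
  have cancel: "f \<in> S" if "csc c f \<in> S" "c \<noteq> 0" for c f using Scsc[OF that(1), of "inverse c"] that(2) by simp
  \<comment> \<open>Two linear relations between f and g; adding them eliminates g.\<close>
  have solve: "f \<in> S" if "csc N f - csc K g \<in> S" "csc K (g + f) \<in> S" "N + K \<noteq> 0" for f g N K
  proof -
    have "(csc N f - csc K g) + csc K (g + f) = csc (N + K) f"
      by (simp add: cv.scale_right_distrib cv.scale_left_distrib)
    then show ?thesis using Sadd[OF that(1,2)] cancel[OF _ that(3)] by simp
  qed
  have jm: "i \<in> {1..m}" if "i \<in> {1..j}" for i using that j by auto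
  have rel: "(\<Sum>i\<in>{1..j}. ?\<mu> (inc i x0) (inc i y0)) \<in> S" if "x0 \<in> fock m d" "y0 \<in> fock m d" for x0 y0
  proof -
    have "(Cop j ^^ Suc s) (zwmon m x0 y0) \<in> S" using Suc.IH[of "Suc s" x0 y0] that Suc.prems by simp
    moreover have "(Cop j ^^ Suc s) (zwmon m x0 y0) = (Cop j ^^ s) (Cop j (zwmon m x0 y0))"
      by (simp add: funpow_swap1)
    moreover have "Cop j (zwmon m x0 y0) = (\<Sum>i\<in>{1..j}. zwmon m (inc i x0) (inc i y0))"
      unfolding Cop_def using jm by (intro sum.cong refl) (simp add: Wr_mono Zr_mono)
    ultimately show ?thesis by (simp add: Cop_pow_simps)
  qed
  have rel': "(\<Sum>i\<in>{1..<j}. ?\<mu> (inc i x0) (inc i y0)) + ?\<mu> (inc j x0) (inc j y0) \<in> S" if "x0 \<in> fock m d" "y0 \<in> fock m d" for x0 y0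
  proof -
    have "{1..j} = insert j {1..<j}" using j by auto
    then show ?thesis using rel[OF that] by (simp add: add.commute)
  qed
  \<comment> \<open>Here w_j is the only w-variable of index at most j. E_b1 with 1 < b < j trades a
    factor z_1 for z_b, and its w-part vanishes since w_b does not occur.\<close>
  have B: "?\<mu> x y \<in> S" if "x \<in> fock m (Suc d)" "y \<in> fock m (Suc d)" "x j = 0" "\<forall>i\<in>{1..<j}. y i = 0" for x y
    using that(1,3)
  proof (induction "sum x {2..<j}" arbitrary: x)
    case 0
    then have "\<forall>i\<in>{2..j}. x i = 0" by (auto simp: less_le)
    then show ?case using Shw[of s "Suc d" x y] that Suc.prems 0 by auto
  next
    case (Suc k)
    then obtain b where b: "b \<in> {2..<j}" "x b > 0" by (metis Suc_neq_Zero sum.neutral gr0I)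
    obtain x0 d0 where x0: "x = inc b x0" "x0 \<in> fock m d0" "Suc d = Suc d0" using fock_incE[OF Suc.prems(1) b(2)] by metis
    have "?\<mu> (inc 1 x0) y \<in> S"
    proof (rule Suc.hyps(1))
      show "k = sum (inc 1 x0) {2..<j}" using Suc.hyps(2) b by (simp add: x0 sum_inc sum_inc_other)
      show "inc 1 x0 \<in> fock m (Suc d)" using x0 fock_inc j by simp
      show "inc 1 x0 j = 0" using Suc.prems(2) j b by (simp add: x0 inc_def)
    qed
    then have "Eop b 1 (?\<mu> (inc 1 x0) y) \<in> S" using SE b by auto
    moreover have "Eop b 1 (?\<mu> (inc 1 x0) y) = csc (of_nat (Suc (x0 1))) (?\<mu> x y)"
    proof -
      have "Eop b 1 (zwmon m (inc 1 x0) y) = csc (of_nat (Suc (x0 1))) (zwmon m x y)"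
        using b j that(4) by (simp add: Eop_def Dr_mono_inc linear_simps Zr_mono Br_mono_0 x0 del: of_nat_Suc)
      then show ?thesis using b by (subst Eop_Cop_pow) (auto simp: Cop_pow_simps)
    qed
    ultimately show ?case using cancel of_nat_neq_0 by metis
  qed
  \<comment> \<open>The exponents of w_a with a < j are now arbitrary, while z_j is still absent.
    E_ja trades w_j for w_a at the cost of a term in which z_a becomes z_j.\<close>
  have C: "?\<mu> x y \<in> S" if "x \<in> fock m (Suc d)" "y \<in> fock m (Suc d)" "x j = 0" for x y
    using that
  proof (induction "sum y {1..<j}" arbitrary: x y)
    case 0
    then show ?case using B[of x y] by auto
  next
    case (Suc r)
    then obtain a where a: "a \<in> {1..<j}" "y a > 0" by (metis Suc_neq_Zero sum.neutral gr0I)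
    obtain y0 d0 where y0: "y = inc a y0" "y0 \<in> fock m d0" "Suc d = Suc d0" using fock_incE[OF Suc.prems(2) a(2)] by metis
    have IH: "?\<mu> x' (inc j y0) \<in> S" if "x' \<in> fock m (Suc d)" "x' j = 0" for x'
    proof (rule Suc.hyps(1))
      show "r = sum (inc j y0) {1..<j}" using Suc.hyps(2) a by (simp add: y0 sum_inc sum_inc_other)
      show "inc j y0 \<in> fock m (Suc d)" using y0 fock_inc j by simp
    qed (use that in auto)
    let ?K = "of_nat (Suc (y0 j)) :: complex"
    show ?case
    proof (cases "x a = 0")
      case True
      have "Eop j a (zwmon m x (inc j y0)) = csc (- ?K) (zwmon m x y)"
        using a j True by (simp add: Eop_def Dr_mono_0 linear_simps Wr_mono Br_mono_inc y0 del: of_nat_Suc)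
      then have "Eop j a (?\<mu> x (inc j y0)) = csc (- ?K) (?\<mu> x y)"
        using a j by (subst Eop_Cop_pow) (auto simp: Cop_pow_simps)
      moreover have "Eop j a (?\<mu> x (inc j y0)) \<in> S" using SE IH Suc.prems a j by auto
      ultimately show ?thesis using cancel of_nat_neq_0 neg_equal_0_iff_equal by metis
    next
      case False
      then obtain \<gamma> d1 where g: "x = inc a \<gamma>" "\<gamma> \<in> fock m d1" "Suc d = Suc d1" using fock_incE[OF Suc.prems(1), of a] by (metis gr0I)
      have gj: "\<gamma> j = 0" using Suc.prems(3) a by (simp add: g inc_def)
      let ?M = "?\<mu> (inc j \<gamma>) (inc j y0)" and ?T = "\<Sum>i\<in>{1..<j}. ?\<mu> (inc i \<gamma>) (inc i y0)"
      \<comment> \<open>For every c < j the action of E_jc relates the unwanted monomial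
        \<open>?M\<close>, which contains z_j w_j, to the one containing z_c w_c. Summed over c and
        combined with the relation from C_j, these leave a positive multiple of \<open>?M\<close> in
        S.\<close>
      have F: "csc (of_nat (Suc (\<gamma> c))) ?M - csc ?K (?\<mu> (inc c \<gamma>) (inc c y0)) \<in> S" if c: "c \<in> {1..<j}" for c
      proof -
        have "?\<mu> (inc c \<gamma>) (inc j y0) \<in> S"
        proof (rule IH)
          show "inc c \<gamma> \<in> fock m (Suc d)" using g(2,3) c j by (intro fock_inc) auto
          show "inc c \<gamma> j = 0" using c gj by simp
        qed
        then have "Eop j c (?\<mu> (inc c \<gamma>) (inc j y0)) \<in> S" using SE c j by auto
        moreover have "Eop j c (zwmon m (inc c \<gamma>) (inc j y0)) = csc (of_nat (Suc (\<gamma> c))) (zwmon m (inc j \<gamma>) (inc j y0)) - csc ?K (zwmon m (inc c \<gamma>) (inc c y0))"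
          using c j by (simp add: Eop_def Dr_mono_inc linear_simps Zr_mono Wr_mono Br_mono_inc del: of_nat_Suc)
        moreover have "Eop j c (?\<mu> (inc c \<gamma>) (inc j y0)) = (Cop j ^^ s) (Eop j c (zwmon m (inc c \<gamma>) (inc j y0)))"
          using c j by (intro Eop_Cop_pow) auto
        ultimately show ?thesis by (simp add: Cop_pow_simps del: of_nat_Suc)
      qed
      let ?N = "of_nat (\<Sum>c\<in>{1..<j}. Suc (\<gamma> c)) :: complex"
      have "(\<Sum>c\<in>{1..<j}. csc (of_nat (Suc (\<gamma> c))) ?M - csc ?K (?\<mu> (inc c \<gamma>) (inc c y0))) \<in> S"
        by (rule Ssum) (rule F)
      then have "csc ?N ?M - csc ?K ?T \<in> S"
        by (simp only: sum_subtractf cv.scale_sum_left cv.scale_sum_right of_nat_sum)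
      moreover have "csc ?K (?T + ?M) \<in> S"
      proof (rule Scsc)
        have "d1 = d" "d0 = d" using g(3) y0(3) by simp_all
        then show "?T + ?M \<in> S" using rel'[of \<gamma> y0] g(2) y0(2) by blast
      qed
      moreover have "?N + ?K \<noteq> 0"
      proof -
        have "?N + ?K = of_nat (Suc ((\<Sum>c\<in>{1..<j}. Suc (\<gamma> c)) + y0 j))" by (simp only: of_nat_add of_nat_Suc add_ac)
        then show ?thesis by (simp only: of_nat_neq_0 simp_thms)
      qed
      ultimately have M: "?M \<in> S" by (rule solve)
      have "csc (of_nat (Suc (\<gamma> a))) ?M - (csc (of_nat (Suc (\<gamma> a))) ?M - csc ?K (?\<mu> (inc a \<gamma>) (inc a y0))) \<in> S"
        by (rule Sdiff[OF Scsc[OF M] F[OF a(1)]])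
      then have "csc ?K (?\<mu> x y) \<in> S" unfolding g(1) y0(1) by simp
      then show ?thesis using cancel of_nat_neq_0 by metis
    qed
  qed
  \<comment> \<open>Induction on the exponent of z_j: without w_j it is created from z_1 by E_j1,
    and otherwise z_j w_j is replaced by minus the sum of the other z_i w_i.\<close>
  have D: "?\<mu> x y \<in> S" if "x \<in> fock m (Suc d)" "y \<in> fock m (Suc d)" for x y
    using that
  proof (induction "x j" arbitrary: x y)
    case 0
    have "x j = 0" using 0(1) by (rule sym)
    then show ?case by (rule C[OF 0(2,3)])
  next
    case (Suc k)
    obtain x0 d0 where x0: "x = inc j x0" "x0 \<in> fock m d0" "Suc d = Suc d0"
      using fock_incE[OF Suc.prems(1), of j] Suc.hyps(2) by (metis zero_less_Suc)
    show ?case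
    proof (cases "y j = 0")
      case True
      have "?\<mu> (inc 1 x0) y \<in> S"
      proof (rule Suc.hyps(1)[OF _ _ Suc.prems(2)])
        show "k = inc 1 x0 j" using Suc.hyps(2) j unfolding x0(1) by simp
        show "inc 1 x0 \<in> fock m (Suc d)" using x0(2,3) j by (intro fock_inc) auto
      qed
      then have "Eop j 1 (?\<mu> (inc 1 x0) y) \<in> S" using SE j by auto
      moreover have "Eop j 1 (zwmon m (inc 1 x0) y) = csc (of_nat (Suc (x0 1))) (zwmon m x y)"
        using j True by (simp add: Eop_def Dr_mono_inc linear_simps Zr_mono Br_mono_0 x0 del: of_nat_Suc)
      then have "Eop j 1 (?\<mu> (inc 1 x0) y) = csc (of_nat (Suc (x0 1))) (?\<mu> x y)"
        using j by (subst Eop_Cop_pow) (auto simp: Cop_pow_simps)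
      ultimately show ?thesis using cancel of_nat_neq_0 by metis
    next
      case False
      obtain y0 d1 where y0: "y = inc j y0" "y0 \<in> fock m d1" "Suc d = Suc d1"
        using fock_incE[OF Suc.prems(2), of j] False by (metis gr0I)
      have "?\<mu> (inc i x0) (inc i y0) \<in> S" if "i \<in> {1..<j}" for i
      proof (rule Suc.hyps(1))
        show "k = inc i x0 j" using Suc.hyps(2) j that unfolding x0(1) by simp
        show "inc i x0 \<in> fock m (Suc d)" using x0(2,3) that j by (intro fock_inc) auto
        show "inc i y0 \<in> fock m (Suc d)" using y0(2,3) that j by (intro fock_inc) auto
      qed
      then have "(\<Sum>i\<in>{1..<j}. ?\<mu> (inc i x0) (inc i y0)) \<in> S" by (rule Ssum)
      then have "(\<Sum>i\<in>{1..<j}. ?\<mu> (inc i x0) (inc i y0)) + ?\<mu> (inc j x0) (inc j y0) - (\<Sum>i\<in>{1..<j}. ?\<mu> (inc i x0) (inc i y0)) \<in> S"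
        using rel'[of x0 y0] x0(2,3) y0(2,3) by (intro Sdiff) auto
      then show ?thesis unfolding x0(1) y0(1) by simp
    qed
  qed
  show ?case using D Suc.prems by blast
qed

text \<open>Within the first j pairs only z_1 and w_j occur, so every E_ab with a < b differentiates
  by an absent variable. Variables of index above j are inert for gl(j), and C_j commutes with
  gl(j).\<close>

lemma hw_mono:
  assumes j: "1 \<le> j" "j \<le> m" and sd: "s + d = n" "x \<in> fock m d" "y \<in> fock m d"
    and xy: "\<forall>i\<in>{2..j}. x i = 0" "\<forall>i\<in>{1..<j}. y i = 0"
  shows "hw m n j (rowmu j (x 1) (y j)) ((Cop j ^^ s) (zwmon m x y))"
proof -
  let ?f = "(Cop j ^^ s) (zwmon m x y)"
  have V: "VV m n ?f" using homp_Cop_pow[OF homp_mono_fun[OF sd(2,3)] j(2), of s] sd by simp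
  have "dRho m n a a ?f = (\<lambda>z. of_int (rowmu j (x 1) (y j) a) * ?f z)" if a: "a \<in> {1..j}" for a
  proof -
    have "Eop a a (zwmon m x y) = csc (of_nat (x a) - of_nat (y a)) (zwmon m x y)"
      by (auto simp: fun_eq_iff Eop_def ZD_apply WB_apply zwmon_def algebra_simps)
    moreover have "(of_nat (x a) - of_nat (y a) :: complex) = of_int (rowmu j (x 1) (y j) a)"
      using xy a by (auto simp: rowmu_def)
    ultimately have "Eop a a ?f = csc (of_int (rowmu j (x 1) (y j) a)) ?f"
      using a by (simp add: Eop_Cop_pow Cop_pow_simps)
    then show ?thesis using dRho_Eop[OF V, of a a] a j by (auto simp: csc_def)
  qed
  moreover have "dRho m n a b ?f = (\<lambda>z. 0)" if ab: "1 \<le> a" "a < b" "b \<le> j" for a b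
  proof -
    have "Eop a b (zwmon m x y) = 0"
      using ab xy by (simp add: Eop_def Dr_mono_0 Br_mono_0 linear_simps)
    then have "Eop a b ?f = 0" using ab by (simp add: Eop_Cop_pow Cop_pow_simps)
    then show ?thesis using dRho_Eop[OF V, of a b] ab j by (auto simp: zero_fun_def)
  qed
  ultimately show ?thesis using V by (auto simp: hw_def VV_iff)
qed

text \<open>S collects the vectors that agree with an element of the component up to a vector
  orthogonal to the whole eigenspace. It is stable under gl(j), since adjoints of the generators
  preserve the eigenspace, and it contains the highest weight vectors of every weight; by
  \<open>hw_generate\<close> it is everything. If f itself is an eigenvector, the remainder f - u is
  orthogonal to itself.\<close>

lemma Eig_isocomp_ge2:
  assumes j: "2 \<le> j" "j \<le> m" and f: "VV m n f" "Eig j p q f"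
  shows "f \<in> isocomp m n j (rowmu j p q)"
proof -
  let ?U = "isocomp m n j (rowmu j p q)"
  let ?P = "\<lambda>v. \<forall>g. VV m n g \<longrightarrow> Eig j p q g \<longrightarrow> cinner m n g v = 0"
  define S where "S = {v. VV m n v \<and> (\<exists>u\<in>?U. ?P (v - u))}"
  have SI: "v \<in> S" if "VV m n v" "u \<in> ?U" "?P (v - u)" for u v using that by (auto simp: S_def)
  have Sadd: "v + w \<in> S" if vw: "v \<in> S" "w \<in> S" for v w
  proof -
    obtain u u' where u: "u \<in> ?U" "?P (v - u)" "u' \<in> ?U" "?P (w - u')" using vw by (auto simp: S_def)
    have e: "(v + w) - (u + u') = (v - u) + (w - u')" by simp
    have "?P ((v + w) - (u + u'))" unfolding e cinner_add_right using u(2,4) by simp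
    moreover have "VV m n (v + w)" using vw by (simp add: S_def homp_add)
    ultimately show ?thesis using isocomp_plus[OF u(1,3)] SI by blast
  qed
  have Scsc: "csc c v \<in> S" if v: "v \<in> S" for c v
  proof -
    obtain u where u: "u \<in> ?U" "?P (v - u)" using v by (auto simp: S_def)
    have e: "csc c v - csc c u = csc c (v - u)" by (simp add: cv.scale_right_diff_distrib)
    have "?P (csc c v - csc c u)" unfolding e cinner_csc_right using u(2) by simp
    moreover have "VV m n (csc c v)" using v by (simp add: S_def homp_csc)
    ultimately show ?thesis using isocomp_csc[OF u(1)] SI by blast
  qed
  have SE: "Eop a b v \<in> S" if ab: "a \<in> {1..j}" "b \<in> {1..j}" and v: "v \<in> S" for a b v
  proof -
    obtain u where u: "u \<in> ?U" "?P (v - u)" using v by (auto simp: S_def)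
    have vu: "VV m n (v - u)" using v u isocomp_VV by (auto simp: S_def intro: homp_diff)
    have abm: "a \<in> {1..m}" "b \<in> {1..m}" using ab j by auto
    have e: "Eop a b v - Eop a b u = Eop a b (v - u)" by (simp add: linear_simps)
    have "?P (Eop a b v - Eop a b u)"
    proof (intro allI impI)
      fix g assume g: "VV m n g" "Eig j p q g"
      have "cinner m n g (Eop a b (v - u)) = cinner m n (Eop b a g) (v - u)"
        by (rule cinner_Eop[OF g(1) vu abm])
      also have "\<dots> = 0"
        using u(2) VV_Eop[OF g(1) abm(2,1)] Eig_Eop[OF g(2) ab(2,1)] by simp
      finally show "cinner m n g (Eop a b v - Eop a b u) = 0" unfolding e .
    qed
    moreover have "VV m n (Eop a b v)" using v abm by (simp add: S_def VV_Eop)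
    ultimately show ?thesis using isocomp_Eop[OF u(1) ab j(2)] SI by blast
  qed
  have Shw: "(Cop j ^^ s) (zwmon m x y) \<in> S" if "s + d = n" "x \<in> fock m d" "y \<in> fock m d" "\<forall>i\<in>{2..j}. x i = 0"
       "\<forall>i\<in>{1..<j}. y i = 0" for s d x y
  proof -
    let ?v = "(Cop j ^^ s) (zwmon m x y)"
    have h: "hw m n j (rowmu j (x 1) (y j)) ?v" using hw_mono[OF _ j(2) that] j by simp
    have V: "VV m n ?v" using isocomp_VV[OF isocomp.base[OF h]] .
    show ?thesis
    proof (cases "(x 1, y j) = (p, q)")
      case True
      have "?v \<in> ?U" using isocomp.base[OF h] True by simp
      then show ?thesis using SI[OF V] by (simp add: cinner_zero_right)
    next
      case False
      have "Eig j (x 1) (y j) ?v" using hw_Eig[OF h] j by simp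
      then have "?P (?v - 0)" using Eig_orth[OF _ _ V _ _ j(2)] j False by auto
      then show ?thesis by (rule SI[OF V isocomp_0])
    qed
  qed
  have mon: "basisv x y \<in> S" if "x \<in> fock m n" "y \<in> fock m n" for x y
  proof -
    have "(Cop j ^^ 0) (zwmon m x y) \<in> S" by (rule hw_generate[OF j Sadd Scsc SE Shw]) (use that in auto)
    then have "csc (inverse (of_real (sqrt (real (mfact m x * mfact m y))))) (zwmon m x y) \<in> S" using Scsc by simp
    moreover have "csc (inverse (of_real (sqrt (real (mfact m x * mfact m y))))) (zwmon m x y) = basisv x y"
      using mfact_pos[of m x] mfact_pos[of m y] by (auto simp: fun_eq_iff zwmon_def basisv_def)
    ultimately show ?thesis by simp
  qed
  have S0: "0 \<in> S" by (rule SI[OF homp_zero isocomp_0]) (simp add: cinner_zero_right)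
  have sum_in: "(\<And>i. i \<in> A \<Longrightarrow> h i \<in> S) \<Longrightarrow> (\<Sum>i\<in>A. h i) \<in> S" for h and A :: "occs set"
    by (induction A rule: infinite_finite_induct) (auto intro: S0 Sadd)
  have "f = (\<Sum>z\<in>dom2 m n. csc (f z) (basisv (fst z) (snd z)))"
    using f(1) by (auto simp: fun_eq_iff sum_fun_apply basisv_def VV_iff finite_dom2 if_distrib cong: if_cong)
  moreover have "(\<Sum>z\<in>dom2 m n. csc (f z) (basisv (fst z) (snd z))) \<in> S"
  proof -
    have "csc (f z) (basisv (fst z) (snd z)) \<in> S" if "z \<in> dom2 m n" for z
      using that by (intro Scsc mon) (auto simp: dom2_def)
    then show ?thesis by (rule sum_in)
  qed
  ultimately have "f \<in> S" by simp
  then obtain u where u: "u \<in> ?U" "?P (f - u)" by (auto simp: S_def)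
  have "Eig j p q u" using isocomp_Eig[OF u(1)] j by simp
  then have e: "Eig j p q (f - u)" by (rule Eig_diff[OF f(2)])
  have V: "VV m n (f - u)" by (rule homp_diff[OF f(1) isocomp_VV[OF u(1)]])
  have "cinner m n (f - u) (f - u) = 0" using u(2) e V by simp
  then have "f - u = 0" by (rule cinner_self_zero[OF V])
  then show ?thesis using u by simp
qed

lemma Eig_isocomp_1:
  assumes f: "VV m n f" "Eig 1 p q f" and m: "1 \<le> m"
  shows "f \<in> isocomp m n 1 (rowmu 1 p q)"
proof (rule isocomp.base)
  have "Eop 1 1 f = csc (of_int (int p - int q)) f" using f(2) by (simp add: Eig_def C1_def)
  then show "hw m n 1 (rowmu 1 p q) f"
    using f(1) m dRho_Eop[OF f(1), of 1 1] by (auto simp: hw_def VV_iff rowmu_def csc_def)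
qed

lemma Eig_isocomp:
  assumes "VV m n f" "Eig j p q f" "1 \<le> j" "j \<le> m"
  shows "f \<in> isocomp m n j (rowmu j p q)"
  using Eig_isocomp_1 Eig_isocomp_ge2 assms by (cases "j = 1") auto

section \<open>Harmonic polynomials along the chain\<close>

lemma Nz_Zr: "Nz j (Zr i f) = Zr i (Nz j f) + (if i \<in> {1..j} then Zr i f else 0)"
  and Nw_Wr: "Nw j (Wr i f) = Wr i (Nw j f) + (if i \<in> {1..j} then Wr i f else 0)"
  and Nz_Wr: "Nz j (Wr i f) = Wr i (Nz j f)"
  and Nw_Zr: "Nw j (Zr i f) = Zr i (Nw j f)"
proof -
  have "Zr l (Dr l (Zr i f)) = Zr i (Zr l (Dr l f)) + (if l = i then Zr i f else 0)" for l
    by (simp add: Dr_Zr linear_simps Zr_commute[of l i])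
  then show "Nz j (Zr i f) = Zr i (Nz j f) + (if i \<in> {1..j} then Zr i f else 0)"
    by (simp add: Nz_def linear_simps sum.distrib)
  have "Wr l (Br l (Wr i f)) = Wr i (Wr l (Br l f)) + (if l = i then Wr i f else 0)" for l
    by (simp add: Br_Wr linear_simps Wr_commute[of l i])
  then show "Nw j (Wr i f) = Wr i (Nw j f) + (if i \<in> {1..j} then Wr i f else 0)"
    by (simp add: Nw_def linear_simps sum.distrib)
  show "Nz j (Wr i f) = Wr i (Nz j f)" by (simp add: Nz_def linear_simps Wr_Dr Wr_Zr flip: Wr_Dr)
  show "Nw j (Zr i f) = Zr i (Nw j f)" by (simp add: Nw_def linear_simps Br_Zr Wr_Zr)
qed

lemma Nz_Cop: "Nz j (Cop j f) = Cop j (Nz j f) + Cop j f"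
  and Nw_Cop: "Nw j (Cop j f) = Cop j (Nw j f) + Cop j f"
  by (simp_all add: Cop_def linear_simps Nz_Zr Nz_Wr Nw_Zr Nw_Wr sum.distrib)

lemma Nz_Cop_pow:
  assumes "Nz j g = csc (of_nat p) g"
  shows "Nz j ((Cop j ^^ s) g) = csc (of_nat (p + s)) ((Cop j ^^ s) g)"
proof (induction s)
  case (Suc s)
  have "Nz j ((Cop j ^^ Suc s) g) = csc (of_nat (p + s)) ((Cop j ^^ Suc s) g) + (Cop j ^^ Suc s) g"
    unfolding funpow.simps(2) comp_apply Nz_Cop Suc.IH lin_csc[OF lin_Cop] ..
  then show ?case by (simp add: fun_eq_iff algebra_simps)
qed (simp add: assms)
lemma Nw_Cop_pow:
  assumes "Nw j g = csc (of_nat q) g"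
  shows "Nw j ((Cop j ^^ s) g) = csc (of_nat (q + s)) ((Cop j ^^ s) g)"
proof (induction s)
  case (Suc s)
  have "Nw j ((Cop j ^^ Suc s) g) = csc (of_nat (q + s)) ((Cop j ^^ Suc s) g) + (Cop j ^^ Suc s) g"
    unfolding funpow.simps(2) comp_apply Nw_Cop Suc.IH lin_csc[OF lin_Cop] ..
  then show ?case by (simp add: fun_eq_iff algebra_simps)
qed (simp add: assms)

text \<open>The standard sl(2) computation on a lowest weight vector, the harmonic g. The scalar
  serves twice: it is the denominator in \<open>hcoeff\<close>, and its positivity keeps powers of
  C_j injective on harmonics.\<close>

lemma Lap_Cop_pow:
  assumes "Lap j g = 0" "Nz j g = csc (of_nat p) g" "Nw j g = csc (of_nat q) g"
  shows "Lap j ((Cop j ^^ Suc s) g) = csc (of_nat (Suc s * (s + j + p + q))) ((Cop j ^^ s) g)"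
proof (induction s)
  case 0
  have "Lap j (Cop j g) = csc (of_nat p) g + csc (of_nat q) g + csc (of_nat j) g"
    unfolding Lap_Cop assms lin_zero[OF lin_Cop] by simp
  then show ?case by (simp add: fun_eq_iff algebra_simps)
next
  case (Suc s)
  let ?f = "(Cop j ^^ Suc s) g"
  have "Lap j ((Cop j ^^ Suc (Suc s)) g) = Cop j (Lap j ?f) + Nz j ?f
     + Nw j ?f + csc (of_nat j) ?f"
    unfolding funpow.simps(2)[of "Suc s"] comp_apply by (rule Lap_Cop)
  also have "\<dots> = csc (of_nat (Suc s * (s + j + p + q))) ?f
     + csc (of_nat (p + Suc s)) ?f + csc (of_nat (q + Suc s)) ?f + csc (of_nat j) ?f"
    unfolding Suc.IH Nz_Cop_pow[OF assms(2)] Nw_Cop_pow[OF assms(3)] by (simp add: linear_simps del: of_nat_mult)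
  also have "\<dots> = csc (of_nat (Suc s * (s + j + p + q)) + of_nat (p + Suc s) + of_nat (q + Suc s) + of_nat j) ?f"
    by (simp only: cv.scale_left_distrib)
  also have "(of_nat (Suc s * (s + j + p + q)) + of_nat (p + Suc s) + of_nat (q + Suc s) + of_nat j :: complex)
     = of_nat (Suc (Suc s) * (Suc s + j + p + q))"
    by (simp add: algebra_simps)
  finally show ?case .
qed

lemma Dr_Cop: "j < i \<Longrightarrow> Dr i (Cop j f) = Cop j (Dr i f)"
  and Br_Cop: "j < i \<Longrightarrow> Br i (Cop j f) = Cop j (Br i f)"
  by (auto simp: Cop_def linear_simps Dr_Zr Br_Wr Br_Zr Wr_Dr[symmetric] intro!: sum.cong)

lemma Dr_Cop_pow: "j < i \<Longrightarrow> Dr i ((Cop j ^^ s) f) = (Cop j ^^ s) (Dr i f)"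
  and Br_Cop_pow: "j < i \<Longrightarrow> Br i ((Cop j ^^ s) f) = (Cop j ^^ s) (Br i f)"
  by (induction s) (simp_all add: Dr_Cop Br_Cop)

lemma Zr_Cop_pow: "Zr i ((Cop j ^^ s) f) = (Cop j ^^ s) (Zr i f)"
  and Wr_Cop_pow: "Wr i ((Cop j ^^ s) f) = (Cop j ^^ s) (Wr i f)"
  by (induction s) (simp_all add: Cop_Zr[symmetric] Cop_Wr[symmetric])

section \<open>Adjoining one pair of variables, and the harmonic extension\<close>

definition ZW :: "nat \<Rightarrow> nat \<Rightarrow> nat \<Rightarrow> cvec \<Rightarrow> cvec" where
  "ZW i a b h = (Zr i ^^ a) ((Wr i ^^ b) h)"

lemma lin_ZW: "lin (ZW i a b)"
  unfolding ZW_def by (intro lin_comp[OF lin_pow[OF lin_Zr]] lin_pow[OF lin_Wr])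

lemma ZW_0 [simp]: "ZW i 0 0 h = h"
  and ZW_Suc_left: "ZW i (Suc a) b h = Zr i (ZW i a b h)"
  and ZW_0_Suc: "ZW i 0 (Suc b) h = Wr i (ZW i 0 b h)"
  by (simp_all add: ZW_def)

lemma Wr_Zr_pow: "Wr i ((Zr l ^^ a) h) = (Zr l ^^ a) (Wr i h)"
  by (induction a) (simp_all add: Wr_Zr)

lemma ZW_Suc_right: "ZW i a (Suc b) h = Wr i (ZW i a b h)"
  by (simp add: ZW_def Wr_Zr_pow)

lemma ZW_preserve:
  assumes "\<And>f. P f \<Longrightarrow> P (Zr i f)" "\<And>f. P f \<Longrightarrow> P (Wr i f)" "P h"
  shows "P (ZW i a b h)"
proof (induction a)
  case 0
  show ?case by (induction b) (simp_all add: ZW_0_Suc assms)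
qed (simp add: ZW_Suc_left assms)

lemma ZW_commute:
  assumes "\<And>f. T (Zr i f) = Zr i (T f)" "\<And>f. T (Wr i f) = Wr i (T f)"
  shows "T (ZW i a b h) = ZW i a b (T h)"
proof (induction a)
  case 0
  show ?case by (induction b) (simp_all add: ZW_0_Suc assms)
qed (simp add: ZW_Suc_left assms)

lemma Dr_ZW:
  assumes "Dr i h = 0"
  shows "Dr i (ZW i a b h) = csc (of_nat a) (ZW i (a - 1) b h)"
proof (induction a)
  case 0
  have "Dr i (ZW i 0 b h) = 0"
    by (induction b) (simp_all only: ZW_0 ZW_0_Suc assms Wr_Dr[symmetric] lin_zero[OF lin_Wr])
  then show ?case by simp
next
  case (Suc a)
  have "csc (of_nat a) (Zr i (ZW i (a - 1) b h)) = csc (of_nat a) (ZW i a b h)"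
    by (cases a) (simp_all add: ZW_Suc_left)
  moreover have "Dr i (ZW i (Suc a) b h) = csc (of_nat a) (Zr i (ZW i (a - 1) b h)) + ZW i a b h"
    unfolding ZW_Suc_left Dr_Zr Suc.IH lin_csc[OF lin_Zr] by simp
  ultimately show ?case by (simp add: fun_eq_iff algebra_simps)
qed

lemma Br_ZW:
  assumes "Br i h = 0"
  shows "Br i (ZW i a b h) = csc (of_nat b) (ZW i a (b - 1) h)"
proof (induction b)
  case 0
  have "Br i (ZW i a 0 h) = 0"
    by (induction a) (simp_all only: ZW_0 ZW_Suc_left assms Br_Zr lin_zero[OF lin_Zr])
  then show ?case by simp
next
  case (Suc b)
  have "csc (of_nat b) (Wr i (ZW i a (b - 1) h)) = csc (of_nat b) (ZW i a b h)"
    by (cases b) (simp_all add: ZW_Suc_right)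
  moreover have "Br i (ZW i a (Suc b) h) = csc (of_nat b) (Wr i (ZW i a (b - 1) h)) + ZW i a b h"
    unfolding ZW_Suc_right Br_Wr Suc.IH lin_csc[OF lin_Wr] by simp
  ultimately show ?case by (simp add: fun_eq_iff algebra_simps)
qed

lemma ZW_inj: "ZW i a b h = 0 \<Longrightarrow> h = 0"
proof (induction a)
  case 0
  then show ?case
  proof (induction b)
    case (Suc b)
    show ?case by (rule Suc.IH, rule Wr_inj[of i], rule Suc.prems[unfolded ZW_0_Suc])
  qed (simp only: ZW_0)
next
  case (Suc a)
  show ?case by (rule Suc.IH, rule Zr_inj[of i], rule Suc.prems[unfolded ZW_Suc_left])
qed

lemma homp_ZW:
  assumes "homp j p q h" "i \<in> {1..j}"
  shows "homp j (p + a) (q + b) (ZW i a b h)"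
proof (induction a)
  case 0
  show ?case by (induction b) (simp_all only: ZW_0 ZW_0_Suc assms homp_Wr add_0_right add_Suc_right)
qed (simp only: ZW_Suc_left assms homp_Zr add_Suc add_Suc_right)

lemma homp_Dr_0: "homp j p q h \<Longrightarrow> j < i \<Longrightarrow> Dr i h = 0"
  and homp_Br_0: "homp j p q h \<Longrightarrow> j < i \<Longrightarrow> Br i h = 0"
proof -
  assume h: "homp j p q h" "j < i"
  have n: "x(i := x i + 1) \<notin> fock j d" for x d
    using h(2) by (auto simp: fock_def intro!: exI[of _ i])
  have "h (x(i := x i + 1), y) = 0" "h (x, y(i := y i + 1)) = 0" for x y
    using h(1) n unfolding homp_def by blast+
  then show "Dr i h = 0" "Br i h = 0"
    by (simp_all add: fun_eq_iff Dr_def Br_def)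
qed

text \<open>The ratio of consecutive coefficients is forced: (a - s)(b - s) comes from
  differentiating by the new pair, (s + 1)(s + j + p + q) from \<open>Lap_Cop_pow\<close>. For j + p
  + q > 0 these are the coefficients of the terminating series 2F1(-a, -b; j + p + q; -X).\<close>

primrec hcoeff :: "nat \<Rightarrow> nat \<Rightarrow> nat \<Rightarrow> nat \<Rightarrow> nat \<Rightarrow> nat \<Rightarrow> real" where
  "hcoeff j p q a b 0 = 1"
| "hcoeff j p q a b (Suc s) = - hcoeff j p q a b s * (real (a - s) * real (b - s) / (real (Suc s) * real (s + j + p + q)))"

definition Et :: "nat \<Rightarrow> nat \<Rightarrow> nat \<Rightarrow> cvec \<Rightarrow> nat \<Rightarrow> cvec" where
  "Et j a b h s = (Cop j ^^ s) (ZW (Suc j) (a - s) (b - s) h)"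

text \<open>For \<open>h\<close> harmonic of bidegree \<open>(p, q)\<close> in \<open>j\<close> variables, this is the harmonic polynomial in one more
variable with leading term \<open>z\<^sup>a w\<^sup>b h\<close>: applying the Laplacian to the sum telescopes by the choice
of the coefficients.\<close>

definition Hst :: "nat \<Rightarrow> nat \<Rightarrow> nat \<Rightarrow> nat \<Rightarrow> nat \<Rightarrow> cvec \<Rightarrow> cvec" where
  "Hst j p q a b h = (\<Sum>s\<le>min a b. csc (of_real (hcoeff j p q a b s)) (Et j a b h s))"

lemma Et_preserve:
  assumes "\<And>f. P f \<Longrightarrow> P (Zr (Suc j) f)" "\<And>f. P f \<Longrightarrow> P (Wr (Suc j) f)" "\<And>f. P f \<Longrightarrow> P (Cop j f)" "P h"
  shows "P (Et j a b h s)"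
proof -
  have "P (ZW (Suc j) (a - s) (b - s) h)" by (rule ZW_preserve[where P = P, OF assms(1,2,4)])
  then have "P ((Cop j ^^ r) (ZW (Suc j) (a - s) (b - s) h))" for r
    by (induction r) (simp_all add: assms(3))
  then show ?thesis unfolding Et_def .
qed

lemma homp_Et:
  assumes "homp j p q h" "s \<le> min a b"
  shows "homp (Suc j) (p + a) (q + b) (Et j a b h s)"
proof -
  have "homp (Suc j) (p + (a - s)) (q + (b - s)) (ZW (Suc j) (a - s) (b - s) h)"
    by (rule homp_ZW[OF homp_mono[OF assms(1)]]) auto
  then have "homp (Suc j) (s + (p + (a - s))) (s + (q + (b - s))) (Et j a b h s)"
    unfolding Et_def by (rule homp_Cop_pow) simp
  moreover have "s + (p + (a - s)) = p + a" "s + (q + (b - s)) = q + b" using assms(2) by auto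
  ultimately show ?thesis by simp
qed

lemma homp_Hst: "homp j p q h \<Longrightarrow> homp (Suc j) (p + a) (q + b) (Hst j p q a b h)"
  unfolding Hst_def by (rule homp_sum, rule homp_csc, rule homp_Et) auto

text \<open>The Laplacian in one more pair has two parts: the old one lowers the power of C_j, the
  new one lowers both new exponents. Both results lie in the same family G, shifted by one, which
  makes telescoping possible.\<close>

lemma Lap_Et:
  fixes a b s :: nat
  assumes h: "homp j p q h" "Lap j h = 0"
  defines "G \<equiv> \<lambda>s. (Cop j ^^ s) (ZW (Suc j) (a - Suc s) (b - Suc s) h)"
  shows "Lap (Suc j) (Et j a b h 0) = csc (of_nat a * of_nat b) (G 0)"
    and "Lap (Suc j) (Et j a b h (Suc s)) = csc (of_nat (Suc s * (s + j + p + q))) (G s)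
       + csc (of_nat (a - Suc s) * of_nat (b - Suc s)) (G (Suc s))"
proof -
  let ?g = "\<lambda>s. ZW (Suc j) (a - s) (b - s) h"
  have L: "Lap j (?g s) = 0" for s
    using ZW_commute[of "Lap j" "Suc j"] by (simp add: Lap_Zr Lap_Wr h(2) lin_zero[OF lin_ZW])
  have Z: "Nz j (?g s) = csc (of_nat p) (?g s)" for s
    using ZW_commute[of "Nz j" "Suc j"] by (simp add: Nz_Zr Nz_Wr homp_Nz[OF h(1)] lin_csc[OF lin_ZW])
  have W: "Nw j (?g s) = csc (of_nat q) (?g s)" for s
    using ZW_commute[of "Nw j" "Suc j"] by (simp add: Nw_Zr Nw_Wr homp_Nw[OF h(1)] lin_csc[OF lin_ZW])
  have D: "Dr (Suc j) (Br (Suc j) (Et j a b h s)) = csc (of_nat (a - s) * of_nat (b - s)) (G s)" for s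
  proof -
    have "Dr (Suc j) (Br (Suc j) (?g s)) = csc (of_nat (a - s) * of_nat (b - s)) (ZW (Suc j) (a - Suc s) (b - Suc s) h)"
      by (simp add: Br_ZW Dr_ZW homp_Dr_0[OF h(1)] homp_Br_0[OF h(1)] linear_simps mult.commute)
    then show ?thesis by (simp add: Et_def G_def Br_Cop_pow Dr_Cop_pow Cop_pow_simps)
  qed
  show "Lap (Suc j) (Et j a b h 0) = csc (of_nat a * of_nat b) (G 0)"
    using D[of 0] L[of 0] by (simp add: Lap_Suc Et_def)
  have "Lap j (Et j a b h (Suc s)) = csc (of_nat (Suc s * (s + j + p + q))) (G s)"
    unfolding Et_def G_def by (rule Lap_Cop_pow[OF L Z W])
  then show "Lap (Suc j) (Et j a b h (Suc s)) = csc (of_nat (Suc s * (s + j + p + q))) (G s)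
       + csc (of_nat (a - Suc s) * of_nat (b - Suc s)) (G (Suc s))"
    using D[of "Suc s"] by (simp only: Lap_Suc)
qed

lemma Lap_Hst:
  assumes h: "homp j p q h" "Lap j h = 0" and ab: "j = 0 \<Longrightarrow> a = 0 \<or> b = 0"
  shows "Lap (Suc j) (Hst j p q a b h) = 0"
proof -
  let ?c = "\<lambda>s. complex_of_real (hcoeff j p q a b s)"
  define G where "G s = (Cop j ^^ s) (ZW (Suc j) (a - Suc s) (b - Suc s) h)" for s
  \<comment> \<open>Partial sums leave only a boundary term, and at r = \<open>min a b\<close> it
    vanishes because one of the two exponents is exhausted.\<close>
  have part: "(\<Sum>s\<le>r. csc (?c s) (Lap (Suc j) (Et j a b h s))) = csc (?c r * (of_nat (a - r) * of_nat (b - r))) (G r)"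
    if "r \<le> min a b" for r
    using that
  proof (induction r)
    case 0
    show ?case using Lap_Et(1)[OF h, of a b] by (simp add: G_def)
  next
    case (Suc r)
    let ?A = "?c r * (of_nat (a - r) * of_nat (b - r))" and ?B = "?c (Suc r) * of_nat (Suc r * (r + j + p + q))"
    \<comment> \<open>Here a and b are positive, so the hypothesis on j = 0 excludes that case and
      the division in \<open>hcoeff\<close> is a genuine one.\<close>
    have nz: "r + j + p + q \<noteq> 0" using Suc.prems ab by auto
    have "?B = - (?A)"
    proof -
      have "hcoeff j p q a b (Suc r) * real (Suc r * (r + j + p + q)) = - (hcoeff j p q a b r * (real (a - r) * real (b - r)))"
      proof -
        have K: "real (Suc r) * real (r + j + p + q) \<noteq> 0" using nz by (simp only: mult_eq_0_iff of_nat_eq_0_iff) simp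
        have "- f * (X / K) * K = - (f * X)" if "K \<noteq> 0" for f X K :: real using that by simp
        from this[OF K] show ?thesis by (simp only: hcoeff.simps(2) of_nat_mult)
      qed
      then show ?thesis by (metis of_real_mult of_real_minus of_real_of_nat_eq)
    qed
    then have c: "?A + ?B = 0" by simp
    have "(\<Sum>s\<le>Suc r. csc (?c s) (Lap (Suc j) (Et j a b h s)))
       = csc (?A) (G r)
       + csc (?c (Suc r)) (csc (of_nat (Suc r * (r + j + p + q))) (G r)
       + csc (of_nat (a - Suc r) * of_nat (b - Suc r)) (G (Suc r)))"
      using Suc Lap_Et(2)[OF h, of a b r] by (simp only: sum.atMost_Suc G_def)
    also have "\<dots> = csc (?A + ?B) (G r)
       + csc (?c (Suc r) * (of_nat (a - Suc r) * of_nat (b - Suc r))) (G (Suc r))"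
      by (simp only: cv.scale_left_distrib cv.scale_right_distrib cv.scale_scale add.assoc)
    finally show ?case unfolding c by (simp only: cv.scale_zero_left add_0)
  qed
  have "of_nat (a - min a b) * of_nat (b - min a b) = (0::complex)" by (auto simp: min_def)
  then have "(\<Sum>s\<le>min a b. csc (?c s) (Lap (Suc j) (Et j a b h s))) = 0"
    using part[OF le_refl] by (simp only: mult_zero_right cv.scale_zero_left)
  then show ?thesis by (simp add: Hst_def linear_simps)
qed

text \<open>The summands have different degrees a - s in the new z-variable, so at a monomial of the
  leading term only s = 0 contributes.\<close>

lemma Hst_nonzero:
  assumes h: "homp j p q h" "h \<noteq> 0"
  shows "Hst j p q a b h \<noteq> 0"
proof -
  have "ZW (Suc j) a b h \<noteq> 0" using ZW_inj h(2) by blast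
  then obtain x y where xy: "ZW (Suc j) a b h (x, y) \<noteq> 0" by (auto simp: fun_eq_iff)
  have N: "Zr (Suc j) (Dr (Suc j) (Et j a b h s)) = csc (of_nat (a - s)) (Et j a b h s)" for s
  proof -
    have "Zr (Suc j) (Dr (Suc j) (ZW (Suc j) (a - s) (b - s) h)) = csc (of_nat (a - s)) (ZW (Suc j) (a - s) (b - s) h)"
      by (cases "a - s") (simp_all add: Dr_ZW homp_Dr_0[OF h(1)] linear_simps flip: ZW_Suc_left)
    then show ?thesis by (simp add: Et_def Dr_Cop_pow Zr_Cop_pow Cop_pow_simps)
  qed
  have N': "of_nat (x (Suc j)) * Et j a b h s (x, y) = of_nat (a - s) * Et j a b h s (x, y)" for s
    using fun_cong[OF N[of s], of "(x, y)"] by (simp add: ZD_apply)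
  have xa: "x (Suc j) = a" using N'[of 0] xy by (simp add: Et_def)
  have "Et j a b h s (x, y) = 0" if "s \<noteq> 0" "s \<le> min a b" for s
  proof -
    have "(of_nat a :: complex) \<noteq> of_nat (a - s)" using that by simp
    then show ?thesis using N'[of s] xa by auto
  qed
  then have "Hst j p q a b h (x, y) = (\<Sum>s\<le>min a b. if s = 0 then ZW (Suc j) a b h (x, y) else 0)"
    unfolding Hst_def sum_fun_apply by (intro sum.cong refl) (auto simp: Et_def)
  then show ?thesis using xy by auto
qed

lemma Eig_Zr: "Eig i p q f \<Longrightarrow> i < l \<Longrightarrow> Eig i p q (Zr l f)"
  and Eig_Wr: "Eig i p q f \<Longrightarrow> i < l \<Longrightarrow> Eig i p q (Wr l f)"
  and Eig_Cop: "Eig i p q f \<Longrightarrow> i \<le> l \<Longrightarrow> Eig i p q (Cop l f)"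
  by (simp_all add: Eig_def C1_Zr C1_Wr C1_Cop Cas_Zr Cas_Wr Cas_Cop linear_simps)

lemma Eig_Hst: "Eig i p' q' h \<Longrightarrow> i \<le> j \<Longrightarrow> Eig i p' q' (Hst j p q a b h)"
  unfolding Hst_def by (rule Eig_sum, rule Eig_csc, rule Et_preserve) (auto intro: Eig_Zr Eig_Wr Eig_Cop)

lemma rl_Hst: "rl h \<Longrightarrow> rl (Hst j p q a b h)"
  unfolding Hst_def by (rule rl_sum, rule rl_csc, rule Et_preserve) (auto intro: rl_Zr rl_Wr rl_Cop)

lemma Eig_harmonic:
  assumes h: "homp j p q h" "Lap j h = 0" and j: "1 \<le> j"
  shows "Eig j p q h"
proof -
  have "casv j p q = p * p + (j - 1) * p + (q * q + (j - 1) * q)" by (simp only: casv_def distrib_left add_ac)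
  then have c: "(of_nat (casv j p q) :: complex) = of_nat p * of_nat p + (of_nat j - 1) * of_nat p + (of_nat q * of_nat q + (of_nat j - 1) * of_nat q)"
    using j by (simp add: of_nat_diff)
  have "Cas j h = csc (of_nat (casv j p q)) h"
    unfolding Cas_conv c homp_Nz[OF h(1)] homp_Nw[OF h(1)] h(2)
    by (simp add: linear_simps homp_Nz[OF h(1)] homp_Nw[OF h(1)] cv.scale_left_distrib)
  moreover have "C1 j h = csc (of_int (int p - int q)) h"
    by (simp add: C1_conv homp_Nz[OF h(1)] homp_Nw[OF h(1)] cv.scale_left_diff_distrib)
  ultimately show ?thesis by (simp add: Eig_def)
qed

primrec gtharm :: "(nat \<Rightarrow> nat) \<Rightarrow> (nat \<Rightarrow> nat) \<Rightarrow> nat \<Rightarrow> cvec" where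
  "gtharm P Q 0 = basisv (\<lambda>_. 0) (\<lambda>_. 0)"
| "gtharm P Q (Suc j) = Hst j (P j) (Q j) (P (Suc j) - P j) (Q (Suc j) - Q j) (gtharm P Q j)"

text \<open>For rows (P, 0, ..., 0, -Q) the betweenness conditions amount to monotonicity of P and
  Q. Row 1 consists of the single entry P 1 - Q 1, which fixes the pair only if one of the two is
  0.\<close>

definition adm :: "nat \<Rightarrow> (nat \<Rightarrow> nat) \<Rightarrow> (nat \<Rightarrow> nat) \<Rightarrow> bool" where
  "adm m P Q \<longleftrightarrow> P 0 = 0 \<and> Q 0 = 0 \<and> (\<forall>j<m. P j \<le> P (Suc j) \<and> Q j \<le> Q (Suc j)) \<and> (0 < m \<longrightarrow> P 1 = 0 \<or> Q 1 = 0)"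

lemma gtharm_props:
  assumes "adm m P Q"
  shows "j \<le> m \<Longrightarrow> homp j (P j) (Q j) (gtharm P Q j) \<and> Lap j (gtharm P Q j) = 0 \<and> gtharm P Q j \<noteq> 0 \<and> rl (gtharm P Q j)"
proof (induction j)
  case 0
  then show ?case using assms
    by (auto simp: homp_def fock_def basisv_def adm_def Lap_def rl_def fun_eq_iff split: if_splits)
next
  case (Suc j)
  then have IH: "homp j (P j) (Q j) (gtharm P Q j)" "Lap j (gtharm P Q j) = 0" "gtharm P Q j \<noteq> 0" "rl (gtharm P Q j)" by auto
  have le: "P j \<le> P (Suc j)" "Q j \<le> Q (Suc j)" using assms Suc.prems by (auto simp: adm_def)
  have 0: "j = 0 \<Longrightarrow> P (Suc j) - P j = 0 \<or> Q (Suc j) - Q j = 0" using assms Suc.prems by (auto simp: adm_def)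
  have "homp (Suc j) (P (Suc j)) (Q (Suc j)) (gtharm P Q (Suc j))"
    using homp_Hst[OF IH(1), of "P (Suc j) - P j" "Q (Suc j) - Q j"] le by simp
  moreover have "Lap (Suc j) (gtharm P Q (Suc j)) = 0"
    unfolding gtharm.simps(2) by (rule Lap_Hst[OF IH(1,2) 0])
  moreover have "gtharm P Q (Suc j) \<noteq> 0" unfolding gtharm.simps(2) by (rule Hst_nonzero[OF IH(1,3)])
  moreover have "rl (gtharm P Q (Suc j))" unfolding gtharm.simps(2) by (rule rl_Hst[OF IH(4)])
  ultimately show ?case by blast
qed

lemma Eig_gtharm:
  assumes "adm m P Q"
  shows "1 \<le> i \<Longrightarrow> i \<le> j \<Longrightarrow> j \<le> m \<Longrightarrow> Eig i (P i) (Q i) (gtharm P Q j)"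
proof (induction j)
  case (Suc j)
  show ?case
  proof (cases "i = Suc j")
    case True
    then show ?thesis using gtharm_props[OF assms Suc.prems(3)] Suc.prems Eig_harmonic by simp
  next
    case False
    then show ?thesis using Suc Eig_Hst[of i "P i" "Q i" "gtharm P Q j" j] by simp
  qed
qed simp

definition gtpoly :: "nat \<Rightarrow> nat \<Rightarrow> (nat \<Rightarrow> nat) \<Rightarrow> (nat \<Rightarrow> nat) \<Rightarrow> cvec" where
  "gtpoly m n P Q = (Cop m ^^ (n - P m)) (gtharm P Q m)"

lemma gtpoly_props:
  assumes a: "adm m P Q" and e: "P m = Q m" "P m \<le> n" and m: "1 \<le> m"
  shows "VV m n (gtpoly m n P Q)" "rl (gtpoly m n P Q)" "gtpoly m n P Q \<noteq> 0"
    and "1 \<le> i \<Longrightarrow> i \<le> m \<Longrightarrow> Eig i (P i) (Q i) (gtpoly m n P Q)"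
proof -
  have h: "homp m (P m) (Q m) (gtharm P Q m)" "Lap m (gtharm P Q m) = 0" "gtharm P Q m \<noteq> 0" "rl (gtharm P Q m)"
    using gtharm_props[OF a le_refl] by auto
  show "VV m n (gtpoly m n P Q)"
    using homp_Cop_pow[OF h(1) le_refl, of "n - P m"] e by (simp add: gtpoly_def)
  have "rl ((Cop m ^^ s) (gtharm P Q m))" for s by (induction s) (simp_all add: h rl_Cop)
  then show "rl (gtpoly m n P Q)" by (simp add: gtpoly_def)
  \<comment> \<open>The Laplacian inverts multiplication by C_m up to a scalar, which is nonzero
    because m is positive.\<close>
  have "(Cop m ^^ s) (gtharm P Q m) \<noteq> 0" for s
  proof (induction s)
    case (Suc s)
    show ?case
    proof
      assume "(Cop m ^^ Suc s) (gtharm P Q m) = 0"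
      then have "csc (of_nat (Suc s * (s + m + P m + Q m))) ((Cop m ^^ s) (gtharm P Q m)) = 0"
        using Lap_Cop_pow[OF h(2) homp_Nz[OF h(1)] homp_Nw[OF h(1)], of s] by (simp only: linear_simps)
      then have "of_nat (Suc s * (s + m + P m + Q m)) = (0::complex)" using Suc by (simp only: cv.scale_eq_0_iff) blast
      then show False using m by (simp only: of_nat_eq_0_iff) simp
    qed
  next
    case 0
    show ?case unfolding funpow.simps(1) id_apply by (rule h(3))
  qed
  then show "gtpoly m n P Q \<noteq> 0" unfolding gtpoly_def by blast
  show "Eig i (P i) (Q i) (gtpoly m n P Q)" if i: "1 \<le> i" "i \<le> m"
  proof -
    have "Eig i (P i) (Q i) ((Cop m ^^ s) (gtharm P Q m))" for s
      by (induction s) (use Eig_gtharm[OF a i le_refl] i in \<open>simp_all add: Eig_Cop\<close>)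
    then show ?thesis by (simp add: gtpoly_def)
  qed
qed

section \<open>The chain vectors span\<close>

definition gtgens :: "nat \<Rightarrow> nat \<Rightarrow> nat \<Rightarrow> cvec set" where
  "gtgens j p q = {(Cop j ^^ s) (gtharm P Q j) | s P Q. adm j P Q \<and> P j + s = p \<and> Q j + s = q}"

definition gtspan :: "nat \<Rightarrow> nat \<Rightarrow> nat \<Rightarrow> cvec set" where
  "gtspan j p q = cv.span (gtgens j p q)"

lemma gtspan_0: "0 \<in> gtspan j p q"
  unfolding gtspan_def by (rule cv.span_zero)
lemma gtspan_add: "f \<in> gtspan j p q \<Longrightarrow> g \<in> gtspan j p q \<Longrightarrow> f + g \<in> gtspan j p q"
  unfolding gtspan_def by (rule cv.span_add)
lemma gtspan_diff: "f \<in> gtspan j p q \<Longrightarrow> g \<in> gtspan j p q \<Longrightarrow> f - g \<in> gtspan j p q"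
  unfolding gtspan_def by (rule cv.span_diff)
lemma gtspan_csc: "f \<in> gtspan j p q \<Longrightarrow> csc c f \<in> gtspan j p q"
  unfolding gtspan_def by (rule cv.span_scale)
lemma gtspan_sum: "(\<And>i. i \<in> A \<Longrightarrow> f i \<in> gtspan j p q) \<Longrightarrow> (\<Sum>i\<in>A. f i) \<in> gtspan j p q"
  unfolding gtspan_def by (rule cv.span_sum)
lemma gtspan_base: "adm j P Q \<Longrightarrow> P j + s = p \<Longrightarrow> Q j + s = q \<Longrightarrow> (Cop j ^^ s) (gtharm P Q j) \<in> gtspan j p q"
  unfolding gtspan_def gtgens_def by (rule cv.span_base) blast

lemma span_image_subset:
  assumes T: "lin T" and B: "\<And>b. b \<in> B \<Longrightarrow> T b \<in> cv.span C" and f: "f \<in> cv.span B"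
  shows "T f \<in> cv.span C"
  using f
proof (induction rule: cv.span_induct_alt)
  case base
  show ?case unfolding lin_zero[OF T] by (rule cv.span_zero)
next
  case (step c x y)
  show ?case unfolding lin_add[OF T] lin_csc[OF T]
    by (rule cv.span_add[OF cv.span_scale[OF B[OF step(1)]] step(2)])
qed

lemma gtspan_Cop:
  assumes "f \<in> gtspan j p q"
  shows "Cop j f \<in> gtspan j (Suc p) (Suc q)"
  unfolding gtspan_def
proof (rule span_image_subset[OF lin_Cop _ assms[unfolded gtspan_def]])
  fix b assume "b \<in> gtgens j p q"
  then obtain s P Q where b: "b = (Cop j ^^ s) (gtharm P Q j)" "adm j P Q" "P j + s = p" "Q j + s = q" unfolding gtgens_def by blast
  have "Cop j b = (Cop j ^^ Suc s) (gtharm P Q j)" by (simp add: b(1))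
  moreover have "(Cop j ^^ Suc s) (gtharm P Q j) \<in> gtspan j (Suc p) (Suc q)"
    by (rule gtspan_base[OF b(2)]) (simp_all add: b(3)[symmetric] b(4)[symmetric])
  ultimately show "Cop j b \<in> cv.span (gtgens j (Suc p) (Suc q))"
    by (simp only: gtspan_def)
qed

lemma gtharm_cong: "(\<And>i. i \<le> j \<Longrightarrow> P i = P' i \<and> Q i = Q' i) \<Longrightarrow> gtharm P Q j = gtharm P' Q' j"
proof (induction j)
  case (Suc j)
  have "gtharm P Q j = gtharm P' Q' j" by (rule Suc.IH) (use Suc.prems in simp)
  then show ?case using Suc.prems[of j] Suc.prems[of "Suc j"] by simp
qed simp

lemma Hst_gtspan:
  assumes a: "adm j P Q" and ab: "j = 0 \<Longrightarrow> a = 0 \<or> b = 0"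
  shows "Hst j (P j) (Q j) a b (gtharm P Q j) \<in> gtspan (Suc j) (P j + a) (Q j + b)"
proof -
  let ?P = "P(Suc j := P j + a)" and ?Q = "Q(Suc j := Q j + b)"
  have "gtharm ?P ?Q j = gtharm P Q j" by (rule gtharm_cong) auto
  then have e: "gtharm ?P ?Q (Suc j) = Hst j (P j) (Q j) a b (gtharm P Q j)" by simp
  have "adm (Suc j) ?P ?Q" using a ab by (auto simp: adm_def less_Suc_eq)
  then have "(Cop (Suc j) ^^ 0) (gtharm ?P ?Q (Suc j)) \<in> gtspan (Suc j) (P j + a) (Q j + b)"
    by (rule gtspan_base) auto
  then show ?thesis by (simp only: e funpow.simps(1) id_apply)
qed

lemma Cop_ZW: "Cop j (ZW i a b h) = ZW i a b (Cop j h)"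
  by (rule ZW_commute) (simp_all only: Cop_Zr Cop_Wr)

lemma Cop_0 [simp]: "Cop 0 f = 0"
  by (simp add: Cop_def)

text \<open>C_(j+1) is C_j plus the product of the new variables: the first part raises s, the
  second restores the exponents at the same s.\<close>

lemma Et_step:
  assumes "s < min (Suc a) (Suc b)"
  shows "Et j (Suc a) (Suc b) h (Suc s) + Et j (Suc a) (Suc b) h s = Cop (Suc j) (Et j a b h s)"
proof -
  let ?g = "ZW (Suc j) (a - s) (b - s) h"
  have d: "Suc a - s = Suc (a - s)" "Suc b - s = Suc (b - s)" using assms by auto
  have "Et j (Suc a) (Suc b) h s = Zr (Suc j) (Wr (Suc j) (Et j a b h s))"
    unfolding Et_def d ZW_Suc_left ZW_Suc_right Zr_Cop_pow Wr_Cop_pow Wr_Zr by (rule refl)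
  moreover have "Et j (Suc a) (Suc b) h (Suc s) = Cop j (Et j a b h s)"
    by (simp add: Et_def)
  ultimately show ?thesis by (simp only: Cop_Suc)
qed

lemma hcoeff_sign: "(-1) ^ s * hcoeff j p q a b s \<ge> 0"
proof (induction s)
  case (Suc s)
  have "(-1) ^ Suc s * hcoeff j p q a b (Suc s) = ((-1) ^ s * hcoeff j p q a b s) * (real (a - s) * real (b - s) / (real (Suc s) * real (s + j + p + q)))"
    by simp
  then show ?case using Suc by (simp only: mult_nonneg_nonneg divide_nonneg_nonneg of_nat_0_le_iff)
qed simp

text \<open>This sum is the scalar by which \<open>Et_gtspan\<close> divides; the signs alternate
  and the term s = 0 equals 1.\<close>

lemma hcoeff_alternating_sum_pos: "(\<Sum>s\<le>r. (-1) ^ s * hcoeff j p q a b s) > 0"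
proof (rule sum_pos2[of _ 0])
  show "0 < (-1) ^ 0 * hcoeff j p q a b 0" by simp
qed (auto intro: hcoeff_sign)

text \<open>By \<open>Et_step\<close> and induction on a, neighbouring terms add up to 0 modulo the
  span, so the s-th term is congruent to (-1)^s times the 0-th. The harmonic vector
  \<open>Hst\<close> lies in the span and is thus congruent to a positive multiple of the 0-th term,
  which forces all of them into the span.\<close>

lemma Et_gtspan:
  assumes ad: "adm j P Q"
  defines "h \<equiv> gtharm P Q j"
  shows "s \<le> min a b \<Longrightarrow> Et j a b h s \<in> gtspan (Suc j) (P j + a) (Q j + b)"
proof (induction a arbitrary: b s rule: less_induct)
  case (less a)
  let ?L = "gtspan (Suc j) (P j + a) (Q j + b)"
  have step: "Et j a b h (Suc s) + Et j a b h s \<in> ?L" if s: "s < min a b" for s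
  proof -
    obtain a' b' where ab: "a = Suc a'" "b = Suc b'" using s by (cases a; cases b) auto
    have "Et j a' b' h s \<in> gtspan (Suc j) (P j + a') (Q j + b')"
      by (rule less.IH) (use s ab in auto)
    then have "Cop (Suc j) (Et j a' b' h s) \<in> gtspan (Suc j) (Suc (P j + a')) (Suc (Q j + b'))" by (rule gtspan_Cop)
    then show ?thesis using Et_step[of s a' b' j h] s by (simp only: ab add_Suc_right)
  qed
  let ?e0 = "Et j a b h 0"
  have alt: "Et j a b h s - csc ((-1) ^ s) ?e0 \<in> ?L" if "s \<le> min a b" for s
    using that
  proof (induction s)
    case 0
    have "Et j a b h 0 - csc ((-1) ^ 0) ?e0 = 0" by (simp only: power_0 cv.scale_one diff_self)
    then show ?case by (simp only: gtspan_0)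
  next
    case (Suc s)
    have "Et j a b h (Suc s) + Et j a b h s \<in> ?L" by (rule step) (use Suc.prems in simp)
    moreover have "Et j a b h s - csc ((-1) ^ s) ?e0 \<in> ?L" by (rule Suc.IH) (use Suc.prems in simp)
    ultimately have "(Et j a b h (Suc s) + Et j a b h s) - (Et j a b h s - csc ((-1) ^ s) ?e0) \<in> ?L" by (rule gtspan_diff)
    moreover have "(Et j a b h (Suc s) + Et j a b h s) - (Et j a b h s - csc ((-1) ^ s) ?e0) = Et j a b h (Suc s) - csc ((-1) ^ Suc s) ?e0"
      by (simp add: fun_eq_iff)
    ultimately show ?case by (simp only:)
  qed
  have e0: "?e0 \<in> ?L"
  \<comment> \<open>In the exceptional case \<open>Hst\<close> is not a chain vector, but C_0 = 0
    annihilates the term s = 1, and the two-term relation alone yields the term s = 0.\<close>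
  proof (cases "j = 0 \<and> 0 < a \<and> 0 < b")
    case True
    have "Et j a b h (Suc 0) = 0" using True by (simp add: Et_def)
    then have "0 + ?e0 \<in> ?L" using step[of 0] True by (simp only: min_less_iff_conj simp_thms)
    then show ?thesis by (simp only: add_0)
  next
    case False
    let ?c = "\<lambda>s. complex_of_real (hcoeff j (P j) (Q j) a b s)"
    let ?r = "min a b"
    have "Hst j (P j) (Q j) a b h \<in> ?L" unfolding h_def by (rule Hst_gtspan[OF ad]) (use False in auto)
    moreover have "(\<Sum>s\<le>?r. csc (?c s) (Et j a b h s - csc ((-1) ^ s) ?e0)) \<in> ?L"
      by (rule gtspan_sum, rule gtspan_csc, rule alt) simp
    ultimately have m: "Hst j (P j) (Q j) a b h - (\<Sum>s\<le>?r. csc (?c s) (Et j a b h s - csc ((-1) ^ s) ?e0)) \<in> ?L" by (rule gtspan_diff)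
    define \<kappa> where "\<kappa> = complex_of_real (\<Sum>s\<le>?r. (-1) ^ s * hcoeff j (P j) (Q j) a b s)"
    have k: "\<kappa> = (\<Sum>s\<le>?r. ?c s * (-1) ^ s)" by (simp add: \<kappa>_def mult.commute)
    have "Hst j (P j) (Q j) a b h - (\<Sum>s\<le>?r. csc (?c s) (Et j a b h s - csc ((-1) ^ s) ?e0)) = csc \<kappa> ?e0"
      unfolding Hst_def cv.scale_right_diff_distrib sum_subtractf cv.scale_scale k cv.scale_sum_left by simp
    then have "csc (inverse \<kappa>) (csc \<kappa> ?e0) \<in> ?L" using gtspan_csc[OF m] by (simp only:)
    moreover have "\<kappa> \<noteq> 0" unfolding \<kappa>_def using hcoeff_alternating_sum_pos[of j "P j" "Q j" a b ?r] by (simp only: of_real_eq_0_iff)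
    then have "inverse \<kappa> * \<kappa> = 1" by simp
    ultimately show ?thesis by (simp only: cv.scale_scale cv.scale_one)
  qed
  have "(Et j a b h s - csc ((-1) ^ s) ?e0) + csc ((-1) ^ s) ?e0 \<in> ?L"
    by (rule gtspan_add[OF alt[OF less.prems] gtspan_csc[OF e0]])
  then show ?case by (simp only: diff_add_cancel)
qed

text \<open>A generator with a factor C_j^s becomes the s-th term of the family \<open>Et\<close>
  with exponents a + s and b + s.\<close>

lemma ZW_gtspan:
  assumes f: "f \<in> gtspan j p q"
  shows "ZW (Suc j) a b f \<in> gtspan (Suc j) (p + a) (q + b)"
proof -
  have "ZW (Suc j) a b f \<in> cv.span (gtgens (Suc j) (p + a) (q + b))"
  proof (rule span_image_subset[OF lin_ZW _ f[unfolded gtspan_def]])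
    fix g assume "g \<in> gtgens j p q"
    then obtain s P Q where g: "g = (Cop j ^^ s) (gtharm P Q j)" "adm j P Q" "P j + s = p" "Q j + s = q" unfolding gtgens_def by blast
    have "ZW (Suc j) a b ((Cop j ^^ s) h) = (Cop j ^^ s) (ZW (Suc j) a b h)" for h
      by (induction s) (simp_all add: Cop_ZW[symmetric])
    then have "ZW (Suc j) a b g = Et j (a + s) (b + s) (gtharm P Q j) s" by (simp add: Et_def g(1))
    moreover have "Et j (a + s) (b + s) (gtharm P Q j) s \<in> gtspan (Suc j) (P j + (a + s)) (Q j + (b + s))"
      by (rule Et_gtspan[OF g(2)]) simp
    moreover have "P j + (a + s) = p + a" "Q j + (b + s) = q + b" using g by auto
    ultimately show "ZW (Suc j) a b g \<in> cv.span (gtgens (Suc j) (p + a) (q + b))"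
      by (simp only: gtspan_def)
  qed
  then show ?thesis by (simp only: gtspan_def)
qed

lemma zwmon_ZW:
  assumes i: "i \<in> {1..m}" and z: "x i = 0" "y i = 0"
  shows "zwmon m (x(i := a)) (y(i := b)) = ZW i a b (zwmon m x y)"
proof (induction a)
  case 0
  show ?case
  proof (induction b)
    case 0
    have "x(i := 0) = x" "y(i := 0) = y" using z by (auto simp: fun_eq_iff)
    then show ?case by simp
  next
    case (Suc b)
    have "inc i (y(i := b)) = y(i := Suc b)" by (simp add: inc_def)
    then show ?case unfolding ZW_0_Suc Suc.IH[symmetric] Wr_mono[OF i] by (simp only:)
  qed
next
  case (Suc a)
  have "inc i (x(i := a)) = x(i := Suc a)" by (simp add: inc_def)
  then show ?case unfolding ZW_Suc_left Suc.IH[symmetric] Zr_mono[OF i] by (simp only:)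
qed

lemma homp_expand:
  assumes "homp j p q f"
  shows "f = (\<Sum>z\<in>fock j p \<times> fock j q. csc (f z / of_real (sqrt (real (mfact j (fst z) * mfact j (snd z))))) (zwmon j (fst z) (snd z)))"
proof
  let ?t = "\<lambda>z. csc (f z / of_real (sqrt (real (mfact j (fst z) * mfact j (snd z))))) (zwmon j (fst z) (snd z))"
  fix w :: occs
  have e: "?t z w = (if z = w then f w else 0)" for z
    using mfact_pos[of j "fst z"] mfact_pos[of j "snd z"] by (cases z) (auto simp: zwmon_def)
  have "f w = 0" if "w \<notin> fock j p \<times> fock j q"
    using assms that by (cases w) (auto simp: homp_def)
  then show "f w = (\<Sum>z\<in>fock j p \<times> fock j q. ?t z) w"
    unfolding sum_fun_apply e by (simp add: finite_fock)
qed

lemma homp_gtspan: "homp j p q f \<Longrightarrow> f \<in> gtspan j p q"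
proof (induction j arbitrary: p q f)
  case 0
  have fz: "x \<in> fock 0 p \<longleftrightarrow> p = 0 \<and> x = (\<lambda>_. 0)" for x p by (auto simp: fock_def)
  show ?case
  proof (cases "p = 0 \<and> q = 0")
    case True
    define e :: cvec where "e = basisv (\<lambda>_. 0) (\<lambda>_. 0)"
    define c where "c = f (\<lambda>_. 0, \<lambda>_. 0)"
    have "f z = csc c e z" for z
      using 0 by (cases z) (auto simp: homp_def fz basisv_def c_def e_def)
    then have fe: "f = csc c e" by (rule ext)
    have "adm 0 (\<lambda>_. 0) (\<lambda>_. 0)" by (simp add: adm_def)
    then have "(Cop 0 ^^ 0) (gtharm (\<lambda>_. 0) (\<lambda>_. 0) 0) \<in> gtspan 0 p q"
      by (rule gtspan_base) (use True in auto)
    then have "e \<in> gtspan 0 p q" by (simp only: funpow.simps(1) id_apply gtharm.simps(1) e_def)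
    then have m: "csc c e \<in> gtspan 0 p q" by (rule gtspan_csc)
    show ?thesis by (subst fe) (rule m)
  next
    case False
    then have "f z = 0 z" for z using 0 by (cases z) (auto simp: homp_def fz)
    then have "f = 0" by (rule ext)
    then show ?thesis by (simp only: gtspan_0)
  qed
next
  case (Suc j)
  have mon: "zwmon (Suc j) x y \<in> gtspan (Suc j) p q" if xy: "x \<in> fock (Suc j) p" "y \<in> fock (Suc j) q" for x y
  proof -
    define x' y' where "x' = x(Suc j := 0)" and "y' = y(Suc j := 0)"
    have sx: "sum x' {1..j} = sum x {1..j}" "sum y' {1..j} = sum y {1..j}"
      by (auto simp: x'_def y'_def intro!: sum.cong)
    have x': "x' \<in> fock j (sum x {1..j})" "y' \<in> fock j (sum y {1..j})"
      using xy sx by (auto simp: fock_def x'_def y'_def)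
    have pq: "p = sum x {1..j} + x (Suc j)" "q = sum y {1..j} + y (Suc j)" using xy by (auto simp: fock_def)
    have "homp j (sum x {1..j}) (sum y {1..j}) (zwmon (Suc j) x' y')"
      using x' by (auto simp: homp_def zwmon_def)
    then have "zwmon (Suc j) x' y' \<in> gtspan j (sum x {1..j}) (sum y {1..j})" by (rule Suc.IH)
    then have "ZW (Suc j) (x (Suc j)) (y (Suc j)) (zwmon (Suc j) x' y') \<in> gtspan (Suc j) p q"
      unfolding pq by (rule ZW_gtspan)
    moreover have "ZW (Suc j) (x (Suc j)) (y (Suc j)) (zwmon (Suc j) x' y') = zwmon (Suc j) (x'(Suc j := x (Suc j))) (y'(Suc j := y (Suc j)))"
      by (rule zwmon_ZW[symmetric]) (auto simp: x'_def y'_def)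
    moreover have "x'(Suc j := x (Suc j)) = x" "y'(Suc j := y (Suc j)) = y" by (auto simp: x'_def y'_def)
    ultimately show ?thesis by (simp only:)
  qed
  show ?case
    by (subst homp_expand[OF Suc.prems], rule gtspan_sum, rule gtspan_csc, rule mon) auto
qed

section \<open>Gelfand--Tsetlin patterns\<close>

text \<open>Row \<open>j\<close> of a pattern, shifted by \<open>k\<close>, is \<open>(rowp, 0, \<dots>, 0, - rowq)\<close>. In row 1 the only entry is \<open>rowp - rowq\<close>, and
truncated subtraction makes one of the two terms vanish.\<close>

definition rowp :: "nat \<Rightarrow> (nat \<Rightarrow> nat \<Rightarrow> nat) \<Rightarrow> nat \<Rightarrow> nat" where
  "rowp k M j = (if j = 0 then 0 else M 1 j - k)"
definition rowq :: "nat \<Rightarrow> (nat \<Rightarrow> nat \<Rightarrow> nat) \<Rightarrow> nat \<Rightarrow> nat" where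
  "rowq k M j = (if j = 0 then 0 else k - M j j)"

section \<open>Shape of the patterns with top row \<open>lamk\<close>\<close>

lemma GT_step:
  assumes "M \<in> GT m lam" "1 \<le> i" "i \<le> j" "j < m"
  shows "M i j \<le> M i (Suc j)" "M (Suc i) (Suc j) \<le> M i j"
  using assms by (auto simp: GT_def)

lemma GT_top: "M \<in> GT m lam \<Longrightarrow> i \<in> {1..m} \<Longrightarrow> M i m = lam i"
  by (simp add: GT_def)

lemma GT_upper:
  assumes M: "M \<in> GT m lam" and ij: "1 \<le> i" "i \<le> j" "j \<le> m"
  shows "M i j \<le> lam i"
proof -
  have "M i j \<le> M i m" using ij(3)
  proof (induction rule: inc_induct)
    case (step l)
    have "M i l \<le> M i (Suc l)" using step ij by (intro GT_step(1)[OF M]) auto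
    then show ?case using step.IH by simp
  qed simp
  then show ?thesis using GT_top[OF M, of i] ij by simp
qed

lemma GT_lower:
  assumes M: "M \<in> GT m lam" and ij: "1 \<le> i" "i \<le> j" "j \<le> m"
  shows "lam (i + (m - j)) \<le> M i j"
proof -
  have "M (i + r) (j + r) \<le> M i j" if "j + r \<le> m" for r
    using that
  proof (induction r)
    case (Suc r)
    have "M (Suc (i + r)) (Suc (j + r)) \<le> M (i + r) (j + r)" using Suc.prems ij by (intro GT_step(2)[OF M]) auto
    then show ?case using Suc by simp
  qed simp
  from this[of "m - j"] have "M (i + (m - j)) m \<le> M i j" using ij by simp
  moreover have "i + (m - j) \<in> {1..m}" using ij by auto
  ultimately show ?thesis using GT_top[OF M] by metis
qed

abbreviation "GTlam m k \<equiv> GT m (lamk m k)"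

text \<open>The interior entries of the top row all equal k. Betweenness squeezes every interior
  entry below between two of them, so only the two ends of a row are free.\<close>

lemma GT_lamk_rows:
  assumes M: "M \<in> GTlam m k" and m: "2 \<le> m"
  shows "2 \<le> j \<Longrightarrow> j \<le> m \<Longrightarrow> k \<le> M 1 j"
    and "2 \<le> j \<Longrightarrow> j \<le> m \<Longrightarrow> M j j \<le> k"
    and "1 < i \<Longrightarrow> i < j \<Longrightarrow> j \<le> m \<Longrightarrow> M i j = k"
proof -
  show "k \<le> M 1 j" if "2 \<le> j" "j \<le> m"
  proof -
    have "k \<le> lamk m k (1 + (m - j))" using that m by (auto simp: lamk_def)
    then show ?thesis using GT_lower[OF M, of 1 j] that by simp
  qed
  show "M j j \<le> k" if "2 \<le> j" "j \<le> m"
  proof -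
    have "lamk m k j \<le> k" using that m by (auto simp: lamk_def)
    then show ?thesis using GT_upper[OF M, of j j] that by simp
  qed
  show "M i j = k" if "1 < i" "i < j" "j \<le> m"
  proof -
    have "lamk m k i = k" "lamk m k (i + (m - j)) = k" using that by (auto simp: lamk_def)
    then show ?thesis using GT_upper[OF M, of i j] GT_lower[OF M, of i j] that by simp
  qed
qed

lemma GT_rowmu:
  assumes M: "M \<in> GTlam m k" and m: "2 \<le> m" and j: "j \<in> {1..m}" and a: "a \<in> {1..j}"
  shows "int (M a j) - int k = rowmu j (rowp k M j) (rowq k M j) a"
proof -
  note r = GT_lamk_rows[OF M m]
  consider "j = 1" | "j \<ge> 2" "a = 1" | "j \<ge> 2" "a = j" | "1 < a" "a < j" using j a by force
  then show ?thesis
  proof cases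
    case 1
    then show ?thesis using a by (auto simp: rowmu_def rowp_def rowq_def)
  next
    case 2
    then show ?thesis using r(1)[of j] j by (auto simp: rowmu_def rowp_def rowq_def)
  next
    case 3
    then show ?thesis using r(2)[of j] j by (auto simp: rowmu_def rowp_def rowq_def)
  next
    case 4
    then show ?thesis using r(3)[of a j] j by (auto simp: rowmu_def rowp_def rowq_def)
  qed
qed

lemma adm_rowp_rowq:
  assumes M: "M \<in> GTlam m k" and m: "2 \<le> m"
  shows "adm m (rowp k M) (rowq k M)" "rowp k M m = k" "rowq k M m = k"
proof -
  have "rowp k M j \<le> rowp k M (Suc j) \<and> rowq k M j \<le> rowq k M (Suc j)" if "j < m" for j
  proof (cases "j = 0")
    case False
    then show ?thesis using GT_step[OF M, of 1 j] GT_step[OF M, of j j] that by (auto simp: rowp_def rowq_def)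
  qed (simp add: rowp_def rowq_def)
  then show "adm m (rowp k M) (rowq k M)" by (auto simp: adm_def rowp_def rowq_def)
  show "rowp k M m = k" "rowq k M m = k"
    using GT_top[OF M, of 1] GT_top[OF M, of m] m by (auto simp: rowp_def rowq_def lamk_def)
qed

lemma GT_zero: "M \<in> GT m lam \<Longrightarrow> \<not> (1 \<le> i \<and> i \<le> j \<and> j \<le> m) \<Longrightarrow> M i j = 0"
  unfolding GT_def by blast

lemma rowp_rowq_inj:
  assumes M: "M \<in> GTlam m k" and M': "M' \<in> GTlam m k" and m: "2 \<le> m"
    and eq: "\<And>j. j \<in> {1..m} \<Longrightarrow> rowp k M j = rowp k M' j \<and> rowq k M j = rowq k M' j"
  shows "M = M'"
proof (intro ext)
  fix i j
  show "M i j = M' i j"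
  proof (cases "1 \<le> i \<and> i \<le> j \<and> j \<le> m")
    case True
    then have j: "j \<in> {1..m}" "i \<in> {1..j}" by auto
    have "int (M i j) - int k = int (M' i j) - int k"
      using GT_rowmu[OF M m j] GT_rowmu[OF M' m j] eq[OF j(1)] by simp
    then show ?thesis by simp
  qed (use GT_zero[OF M] GT_zero[OF M'] in simp)
qed

lemma adm_mono:
  assumes "adm m P Q" "i \<le> j" "j \<le> m"
  shows "P i \<le> P j \<and> Q i \<le> Q j"
  using assms(2,3)
proof (induction rule: dec_induct)
  case (step l)
  then have "P l \<le> P (Suc l) \<and> Q l \<le> Q (Suc l)" using assms(1) by (simp add: adm_def)
  then show ?case using step by simp
qed simp

lemma rowp_rowq_surj:
  assumes a: "adm m P Q" and k: "P m = k" "Q m = k" and m: "2 \<le> m"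
  obtains M where "M \<in> GTlam m k" "\<And>j. j \<le> m \<Longrightarrow> rowp k M j = P j \<and> rowq k M j = Q j"
proof -
  let ?r = "\<lambda>j i. int k + rowmu j (P j) (Q j) i"
  define M where "M i j = (if 1 \<le> i \<and> i \<le> j \<and> j \<le> m then nat (?r j i) else 0)" for i j
  \<comment> \<open>Monotonicity up to \<open>Q m = k\<close> keeps the shifted rows nonnegative, so
    the conversion by \<open>nat\<close> loses nothing.\<close>
  have Qk: "Q j \<le> k" if "j \<le> m" for j using adm_mono[OF a that] k by simp
  have nn: "0 \<le> ?r j i" if "j \<le> m" for j i using Qk[OF that] by (auto simp: rowmu_def)
  have Mr: "int (M i j) = ?r j i" if "1 \<le> i" "i \<le> j" "j \<le> m" for i j using nn[OF that(3)] that by (simp add: M_def)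
  have z: "P 0 = 0" "Q 0 = 0" "P 1 = 0 \<or> Q 1 = 0" using a m by (auto simp: adm_def)
  have "M \<in> GTlam m k"
    unfolding GT_def
  proof (intro CollectI conjI allI impI ballI)
    fix i assume i: "i \<in> {1..m}"
    have "int (M i m) = int (lamk m k i)" using Mr[of i m] i m k by (auto simp: rowmu_def lamk_def)
    then show "M i m = lamk m k i" by simp
  next
    fix i j assume ij: "1 \<le> i" "i \<le> j" "j < m"
    have s: "P j \<le> P (Suc j)" "Q j \<le> Q (Suc j)" using a ij by (auto simp: adm_def)
    have "int (M i j) \<le> int (M i (j + 1))"
      using Mr[of i j] Mr[of i "j + 1"] ij s by (auto simp: rowmu_def)
    then show "M i j \<le> M i (j + 1)" by simp
    have "int (M (i + 1) (j + 1)) \<le> int (M i j)"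
      using Mr[of i j] Mr[of "i + 1" "j + 1"] ij s by (auto simp: rowmu_def)
    then show "M (i + 1) (j + 1) \<le> M i j" by simp
  qed (auto simp: M_def)
  moreover have "rowp k M j = P j \<and> rowq k M j = Q j" if j: "j \<le> m" for j
  proof (cases "j = 0")
    case False
    have "int (M 1 j) = ?r j 1" "int (M j j) = ?r j j" using Mr j False by auto
    then show ?thesis using z(3) Qk[OF j] False by (cases "j = 1") (auto simp: rowmu_def rowp_def rowq_def)
  qed (use z in \<open>simp add: rowp_def rowq_def\<close>)
  ultimately show ?thesis using that by blast
qed

lemma finite_GT: "finite (GTlam m k)"
proof -
  let ?F = "{f. \<forall>z. (z \<in> {1..m} \<times> {1..m} \<longrightarrow> f z \<in> {..2 * k}) \<and> (z \<notin> {1..m} \<times> {1..m} \<longrightarrow> f z = (0::nat))}"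
  have "GTlam m k \<subseteq> curry ` ?F"
  proof
    fix M assume M: "M \<in> GTlam m k"
    have z: "M i j = 0" if "\<not> (1 \<le> i \<and> i \<le> j \<and> j \<le> m)" for i j using GT_zero[OF M that] .
    have "M i j \<le> 2 * k" for i j
    proof (cases "1 \<le> i \<and> i \<le> j \<and> j \<le> m")
      case True
      then show ?thesis using GT_upper[OF M, of i j] by (auto simp: lamk_def split: if_splits)
    qed (use z[of i j] in simp)
    then have "case_prod M \<in> ?F" using z by auto
    moreover have "M = curry (case_prod M)" by simp
    ultimately show "M \<in> curry ` ?F" by blast
  qed
  moreover have "finite ?F" by (rule finite_set_of_finite_funs) auto
  ultimately show ?thesis by (meson finite_imageI finite_subset)
qed

section \<open>Weights of patterns and Fock labels\<close>

lemma ptwt_eq: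
  assumes M: "M \<in> GTlam m k" and m: "2 \<le> m" and j: "j \<in> {1..m}"
  shows "ptwt M j = int k + (int (rowp k M j) - int (rowq k M j)) - (int (rowp k M (j - 1)) - int (rowq k M (j - 1)))"
proof -
  have row: "(\<Sum>i\<in>{1..l}. int (M i l)) = int l * int k + (int (rowp k M l) - int (rowq k M l))" if "l \<le> m" for l
  proof (cases "l = 0")
    case False
    have "(\<Sum>i\<in>{1..l}. int (M i l)) = (\<Sum>i\<in>{1..l}. int k + rowmu l (rowp k M l) (rowq k M l) i)"
      by (rule sum.cong[OF refl]) (use GT_rowmu[OF M m, of l] that False in force)
    also have "\<dots> = int l * int k + (int (rowp k M l) - int (rowq k M l))"
      using False by (simp add: sum.distrib rowmu_def sum_subtractf)
    finally show ?thesis .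
  qed (simp add: rowp_def rowq_def)
  have l: "j \<le> m" "j - 1 \<le> m" "int (j - 1) = int j - 1" using j by (auto simp: of_nat_diff)
  show ?thesis unfolding ptwt_def row[OF l(1)] row[OF l(2)] l(3) by (simp add: algebra_simps)
qed

text \<open>Zero weight for SU(m) means the constant gl(m)-weight (k, ..., k). The weight entries
  minus k are the successive differences of \<open>rowp - rowq\<close>, which starts at 0.\<close>

lemma zero_weight_iff:
  assumes M: "M \<in> GTlam m k" and m: "2 \<le> m"
  shows "(\<forall>j\<in>{1..m}. ptwt M j = int k) \<longleftrightarrow> (\<forall>j\<in>{1..m}. rowp k M j = rowq k M j)"
proof
  assume w: "\<forall>j\<in>{1..m}. ptwt M j = int k"
  have "j \<le> m \<Longrightarrow> rowp k M j = rowq k M j" for j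
  proof (induction j)
    case (Suc j)
    then show ?case using ptwt_eq[OF M m, of "Suc j"] w by simp
  qed (simp add: rowp_def rowq_def)
  then show "\<forall>j\<in>{1..m}. rowp k M j = rowq k M j" by simp
next
  assume e: "\<forall>j\<in>{1..m}. rowp k M j = rowq k M j"
  have "rowp k M j = rowq k M j" if "j \<le> m" for j
    using e that by (cases "j = 0") (auto simp: rowp_def rowq_def)
  then have e': "rowp k M j = rowq k M j" "rowp k M (j - 1) = rowq k M (j - 1)" if "j \<in> {1..m}" for j
    using that by (auto intro!: \<open>\<And>j. j \<le> m \<Longrightarrow> rowp k M j = rowq k M j\<close>)
  show "\<forall>j\<in>{1..m}. ptwt M j = int k"
  proof
    fix j assume j: "j \<in> {1..m}"
    show "ptwt M j = int k" unfolding ptwt_eq[OF M m j] e'[OF j] by simp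
  qed
qed

lemma fockOf_Npat: "v \<in> fock m n \<Longrightarrow> fockOf m (Npat m v) = v"
proof
  fix j assume v: "v \<in> fock m n"
  show "fockOf m (Npat m v) j = v j"
  proof (cases "1 \<le> j \<and> j \<le> m")
    case True
    then obtain l where "j = Suc l" by (cases j) auto
    then show ?thesis using True by (cases l) (auto simp: fockOf_def Npat_def)
  qed (use v in \<open>auto simp: fockOf_def fock_def\<close>)
qed

lemma Npat_GT:
  assumes v: "v \<in> fock m n"
  shows "Npat m v \<in> GT m (tauhw n)"
  using v by (auto simp: GT_def Npat_def tauhw_def fock_def)

lemma fockOf_GT:
  assumes N: "N \<in> GT m (tauhw n)" and m: "1 \<le> m"
  shows "fockOf m N \<in> fock m n" "Npat m (fockOf m N) = N"
proof -
  have z: "N i j = 0" if "i \<noteq> 1" for i j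
    using GT_zero[OF N, of i j] GT_upper[OF N, of i j] that
    by (cases "1 \<le> i \<and> i \<le> j \<and> j \<le> m") (auto simp: tauhw_def)
  have s: "(\<Sum>l\<in>{1..j}. fockOf m N l) = N 1 j" if "j \<le> m" for j
    using that
  proof (induction j)
    case 0
    then show ?case using GT_zero[OF N, of 1 0] by simp
  next
    case (Suc j)
    have "N 1 j \<le> N 1 (Suc j)" using GT_step(1)[OF N, of 1 j] GT_zero[OF N, of 1 0] Suc.prems by (cases "j = 0") auto
    then show ?case using Suc by (simp add: fockOf_def)
  qed
  have "N 1 m = n" using GT_top[OF N, of 1] m by (simp add: tauhw_def)
  then show "fockOf m N \<in> fock m n" using s[of m] by (auto simp: fock_def fockOf_def)
  show "Npat m (fockOf m N) = N"
  proof (intro ext)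
    fix i j show "Npat m (fockOf m N) i j = N i j"
      using s[of j] z[of i j] GT_zero[OF N, of i j] by (auto simp: Npat_def)
  qed
qed

section \<open>The basis of pattern vectors\<close>

definition jeig :: "nat \<Rightarrow> nat \<Rightarrow> nat \<Rightarrow> (nat \<Rightarrow> nat \<Rightarrow> nat) \<Rightarrow> cvec \<Rightarrow> bool" where
  "jeig m n k M f \<longleftrightarrow> VV m n f \<and> (\<forall>j\<in>{1..m}. Eig j (rowp k M j) (rowq k M j) f)"

definition gtf :: "nat \<Rightarrow> nat \<Rightarrow> nat \<Rightarrow> (nat \<Rightarrow> nat \<Rightarrow> nat) \<Rightarrow> cvec" where
  "gtf m n k M = gtpoly m n (rowp k M) (rowq k M)"

lemma jeig_csc: "jeig m n k M f \<Longrightarrow> jeig m n k M (csc c f)"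
  by (simp add: jeig_def homp_csc Eig_csc)
lemma jeig_diff: "jeig m n k M f \<Longrightarrow> jeig m n k M g \<Longrightarrow> jeig m n k M (f - g)"
  by (simp add: jeig_def homp_diff Eig_diff)

lemma jeig_orth:
  assumes f: "jeig m n k M f" "M \<in> GTlam m k" and g: "jeig m n k' M' g" "M' \<in> GT m (lamk m k')"
    and m: "2 \<le> m" and ne: "(k, M) \<noteq> (k', M')"
  shows "cinner m n f g = 0"
proof -
  obtain j where j: "j \<in> {1..m}" "(rowp k M j, rowq k M j) \<noteq> (rowp k' M' j, rowq k' M' j)"
  proof (cases "k = k'")
    case True
    then show ?thesis using rowp_rowq_inj[OF f(2), of M'] g(2) m ne that by auto
  next
    case False
    have "rowp k M m \<noteq> rowp k' M' m" unfolding adm_rowp_rowq(2)[OF f(2) m] adm_rowp_rowq(2)[OF g(2) m] by (rule False)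
    then show ?thesis using that[of m] m by simp
  qed
  show ?thesis using f(1) g(1) j by (intro Eig_orth[of m n f j _ _ g]) (auto simp: jeig_def)
qed

lemma gtf_props:
  assumes M: "M \<in> GTlam m k" and m: "2 \<le> m" and k: "k \<le> n"
  shows "jeig m n k M (gtf m n k M)" "rl (gtf m n k M)" "gtf m n k M \<noteq> 0"
proof -
  note a = adm_rowp_rowq[OF M m]
  have e: "rowp k M m = rowq k M m" "rowp k M m \<le> n" "1 \<le> m" using a k m by auto
  show "jeig m n k M (gtf m n k M)" "rl (gtf m n k M)" "gtf m n k M \<noteq> 0"
    using gtpoly_props[OF a(1) e] unfolding jeig_def gtf_def by auto
qed

lemma Vlam_eq: "2 \<le> m \<Longrightarrow> Vlam m n k = isocomp m n m (rowmu m k k)"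
  unfolding Vlam_def by (rule isocomp_cong) (auto simp: rowmu_def lamk_def)

lemma isocomp_pattern:
  assumes M: "M \<in> GTlam m k" and m: "2 \<le> m" and j: "j \<in> {1..m}"
  shows "isocomp m n j (\<lambda>i. int (M i j) - int k) = isocomp m n j (rowmu j (rowp k M j) (rowq k M j))"
  by (rule isocomp_cong) (rule GT_rowmu[OF M m j])

lemma cinner_self_pos:
  assumes "VV m n f" "f \<noteq> 0"
  obtains r where "r > 0" "cinner m n f f = of_real (r\<^sup>2)"
proof -
  let ?s = "\<Sum>z\<in>dom2 m n. (cmod (f z))\<^sup>2"
  have "?s \<ge> 0" by (intro sum_nonneg) simp
  moreover have "?s \<noteq> 0"
  proof
    assume "?s = 0"
    then have "cinner m n f f = 0" by (simp only: cinner_self of_real_0)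
    then show False using cinner_self_zero[OF assms(1)] assms(2) by blast
  qed
  ultimately show ?thesis using that[of "sqrt ?s"] by (simp add: cinner_self)
qed

text \<open>The normalised \<open>gtf\<close> witnesses the choice; conversely the chosen vector
  satisfies the eigenvalue equations at every level, so nothing else about the choice is needed
  later.\<close>

lemma gtvec_props:
  assumes M: "M \<in> GTlam m k" and m: "2 \<le> m" and k: "k \<le> n"
  shows "jeig m n k M (gtvec m n k M)" "cinner m n (gtvec m n k M) (gtvec m n k M) = 1"
    "rl (gtvec m n k M)" "gtvec m n k M \<in> Vlam m n k"
proof -
  let ?P = "\<lambda>v. v \<in> Vlam m n k \<and> (\<forall>j\<in>{1..m-1}. v \<in> isocomp m n j (\<lambda>i. int (M i j) - int k))
      \<and> cinner m n v v = 1 \<and> (\<forall>z. Im (v z) = 0)"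
  note f = gtf_props[OF M m k] and a = adm_rowp_rowq[OF M m]
  have VVf: "VV m n (gtf m n k M)" using f(1) by (simp add: jeig_def)
  obtain r where r: "r > 0" "cinner m n (gtf m n k M) (gtf m n k M) = of_real (r\<^sup>2)"
    using cinner_self_pos[OF VVf f(3)] .
  define v where "v = csc (of_real (inverse r)) (gtf m n k M)"
  have jv: "jeig m n k M v" unfolding v_def by (rule jeig_csc[OF f(1)])
  have iso: "v \<in> isocomp m n j (rowmu j (rowp k M j) (rowq k M j))" if "j \<in> {1..m}" for j
    using jv that by (intro Eig_isocomp) (auto simp: jeig_def)
  have 1: "v \<in> Vlam m n k" using iso[of m] m unfolding Vlam_eq[OF m] a(2,3) by simp
  have 2: "v \<in> isocomp m n j (\<lambda>i. int (M i j) - int k)" if "j \<in> {1..m-1}" for j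
  proof -
    have j: "j \<in> {1..m}" using that by auto
    show ?thesis unfolding isocomp_pattern[OF M m j] by (rule iso[OF j])
  qed
  have 3: "cinner m n v v = 1"
  proof -
    have i: "inverse r * (inverse r * r\<^sup>2) = 1" using r(1) by (simp add: power2_eq_square field_simps)
    show ?thesis
      unfolding v_def cinner_csc_left cinner_csc_right r(2)
      by (simp only: complex_cnj_complex_of_real of_real_mult[symmetric] i of_real_1)
  qed
  have 4: "rl v" unfolding v_def by (rule rl_csc[OF f(2)])
  have "?P v" using 1 2 3 4 unfolding rl_def by blast
  then have P: "?P (gtvec m n k M)" unfolding gtvec_def by (rule someI[of ?P])
  show "cinner m n (gtvec m n k M) (gtvec m n k M) = 1" using P by blast
  show "rl (gtvec m n k M)" using P unfolding rl_def by blast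
  show V: "gtvec m n k M \<in> Vlam m n k" using P by blast
  have "Eig j (rowp k M j) (rowq k M j) (gtvec m n k M)" if j: "j \<in> {1..m}" for j
  proof -
    have "gtvec m n k M \<in> isocomp m n j (rowmu j (rowp k M j) (rowq k M j))"
    proof (cases "j = m")
      case True
      show ?thesis using V unfolding True Vlam_eq[OF m] a(2,3) .
    next
      case False
      then have "j \<in> {1..m-1}" using j by auto
      then show ?thesis using P unfolding isocomp_pattern[OF M m j, symmetric] by blast
    qed
    then show ?thesis using j a(1) by (intro isocomp_Eig[of _ m n]) (auto simp: adm_def)
  qed
  moreover have "VV m n (gtvec m n k M)" using V unfolding Vlam_def by (rule isocomp_VV)
  ultimately show "jeig m n k M (gtvec m n k M)" unfolding jeig_def by blast
qed

definition gtidx :: "nat \<Rightarrow> nat \<Rightarrow> (nat \<times> (nat \<Rightarrow> nat \<Rightarrow> nat)) set" where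
  "gtidx m n = Sigma {..n} (\<lambda>k. GTlam m k)"

definition gtb :: "nat \<Rightarrow> nat \<Rightarrow> nat \<times> (nat \<Rightarrow> nat \<Rightarrow> nat) \<Rightarrow> cvec" where
  "gtb m n i = gtvec m n (fst i) (snd i)"

lemma finite_gtidx: "finite (gtidx m n)"
  unfolding gtidx_def by (intro finite_SigmaI finite_GT) auto

lemma gtb_orthonormal:
  assumes m: "2 \<le> m" and i: "i \<in> gtidx m n" and i': "i' \<in> gtidx m n"
  shows "cinner m n (gtb m n i) (gtb m n i') = (if i = i' then 1 else 0)"
proof -
  obtain k M k' M' where e: "i = (k, M)" "i' = (k', M')" by force
  have M: "M \<in> GTlam m k" "k \<le> n" "M' \<in> GT m (lamk m k')" "k' \<le> n" using i i' e by (auto simp: gtidx_def)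
  show ?thesis
  proof (cases "i = i'")
    case True
    then show ?thesis using gtvec_props(2)[OF M(1) m M(2)] by (simp add: gtb_def e)
  next
    case False
    then have "(k, M) \<noteq> (k', M')" by (simp add: e)
    from jeig_orth[OF gtvec_props(1)[OF M(1) m M(2)] M(1) gtvec_props(1)[OF M(3) m M(4)] M(3) m this]
    show ?thesis using False by (simp add: gtb_def e)
  qed
qed

lemma VV_span_gtf:
  assumes m: "2 \<le> m" and f: "VV m n f"
  shows "f \<in> cv.span ((\<lambda>i. gtf m n (fst i) (snd i)) ` gtidx m n)"
proof -
  have "f \<in> gtspan m n n" by (rule homp_gtspan[OF f])
  moreover have "gtgens m n n \<subseteq> (\<lambda>i. gtf m n (fst i) (snd i)) ` gtidx m n"
  proof
    fix g assume "g \<in> gtgens m n n"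
    then obtain s P Q where g: "g = (Cop m ^^ s) (gtharm P Q m)" "adm m P Q" "P m + s = n" "Q m + s = n" unfolding gtgens_def by blast
    have Q: "Q m = P m" using g by simp
    obtain M where M: "M \<in> GT m (lamk m (P m))" "\<And>j. j \<le> m \<Longrightarrow> rowp (P m) M j = P j \<and> rowq (P m) M j = Q j"
      using rowp_rowq_surj[OF g(2) refl Q m] by blast
    have "gtharm (rowp (P m) M) (rowq (P m) M) m = gtharm P Q m" by (rule gtharm_cong) (rule M(2))
    moreover have "n - rowp (P m) M m = s" using M(2)[of m] g(3) by simp
    ultimately have "gtf m n (P m) M = g" unfolding gtf_def gtpoly_def g(1) by (simp only:)
    moreover have "(P m, M) \<in> gtidx m n" using M(1) g(3) by (auto simp: gtidx_def)
    ultimately show "g \<in> (\<lambda>i. gtf m n (fst i) (snd i)) ` gtidx m n" by force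
  qed
  ultimately show ?thesis unfolding gtspan_def using cv.span_mono by blast
qed

text \<open>Uniqueness up to a scalar: expand \<open>gtvec\<close> in the vectors
  \<open>gtf\<close>. Against a joint eigenvector for M all other patterns are invisible, so
  \<open>gtvec\<close> minus its multiple of \<open>gtf\<close> is orthogonal to itself.\<close>

lemma gtf_gtb:
  assumes m: "2 \<le> m" and i: "i \<in> gtidx m n"
  shows "gtf m n (fst i) (snd i) \<in> cv.span (gtb m n ` gtidx m n)"
proof -
  obtain k M where e: "i = (k, M)" by force
  have M: "M \<in> GTlam m k" "k \<le> n" using i by (auto simp: gtidx_def e)
  let ?f = "gtf m n k M" and ?g = "gtvec m n k M"
  note f = gtf_props[OF M(1) m M(2)] and g = gtvec_props[OF M(1) m M(2)]
  have gV: "VV m n ?g" using g(1) by (simp add: jeig_def)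
  have "\<exists>c. \<forall>u. jeig m n k M u \<longrightarrow> cinner m n u (v - csc c ?f) = 0"
    if "v \<in> cv.span ((\<lambda>i. gtf m n (fst i) (snd i)) ` gtidx m n)" for v
    using that
  proof (induction rule: cv.span_induct_alt)
    case base
    have "0 - csc 0 ?f = 0" by (simp only: cv.scale_zero_left diff_self)
    then show ?case by (metis cinner_zero_right)
  next
    case (step a x y)
    then obtain c where c: "\<forall>u. jeig m n k M u \<longrightarrow> cinner m n u (y - csc c ?f) = 0" by blast
    obtain k' M' where x: "x = gtf m n k' M'" "M' \<in> GT m (lamk m k')" "k' \<le> n" using step(1) by (auto simp: gtidx_def)
    show ?case
    proof (cases "(k', M') = (k, M)")
      case True
      then have "csc a x + y - csc (a + c) ?f = y - csc c ?f" using x(1) by (simp add: cv.scale_left_distrib)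
      then show ?thesis using c by (intro exI[of _ "a + c"]) (simp only: simp_thms)
    next
      case False
      have d: "csc a x + y - csc c ?f = csc a x + (y - csc c ?f)" by (simp only: add_diff_eq)
      have "cinner m n u (csc a x + y - csc c ?f) = 0" if u: "jeig m n k M u" for u
      proof -
        have "cinner m n u x = 0" unfolding x(1)
          by (rule jeig_orth[OF u M(1) gtf_props(1)[OF x(2) m x(3)] x(2) m]) (use False in auto)
        moreover have "cinner m n u (y - csc c ?f) = 0" using c u by blast
        ultimately show ?thesis unfolding d cinner_add_right cinner_csc_right by simp
      qed
      then show ?thesis by blast
    qed
  qed
  from this[OF VV_span_gtf[OF m gV]] obtain c where c: "\<forall>u. jeig m n k M u \<longrightarrow> cinner m n u (?g - csc c ?f) = 0" by blast
  have j: "jeig m n k M (?g - csc c ?f)" by (rule jeig_diff[OF g(1) jeig_csc[OF f(1)]])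
  have "?g - csc c ?f = 0" using c j cinner_self_zero[of m n "?g - csc c ?f"] by (simp add: jeig_def)
  then have gc: "?g = csc c ?f" by simp
  have "c \<noteq> 0"
  proof
    assume "c = 0"
    then have "?g = 0" using gc by (simp only: cv.scale_zero_left)
    then show False using g(2) by (simp only: cinner_zero_right) simp
  qed
  then have "inverse c * c = 1" by simp
  then have "?f = csc (inverse c) ?g" unfolding gc by (simp only: cv.scale_scale cv.scale_one)
  moreover have "csc (inverse c) ?g \<in> cv.span (gtb m n ` gtidx m n)"
    by (rule cv.span_scale, rule cv.span_base) (use i in \<open>force simp: gtb_def e\<close>)
  ultimately show ?thesis by (simp only: e fst_conv snd_conv)
qed

lemma gtb_expand:
  assumes m: "2 \<le> m" and f: "VV m n f"
  shows "f = (\<Sum>i\<in>gtidx m n. csc (cinner m n (gtb m n i) f) (gtb m n i))"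
proof -
  have "f \<in> cv.span (gtb m n ` gtidx m n)"
  proof -
    have "(\<lambda>i. gtf m n (fst i) (snd i)) ` gtidx m n \<subseteq> cv.span (gtb m n ` gtidx m n)" using gtf_gtb[OF m] by blast
    then have "cv.span ((\<lambda>i. gtf m n (fst i) (snd i)) ` gtidx m n) \<subseteq> cv.span (gtb m n ` gtidx m n)"
      by (rule cv.span_minimal) (rule cv.subspace_span)
    then show ?thesis using VV_span_gtf[OF m f] by blast
  qed
  then show ?thesis
  proof (induction rule: cv.span_induct_alt)
    case base
    show ?case by (simp only: cinner_zero_right cv.scale_zero_left sum.neutral_const)
  next
    case (step c x y)
    obtain i0 where i0: "i0 \<in> gtidx m n" "x = gtb m n i0" using step(1) by blast
    let ?S = "\<lambda>f. \<Sum>i\<in>gtidx m n. csc (cinner m n (gtb m n i) f) (gtb m n i)"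
    have "(?S x) = (\<Sum>i\<in>gtidx m n. if i = i0 then x else 0)"
      by (rule sum.cong[OF refl]) (auto simp: i0(2) gtb_orthonormal[OF m _ i0(1)])
    also have "\<dots> = x" using i0(1) by (simp add: finite_gtidx)
    finally have ex: "(?S x) = x" .
    have "(?S (csc c x + y))
       = csc c (?S x) + (?S y)"
      by (simp only: cinner_add_right cinner_csc_right cv.scale_left_distrib sum.distrib cv.scale_sum_right cv.scale_scale)
    then show ?case unfolding ex step(2)[symmetric] by (rule sym)
  qed
qed

lemma gtvec_expand_Vlam:
  assumes m: "2 \<le> m" and k: "k \<le> n" and w: "w \<in> Vlam m n k"
  shows "w = (\<Sum>M\<in>GTlam m k. csc (cinner m n (gtvec m n k M) w) (gtvec m n k M))"
proof -
  have V: "VV m n w" using w unfolding Vlam_def by (rule isocomp_VV)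
  have E: "Eig m k k w" using w unfolding Vlam_eq[OF m] by (rule isocomp_Eig) (use m in auto)
  have n0: "cinner m n (gtb m n i) w = 0" if i: "i \<in> gtidx m n" "fst i \<noteq> k" for i
  proof -
    obtain k' M' where e: "i = (k', M')" by force
    have M: "M' \<in> GT m (lamk m k')" "k' \<le> n" using i by (auto simp: gtidx_def e)
    have j: "jeig m n k' M' (gtvec m n k' M')" by (rule gtvec_props(1)[OF M(1) m M(2)])
    have "Eig m (rowp k' M' m) (rowq k' M' m) (gtvec m n k' M')" using j m by (simp add: jeig_def)
    then have E': "Eig m k' k' (gtvec m n k' M')" unfolding adm_rowp_rowq(2,3)[OF M(1) m] .
    show ?thesis unfolding e gtb_def fst_conv snd_conv
      by (rule Eig_orth[OF _ E' V E]) (use j m i e in \<open>auto simp: jeig_def\<close>)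
  qed
  have z: "csc (cinner m n (gtb m n i) w) (gtb m n i) = 0" if "i \<in> gtidx m n" "fst i \<noteq> k" for i
    unfolding n0[OF that] by (rule cv.scale_zero_left)
  have "w = (\<Sum>i\<in>gtidx m n. csc (cinner m n (gtb m n i) w) (gtb m n i))" by (rule gtb_expand[OF m V])
  also have "\<dots> = (\<Sum>i\<in>(\<lambda>M. (k, M)) ` GTlam m k. csc (cinner m n (gtb m n i) w) (gtb m n i))"
  proof (rule sum.mono_neutral_right[OF finite_gtidx])
    show "(\<lambda>M. (k, M)) ` GTlam m k \<subseteq> gtidx m n" using k by (auto simp: gtidx_def)
    show "\<forall>i\<in>gtidx m n - (\<lambda>M. (k, M)) ` GTlam m k. csc (cinner m n (gtb m n i) w) (gtb m n i) = 0"
    proof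
      fix i assume i: "i \<in> gtidx m n - (\<lambda>M. (k, M)) ` GTlam m k"
      then have "fst i \<noteq> k" by (auto simp: gtidx_def)
      then show "csc (cinner m n (gtb m n i) w) (gtb m n i) = 0" using z i by blast
    qed
  qed
  also have "\<dots> = (\<Sum>M\<in>GTlam m k. csc (cinner m n (gtvec m n k M) w) (gtvec m n k M))"
    by (subst sum.reindex) (auto simp: inj_on_def gtb_def)
  finally show ?thesis .
qed

lemma gtvec_orthonormal:
  assumes "2 \<le> m" "k \<le> n" "M \<in> GTlam m k" "M' \<in> GTlam m k"
  shows "cinner m n (gtvec m n k M) (gtvec m n k M') = (if M = M' then 1 else 0)"
  using gtb_orthonormal[of m "(k, M)" n "(k, M')"] assms by (auto simp: gtb_def gtidx_def)

lemma Plam_expand: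
  assumes m: "2 \<le> m" and k: "k \<le> n"
  shows "Plam m n k x = (\<Sum>M\<in>GTlam m k. csc (cinner m n (gtvec m n k M) x) (gtvec m n k M))"
proof -
  let ?G = "GTlam m k" and ?g = "gtvec m n k"
  let ?y = "\<Sum>M\<in>?G. csc (cinner m n (?g M) x) (?g M)"
  have clsum: "(\<Sum>i\<in>A. F i) \<in> Vlam m n k" if "\<And>i. i \<in> A \<Longrightarrow> F i \<in> Vlam m n k" for F and A :: "(nat \<Rightarrow> nat \<Rightarrow> nat) set"
    using that unfolding Vlam_def by (induction A rule: infinite_finite_induct) (auto intro: isocomp_0 isocomp_plus)
  have yV: "?y \<in> Vlam m n k"
    by (rule clsum) (use gtvec_props(4)[OF _ m k] in \<open>auto simp: Vlam_def intro: isocomp_csc\<close>)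
  have gy: "cinner m n (?g M) (x - ?y) = 0" if M: "M \<in> ?G" for M
  proof -
    have "cinner m n (?g M) ?y = (\<Sum>M'\<in>?G. if M' = M then cinner m n (?g M) x else 0)"
      unfolding cinner_sum_right cinner_csc_right
      by (rule sum.cong[OF refl]) (auto simp: gtvec_orthonormal[OF m k M])
    then show ?thesis using M by (simp add: cinner_diff_right finite_GT)
  qed
  have orth: "cinner m n w (x - ?y) = 0" if w: "w \<in> Vlam m n k" for w
  proof -
    have "cinner m n w (x - ?y) = (\<Sum>M\<in>?G. cnj (cinner m n (?g M) w) * cinner m n (?g M) (x - ?y))"
      by (subst gtvec_expand_Vlam[OF m k w]) (simp only: cinner_sum_left cinner_csc_left)
    also have "\<dots> = 0" by (rule sum.neutral) (use gy in simp)
    finally show ?thesis .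
  qed
  have d: "(\<lambda>z. x z - y z) = x - y" for y by (simp only: fun_diff_def)
  show ?thesis
    unfolding Plam_def proj_def d
  proof (rule the_equality)
    show "?y \<in> Vlam m n k \<and> (\<forall>w\<in>Vlam m n k. cinner m n w (x - ?y) = 0)" using yV orth by blast
    fix y assume y: "y \<in> Vlam m n k \<and> (\<forall>w\<in>Vlam m n k. cinner m n w (x - y) = 0)"
    have dV: "y - ?y \<in> Vlam m n k" using y yV unfolding Vlam_def by (blast intro: isocomp_diff)
    have "y - ?y = (x - ?y) - (x - y)" by simp
    then have "cinner m n (y - ?y) (y - ?y) = cinner m n (y - ?y) (x - ?y) - cinner m n (y - ?y) (x - y)"
      using cinner_diff_right by metis
    also have "\<dots> = 0" using orth[OF dV] y dV by simp
    finally have "y - ?y = 0" using cinner_self_zero isocomp_VV dV unfolding Vlam_def by blast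
    then show "y = ?y" by simp
  qed
qed

section \<open>Multiplicities and the filter function\<close>

lemma cinner_basisv: "z \<in> dom2 m n \<Longrightarrow> cinner m n v (basisv (fst z) (snd z)) = cnj (v z)"
  by (simp add: cinner_def basisv_def finite_dom2 if_distrib cong: if_cong)

lemma VV_basisv: "x \<in> fock m n \<Longrightarrow> y \<in> fock m n \<Longrightarrow> VV m n (basisv x y)"
  by (simp add: homp_def basisv_def)

lemma gtvec_real: "M \<in> GTlam m k \<Longrightarrow> 2 \<le> m \<Longrightarrow> k \<le> n \<Longrightarrow> cnj (gtvec m n k M z) = gtvec m n k M z"
  using gtvec_props(3)[of M m k n] by (cases z) (simp add: rl_def complex_eq_iff)

lemma gtb_complete:
  assumes m: "2 \<le> m" and z: "z \<in> dom2 m n"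
  shows "(\<Sum>i\<in>gtidx m n. (cmod (gtb m n i z))\<^sup>2) = 1"
proof -
  let ?e = "basisv (fst z) (snd z)"
  have V: "VV m n ?e" using z by (auto simp: dom2_def intro: VV_basisv)
  have "?e z = (\<Sum>i\<in>gtidx m n. csc (cinner m n (gtb m n i) ?e) (gtb m n i)) z"
    using gtb_expand[OF m V] by (rule fun_cong)
  also have "\<dots> = (\<Sum>i\<in>gtidx m n. of_real ((cmod (gtb m n i z))\<^sup>2))"
    unfolding sum_fun_apply csc_apply cinner_basisv[OF z]
    by (intro sum.cong refl) (simp only: complex_norm_square mult.commute)
  finally have "complex_of_real (\<Sum>i\<in>gtidx m n. (cmod (gtb m n i z))\<^sup>2) = of_real 1"
    by (simp add: basisv_def)
  then show ?thesis by (simp only: of_real_eq_iff)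
qed

lemma gtb_norm:
  assumes m: "2 \<le> m" and i: "i \<in> gtidx m n"
  shows "(\<Sum>z\<in>dom2 m n. (cmod (gtb m n i z))\<^sup>2) = 1"
proof -
  have "complex_of_real (\<Sum>z\<in>dom2 m n. (cmod (gtb m n i z))\<^sup>2) = of_real 1"
    unfolding cinner_self[symmetric] gtb_orthonormal[OF m i i] by simp
  then show ?thesis by (simp only: of_real_eq_iff)
qed

text \<open>The squared moduli of all entries of the change-of-basis matrix are summed once by
  patterns and once by pairs of Fock vectors.\<close>

lemma card_gtidx: "2 \<le> m \<Longrightarrow> (\<Sum>k\<le>n. card (GTlam m k)) = (card (fock m n))\<^sup>2"
proof -
  assume m: "2 \<le> m"
  have "real (card (gtidx m n)) = (\<Sum>i\<in>gtidx m n. \<Sum>z\<in>dom2 m n. (cmod (gtb m n i z))\<^sup>2)"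
    by (simp add: gtb_norm[OF m])
  also have "\<dots> = (\<Sum>z\<in>dom2 m n. \<Sum>i\<in>gtidx m n. (cmod (gtb m n i z))\<^sup>2)" by (rule sum.swap)
  also have "\<dots> = real (card (dom2 m n))" by (simp add: gtb_complete[OF m])
  finally have "card (gtidx m n) = card (dom2 m n)" by (simp only: of_nat_eq_iff)
  then show ?thesis by (simp add: gtidx_def dom2_def card_cartesian_product power2_eq_square finite_GT)
qed

definition GT0 :: "nat \<Rightarrow> nat \<Rightarrow> (nat \<Rightarrow> nat \<Rightarrow> nat) set" where
  "GT0 m k = {M \<in> GTlam m k. \<forall>j\<in>{1..m}. ptwt M j = int k}"

text \<open>The traces are diagonal in the Fock basis, so a single nonzero coefficient reveals their
  eigenvalues as differences of partial sums.\<close>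

lemma gtvec_C1:
  assumes M: "M \<in> GTlam m k" and m: "2 \<le> m" and k: "k \<le> n" and j: "j \<in> {1..m}"
    and nz: "gtvec m n k M (x, y) \<noteq> 0"
  shows "int (\<Sum>i\<in>{1..j}. x i) - int (\<Sum>i\<in>{1..j}. y i) = int (rowp k M j) - int (rowq k M j)"
proof -
  let ?f = "gtvec m n k M"
  have "Eig j (rowp k M j) (rowq k M j) ?f" using gtvec_props(1)[OF M m k] j by (simp add: jeig_def)
  then have "(Nz j ?f - Nw j ?f) (x, y) = csc (of_int (int (rowp k M j) - int (rowq k M j))) ?f (x, y)"
    unfolding Eig_def C1_conv by simp
  then have "(of_nat (\<Sum>i\<in>{1..j}. x i) - of_nat (\<Sum>i\<in>{1..j}. y i)) * ?f (x, y) = of_int (int (rowp k M j) - int (rowq k M j)) * ?f (x, y)"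
    by (simp only: fun_diff_def Nz_apply Nw_apply csc_apply left_diff_distrib)
  then have "(of_nat (\<Sum>i\<in>{1..j}. x i) - of_nat (\<Sum>i\<in>{1..j}. y i) :: complex) = of_int (int (rowp k M j) - int (rowq k M j))"
    using nz by (simp only: mult_cancel_right simp_thms)
  then have "complex_of_int (int (\<Sum>i\<in>{1..j}. x i) - int (\<Sum>i\<in>{1..j}. y i)) = of_int (int (rowp k M j) - int (rowq k M j))"
    by (simp only: of_int_diff of_int_of_nat_eq)
  then show ?thesis by (simp only: of_int_eq_iff)
qed

lemma gtvec_diag_zero:
  assumes M: "M \<in> GTlam m k" "M \<notin> GT0 m k" and m: "2 \<le> m" and k: "k \<le> n"
  shows "gtvec m n k M (x, x) = 0"
proof (rule ccontr)
  assume nz: "gtvec m n k M (x, x) \<noteq> 0"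
  have "\<forall>j\<in>{1..m}. rowp k M j = rowq k M j"
    using gtvec_C1[OF M(1) m k _ nz] by simp
  then show False using zero_weight_iff[OF M(1) m] M by (simp add: GT0_def)
qed

text \<open>For zero weight the partial sums of x and y agree at every level, hence so do x and
  y.\<close>

lemma gtvec_offdiag_zero:
  assumes M: "M \<in> GT0 m k" and m: "2 \<le> m" and k: "k \<le> n" and xy: "x \<noteq> y"
  shows "gtvec m n k M (x, y) = 0"
proof (rule ccontr)
  assume nz: "gtvec m n k M (x, y) \<noteq> 0"
  have M': "M \<in> GTlam m k" and eq: "\<forall>j\<in>{1..m}. rowp k M j = rowq k M j"
    using M zero_weight_iff[of M m k] m by (auto simp: GT0_def)
  have s: "(\<Sum>i\<in>{1..j}. x i) = (\<Sum>i\<in>{1..j}. y i)" if "j \<le> m" for j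
    using gtvec_C1[OF M' m k _ nz, of j] eq that by (cases "j = 0") (auto simp del: of_nat_sum)
  have "x i = y i" for i
  proof (cases "i \<in> {1..m}")
    case True
    then obtain l where l: "i = Suc l" by (cases i) auto
    show ?thesis using s[of i] s[of l] True by (simp add: l)
  next
    case False
    have "VV m n (gtvec m n k M)" using gtvec_props(1)[OF M' m k] by (simp add: jeig_def)
    then have "x \<in> fock m n" "y \<in> fock m n" using nz by (auto simp: homp_def)
    then show ?thesis using False by (simp add: fock_def)
  qed
  then show False using xy by blast
qed

lemma gtvec_diag_norm:
  assumes M: "M \<in> GTlam m k" and m: "2 \<le> m" and k: "k \<le> n"
  shows "(\<Sum>x\<in>fock m n. (cmod (gtvec m n k M (x, x)))\<^sup>2) = (if M \<in> GT0 m k then 1 else 0)"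
proof (cases "M \<in> GT0 m k")
  case True
  let ?c = "\<lambda>z. (cmod (gtvec m n k M z))\<^sup>2"
  have "(\<Sum>x\<in>fock m n. ?c (x, x)) = (\<Sum>x\<in>fock m n. \<Sum>y\<in>fock m n. ?c (x, y))"
  proof (rule sum.cong[OF refl])
    fix x assume x: "x \<in> fock m n"
    have "(\<Sum>y\<in>fock m n. ?c (x, y)) = (\<Sum>y\<in>fock m n. if y = x then ?c (x, x) else 0)"
      by (rule sum.cong[OF refl]) (use gtvec_offdiag_zero[OF True m k] in auto)
    then show "?c (x, x) = (\<Sum>y\<in>fock m n. ?c (x, y))"
      using x by (simp add: finite_fock)
  qed
  also have "\<dots> = (\<Sum>z\<in>dom2 m n. (cmod (gtvec m n k M z))\<^sup>2)"
    by (simp add: dom2_def sum.cartesian_product)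
  also have "\<dots> = 1" using gtb_norm[OF m, of "(k, M)" n] M k by (simp add: gtb_def gtidx_def)
  finally show ?thesis using True by simp
next
  case False
  then show ?thesis using gtvec_diag_zero[OF M False m k] by simp
qed

lemma card_GT0_eq:
  assumes m: "2 \<le> m" and k: "k \<le> n"
  shows "(\<Sum>M\<in>GTlam m k. \<Sum>x\<in>fock m n. (cmod (gtvec m n k M (x, x)))\<^sup>2) = real (card (GT0 m k))"
proof -
  have "(\<Sum>M\<in>GTlam m k. \<Sum>x\<in>fock m n. (cmod (gtvec m n k M (x, x)))\<^sup>2) = (\<Sum>M\<in>GTlam m k. if M \<in> GT0 m k then 1 else 0)"
    by (rule sum.cong[OF refl gtvec_diag_norm[OF _ m k]])
  also have "\<dots> = real (card (GTlam m k \<inter> GT0 m k))"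
    by (simp add: sum.If_cases finite_GT Int_def)
  also have "GTlam m k \<inter> GT0 m k = GT0 m k" by (auto simp: GT0_def)
  finally show ?thesis .
qed

text \<open>The double count of \<open>card_gtidx\<close> restricted to diagonal pairs: a pattern
  contributes its full norm 1 or nothing, according to its weight.\<close>

lemma sum_card_GT0:
  assumes m: "2 \<le> m"
  shows "(\<Sum>k\<le>n. card (GT0 m k)) = card (fock m n)"
proof -
  have "real (\<Sum>k\<le>n. card (GT0 m k)) = (\<Sum>k\<le>n. \<Sum>M\<in>GTlam m k. \<Sum>x\<in>fock m n. (cmod (gtvec m n k M (x, x)))\<^sup>2)"
    by (simp add: card_GT0_eq[OF m])
  also have "\<dots> = (\<Sum>i\<in>gtidx m n. \<Sum>x\<in>fock m n. (cmod (gtb m n i (x, x)))\<^sup>2)"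
    unfolding gtidx_def gtb_def by (subst sum.Sigma) (auto simp: finite_GT split_def)
  also have "\<dots> = (\<Sum>x\<in>fock m n. \<Sum>i\<in>gtidx m n. (cmod (gtb m n i (x, x)))\<^sup>2)" by (rule sum.swap)
  also have "\<dots> = (\<Sum>x\<in>fock m n. 1)"
    by (rule sum.cong[OF refl gtb_complete[OF m]]) (simp add: dom2_def)
  finally have "real (\<Sum>k\<le>n. card (GT0 m k)) = real (card (fock m n))" by simp
  then show ?thesis by (simp only: of_nat_eq_iff)
qed

lemma card_fock: "1 \<le> m \<Longrightarrow> card (fock m n) = (n + m - 1) choose n"
proof -
  assume m: "1 \<le> m"
  have "bij_betw (\<lambda>v. map v [1..<Suc m]) (fock m n) {l :: nat list. size l = m \<and> sum_list l = n}"
  proof (rule bij_betw_byWitness[where f' = "\<lambda>l i. if i \<in> {1..m} then l ! (i - 1) else 0"])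
    show "\<forall>v\<in>fock m n. (\<lambda>i. if i \<in> {1..m} then map v [1..<Suc m] ! (i - 1) else 0) = v"
      by (auto simp: fock_def fun_eq_iff nth_append simp del: upt_Suc)
    show "\<forall>l\<in>{l :: nat list. size l = m \<and> sum_list l = n}. map (\<lambda>i. if i \<in> {1..m} then l ! (i - 1) else 0) [1..<Suc m] = l"
      by (auto intro!: nth_equalityI simp del: upt_Suc)
    show "(\<lambda>v. map v [1..<Suc m]) ` fock m n \<subseteq> {l. size l = m \<and> sum_list l = n}"
      by (auto simp: fock_def sum_list_distinct_conv_sum_set atLeastLessThanSuc_atLeastAtMost simp del: upt_Suc)
    show "(\<lambda>l i. if i \<in> {1..m} then l ! (i - 1) else 0) ` {l. size l = m \<and> sum_list l = n} \<subseteq> fock m n"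
    proof (rule image_subsetI)
      fix l :: "nat list" assume l: "l \<in> {l. size l = m \<and> sum_list l = n}"
      have "(\<Sum>i\<in>{1..m}. l ! (i - 1)) = (\<Sum>i\<in>{0..<m}. l ! i)"
        by (rule sum.reindex_bij_witness[of _ Suc "\<lambda>i. i - 1"]) auto
      then show "(\<lambda>i. if i \<in> {1..m} then l ! (i - 1) else 0) \<in> fock m n"
        using l by (auto simp: fock_def sum_list_sum_nth)
    qed
  qed
  then have "card (fock m n) = card {l :: nat list. size l = m \<and> sum_list l = n}" by (rule bij_betw_same_card)
  then show ?thesis by (simp add: card_length_sum_list)
qed

lemma dlam_eq_card:
  assumes m: "2 \<le> m" and k: "k \<le> n"
  shows "dlam m n k = card (GTlam m k)"
proof -
  let ?G = "GTlam m k" and ?g = "gtvec m n k"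
  have inj: "inj_on ?g ?G"
  proof (rule inj_onI)
    fix M M' assume M: "M \<in> ?G" "M' \<in> ?G" "?g M = ?g M'"
    then have "cinner m n (?g M) (?g M') = 1" using gtvec_orthonormal[OF m k M(1) M(1)] by simp
    then show "M = M'" using gtvec_orthonormal[OF m k M(1,2)] by (simp split: if_splits)
  qed
  have indep: "cindep (?g ` ?G)"
    unfolding cindep_def
  proof (intro allI impI ballI)
    fix c v assume c: "\<forall>z. (\<Sum>v\<in>?g ` ?G. c v * v z) = 0" and v: "v \<in> ?g ` ?G"
    obtain M where M: "M \<in> ?G" "v = ?g M" using v by blast
    have "(\<Sum>M'\<in>?G. csc (c (?g M')) (?g M')) z = 0 z" for z
      using c inj by (cases z) (simp add: sum_fun_apply sum.reindex)
    then have "(\<Sum>M'\<in>?G. csc (c (?g M')) (?g M')) = 0" by (rule ext)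
    then have "cinner m n (?g M) (\<Sum>M'\<in>?G. csc (c (?g M')) (?g M')) = 0" by (simp only: cinner_zero_right)
    moreover have "cinner m n (?g M) (\<Sum>M'\<in>?G. csc (c (?g M')) (?g M')) = (\<Sum>M'\<in>?G. if M' = M then c (?g M) else 0)"
      unfolding cinner_sum_right cinner_csc_right
      by (rule sum.cong[OF refl]) (auto simp: gtvec_orthonormal[OF m k M(1)])
    ultimately show "c v = 0" using M by (simp add: finite_GT)
  qed
  show ?thesis
    unfolding dlam_def cdim_def
  proof (rule Greatest_equality)
    show "\<exists>S\<subseteq>Vlam m n k. finite S \<and> card S = card ?G \<and> cindep S"
      using indep gtvec_props(4)[OF _ m k] finite_GT card_image[OF inj] by (intro exI[of _ "?g ` ?G"]) auto
    fix c assume "\<exists>S\<subseteq>Vlam m n k. finite S \<and> card S = c \<and> cindep S"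
    then obtain S where S: "S \<subseteq> Vlam m n k" "finite S" "card S = c" "cindep S" by blast
    have "\<not> cv.dependent S"
    proof
      assume "cv.dependent S"
      then obtain u where u: "\<exists>v\<in>S. u v \<noteq> 0" "(\<Sum>v\<in>S. csc (u v) v) = 0" using cv.dependent_finite[OF S(2)] by blast
      have "(\<Sum>v\<in>S. u v * v z) = 0" for z using fun_cong[OF u(2), of z] by (simp add: sum_fun_apply)
      then show False using S(4) u(1) unfolding cindep_def by blast
    qed
    moreover have "S \<subseteq> cv.span (?g ` ?G)"
    proof
      fix w assume "w \<in> S"
      then have w: "w \<in> Vlam m n k" using S(1) by blast
      show "w \<in> cv.span (?g ` ?G)"
        by (subst gtvec_expand_Vlam[OF m k w]) (intro cv.span_sum cv.span_scale cv.span_base imageI)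
    qed
    ultimately have "card S \<le> card (?g ` ?G)" using cv.independent_span_bound[of "?g ` ?G" S] finite_GT by blast
    also have "\<dots> \<le> card ?G" using finite_GT by (rule card_image_le)
    finally show "c \<le> card ?G" using S(3) by simp
  qed
qed

lemma slam_eq_card:
  assumes m: "2 \<le> m" and k: "k \<le> n"
  shows "slam m n k = of_nat (card (GT0 m k)) / of_nat (card (GTlam m k))"
proof -
  have "Plam m n k (basisv x x) (x, x) = of_real (\<Sum>M\<in>GTlam m k. (cmod (gtvec m n k M (x, x)))\<^sup>2)"
    if x: "x \<in> fock m n" for x
  proof -
    have c: "cinner m n v (basisv x x) = cnj (v (x, x))" for v
      using cinner_basisv[of "(x, x)" m n v] x by (simp add: dom2_def)
    show ?thesis
      unfolding Plam_expand[OF m k] sum_fun_apply csc_apply c of_real_sum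
      by (intro sum.cong refl) (simp only: complex_norm_square mult.commute)
  qed
  then have "(\<Sum>x\<in>fock m n. Plam m n k (basisv x x) (x, x)) = of_real (\<Sum>x\<in>fock m n. \<Sum>M\<in>GTlam m k. (cmod (gtvec m n k M (x, x)))\<^sup>2)"
    by (simp only: of_real_sum cong: sum.cong)
  also have "\<dots> = of_real (real (card (GT0 m k)))"
    by (subst sum.swap) (simp only: card_GT0_eq[OF m k])
  finally show ?thesis unfolding slam_def dlam_eq_card[OF m k] by simp
qed

lemma slam_value:
  assumes m: "2 \<le> m" and k: "k \<le> n"
  shows "slam m n k = of_real ((real m - 1) / (2 * real k + real m - 1) / real ((k + m - 2) choose k))"
proof (cases k)
  case 0
  have "card (GT0 m 0) = card (fock m 0)" using sum_card_GT0[OF m, of 0] by simp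
  moreover have "card (GT m (lamk m 0)) = (card (fock m 0))\<^sup>2" using card_gtidx[OF m, of 0] by simp
  moreover have "card (fock m 0) = 1" using card_fock[of m 0] m by simp
  ultimately have "slam m n 0 = 1" using slam_eq_card[OF m, of 0 n] by simp
  then show ?thesis using m by (simp add: 0)
next
  case (Suc l)
  let ?F = "\<lambda>k. card (fock m k)"
  \<comment> \<open>By Pascal's rule A + B = \<open>card (fock m k)\<close>, and A =
    \<open>card (fock m l)\<close> with l = k - 1. Hence the zero weight has multiplicity B, the
    dimension is (A + B)^2 - A^2, and the ratio is 1 / (2 A + B).\<close>
  define B where "B = (k + m - 2) choose k"
  define A where "A = (k + m - 2) choose l"
  have Z: "card (GT0 m k) + ?F l = ?F k" using sum_card_GT0[OF m, of k] sum_card_GT0[OF m, of l] by (simp add: Suc)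
  have D: "card (GTlam m k) + (?F l)\<^sup>2 = (?F k)\<^sup>2" using card_gtidx[OF m, of k] card_gtidx[OF m, of l] by (simp add: Suc)
  have Fl: "?F l = A" using card_fock[of m l] m by (simp add: A_def Suc)
  have e: "k + m - 1 = Suc (k + m - 2)" using m by simp
  have "?F k = Suc (k + m - 2) choose Suc l" using card_fock[of m k] m unfolding e Suc by simp
  then have Fk: "?F k = A + B"
    using binomial_Suc_Suc[of "k + m - 2" l] by (simp only: A_def B_def Suc[symmetric])
  have ZB: "card (GT0 m k) = B" using Z Fl Fk by simp
  have DB: "card (GTlam m k) = B * (2 * A + B)"
    using D Fl Fk by (simp add: power2_eq_square algebra_simps)
  have "Suc l * ((k + m - 2) choose Suc l) = ((k + m - 2) - l) * ((k + m - 2) choose l)"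
    by (simp only: binomial_absorption binomial_absorb_comp)
  then have "k * B = (m - 1) * A" using m by (simp add: A_def B_def Suc)
  then have kB: "real k * real B = (real m - 1) * real A" using m by (metis of_nat_mult of_nat_diff One_nat_def of_nat_1 numeral_2_eq_2 Suc_leD)
  have Bpos: "real B > 0" using m by (simp add: B_def)
  have m1: "real m - 1 > 0" using m by simp
  have "slam m n k = of_real (real B / (real B * (2 * real A + real B)))"
    unfolding slam_eq_card[OF m k] ZB DB by simp
  also have "real B / (real B * (2 * real A + real B)) = (real m - 1) / ((2 * real k + real m - 1) * real B)"
  proof -
    have "(real m - 1) * (2 * real A + real B) = 2 * (real k * real B) + (real m - 1) * real B"
      unfolding kB by (simp add: algebra_simps)
    also have "\<dots> = (2 * real k + real m - 1) * real B" by (simp add: algebra_simps)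
    finally have e: "(real m - 1) * (2 * real A + real B) = (2 * real k + real m - 1) * real B" .
    have "2 * real A + real B > 0" using Bpos by simp
    then show ?thesis unfolding e[symmetric] using Bpos m1 by simp
  qed
  finally show ?thesis by (simp add: B_def)
qed

section \<open>Clebsch-Gordan coefficients and the filter function\<close>

lemma sgn1_sq: "sgn1 a * sgn1 a = 1" and cnj_sgn1: "cnj (sgn1 a) = sgn1 a"
  by (auto simp: sgn1_def)

lemma CG_eq:
  assumes M: "M \<in> GTlam m k" and m: "2 \<le> m" and k: "k \<le> n" and N: "fockOf m N \<in> fock m n"
  shows "CG m n k M N N = sgn1 (phi m N) * gtvec m n k M (fockOf m N, fockOf m N)"
proof -
  let ?a = "fockOf m N"
  have "CG m n k M N N = cinner m n (csc (sgn1 (phi m N)) (basisv ?a ?a)) (gtvec m n k M)"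
    by (simp only: CG_def csc_def)
  also have "\<dots> = sgn1 (phi m N) * cnj (cinner m n (gtvec m n k M) (basisv ?a ?a))"
    by (simp only: cinner_csc_left cnj_sgn1 cinner_cnj)
  also have "cinner m n (gtvec m n k M) (basisv ?a ?a) = cnj (gtvec m n k M (?a, ?a))"
    using cinner_basisv[of "(?a, ?a)" m n] N by (simp add: dom2_def)
  finally show ?thesis by simp
qed

lemma sum_GT_fock:
  assumes m: "1 \<le> m"
  shows "(\<Sum>N\<in>GT m (tauhw n). F (fockOf m N)) = (\<Sum>a\<in>fock m n. F a)"
  by (rule sum.reindex_bij_witness[of _ "Npat m" "fockOf m"])
    (use m in \<open>auto simp: fockOf_GT fockOf_Npat Npat_GT\<close>)

lemma filt_expand:
  assumes m: "2 \<le> m" and k: "k \<le> n" and n0: "n0 \<in> fock m n" and x: "x \<in> fock m n"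
  shows "filt m n k n0 x g = (\<Sum>M\<in>GTlam m k. gtvec m n k M (n0, n0) *
     (\<Sum>a\<in>fock m n. gtvec m n k M (a, a) * (cmod (perm_sub m g x a))\<^sup>2 / of_nat (mfact m x * mfact m a))) / slam m n k"
proof -
  let ?G = "GTlam m k" and ?g = "gtvec m n k" and ?F = "fock m n"
  let ?p = "\<lambda>a. complex_of_real ((cmod (perm_sub m g x a))\<^sup>2) / of_nat (mfact m x * mfact m a)"
  have c: "cinner m n (?g M) (basisv n0 n0) = ?g M (n0, n0)" if "M \<in> ?G" for M
    using cinner_basisv[of "(n0, n0)" m n] n0 gtvec_real[OF that m k] by (simp add: dom2_def)
  have X: "Plam m n k (basisv n0 n0) (a, b) = (\<Sum>M\<in>?G. ?g M (n0, n0) * ?g M (a, b))" for a b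
    unfolding Plam_expand[OF m k] sum_fun_apply csc_apply by (intro sum.cong refl) (simp only: c)
  \<comment> \<open>If M has nonzero weight, the factor at the diagonal pair vanishes; if it has
    zero weight, the off-diagonal one does. So the projected state is diagonal and only squared
    moduli of \<open>tau\<close> survive.\<close>
  have off: "?g M (n0, n0) * ?g M (a, b) = 0" if "M \<in> ?G" "a \<noteq> b" for M a b
    using gtvec_diag_zero[OF that(1) _ m k] gtvec_offdiag_zero[OF _ m k that(2)] by (cases "M \<in> GT0 m k") auto
  have X0: "Plam m n k (basisv n0 n0) (a, b) = 0" if "a \<noteq> b" for a b
    unfolding X by (rule sum.neutral) (use off that in blast)
  have t: "tau m n g x a * cnj (tau m n g x a) = ?p a"
    if a: "a \<in> ?F" for a
  proof -
    have "tau m n g x a * cnj (tau m n g x a) = of_real ((cmod (tau m n g x a))\<^sup>2)" by (simp only: complex_norm_square)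
    then show ?thesis by (simp add: cmod_tau_sq[OF x a])
  qed
  have "(\<Sum>a\<in>?F. \<Sum>b\<in>?F. tau m n g x a * Plam m n k (basisv n0 n0) (a, b) * cnj (tau m n g x b))
     = (\<Sum>a\<in>?F. Plam m n k (basisv n0 n0) (a, a) * ?p a)"
  proof (rule sum.cong[OF refl])
    fix a assume a: "a \<in> ?F"
    have "(\<Sum>b\<in>?F. tau m n g x a * Plam m n k (basisv n0 n0) (a, b) * cnj (tau m n g x b))
       = (\<Sum>b\<in>?F. if b = a then Plam m n k (basisv n0 n0) (a, a) * (tau m n g x a * cnj (tau m n g x a)) else 0)"
      by (rule sum.cong[OF refl]) (use X0 in auto)
    then show "(\<Sum>b\<in>?F. tau m n g x a * Plam m n k (basisv n0 n0) (a, b) * cnj (tau m n g x b))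
       = Plam m n k (basisv n0 n0) (a, a) * ?p a"
      using a t[OF a] by (simp add: finite_fock)
  qed
  also have "\<dots> = (\<Sum>a\<in>?F. \<Sum>M\<in>?G. ?g M (n0, n0) * (?g M (a, a) * ?p a))"
    unfolding X sum_distrib_right by (intro sum.cong refl) simp
  also have "\<dots> = (\<Sum>M\<in>?G. ?g M (n0, n0) * (\<Sum>a\<in>?F. ?g M (a, a) * ?p a))"
    by (subst sum.swap) (simp only: sum_distrib_left)
  finally show ?thesis by (simp only: filt_def Let_def times_divide_eq_right)
qed

theorem theoremT5:
  fixes m n k :: nat and n0 x :: "nat \<Rightarrow> nat" and g :: "nat \<Rightarrow> nat \<Rightarrow> complex"
  assumes "m \<ge> 2" and "k \<le> n" and "n0 \<in> fock m n" and "g \<in> SU m" and "x \<in> fock m n"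
  shows "filt m n k n0 x g =
      (1 / slam m n k) * (sgn1 (phi m (Npat m n0)) / of_nat (mfact m x)) *
      (\<Sum>M\<in>GT m (lamk m k). CG m n k M (Npat m n0) (Npat m n0) *
         (\<Sum>N'\<in>GT m (tauhw n). sgn1 (phi m N') / of_nat (mfact m (fockOf m N')) *
            CG m n k M N' N' * (cmod (perm_sub m g x (fockOf m N')))\<^sup>2))
    \<and> slam m n k = of_real ((real m - 1) / (2 * real k + real m - 1) / real ((k + m - 2) choose k))
    \<and> (\<forall>M\<in>GT m (lamk m k). (\<exists>j\<in>{1..m}. ptwt M j \<noteq> int k) \<longrightarrow> CG m n k M (Npat m n0) (Npat m n0) = 0)"
proof (intro conjI ballI impI)
  note m = assms(1) and k = assms(2) and n0 = assms(3) and x = assms(5)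
  let ?G = "GT m (lamk m k)" and ?g = "gtvec m n k" and ?s = "sgn1 (phi m (Npat m n0))"
  let ?C = "\<lambda>M. CG m n k M (Npat m n0) (Npat m n0)"
  let ?T = "\<lambda>M N'. sgn1 (phi m N') / of_nat (mfact m (fockOf m N')) *
    CG m n k M N' N' * (cmod (perm_sub m g x (fockOf m N')))\<^sup>2"
  let ?h = "\<lambda>M a. ?g M (a, a) * (cmod (perm_sub m g x a))\<^sup>2 / of_nat (mfact m a)"
  have CG0: "?C M = ?s * ?g M (n0, n0)" if "M \<in> ?G" for M
    using CG_eq[OF that m k, of "Npat m n0"] n0 by (simp add: fockOf_Npat)
  show "slam m n k = of_real ((real m - 1) / (2 * real k + real m - 1) / real ((k + m - 2) choose k))"
    by (rule slam_value[OF m k])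
  show "?C M = 0" if "M \<in> ?G" "\<exists>j\<in>{1..m}. ptwt M j \<noteq> int k" for M
  proof -
    have "M \<notin> GT0 m k" using that(2) by (auto simp: GT0_def)
    then show ?thesis using CG0[OF that(1)] gtvec_diag_zero[OF that(1) _ m k] by simp
  qed
  have inner: "(\<Sum>N'\<in>GT m (tauhw n). ?T M N')
     = (\<Sum>a\<in>fock m n. ?h M a)" if M: "M \<in> ?G" for M
  proof -
    have "(\<Sum>N'\<in>GT m (tauhw n). ?T M N')
     = (\<Sum>N'\<in>GT m (tauhw n). ?h M (fockOf m N'))"
    proof (rule sum.cong[OF refl])
      fix N assume N: "N \<in> GT m (tauhw n)"
      have a: "fockOf m N \<in> fock m n" using fockOf_GT(1)[OF N] m by simp
      \<comment> \<open>The explicit sign of N' meets the same sign inside the Clebsch-Gordan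
        coefficient; the prefactor for n0 is treated alike below.\<close>
      have "s / f * (s * v) * p = v * p / f" if "s * s = 1" for s f v p :: complex
      proof -
        have "s / f * (s * v) * p = (s * s) * (v * p / f)" by simp
        then show ?thesis using that by simp
      qed
      then show "?T M N
        = ?h M (fockOf m N)"
        unfolding CG_eq[OF M m k a] using sgn1_sq by blast
    qed
    also have "\<dots> = (\<Sum>a\<in>fock m n. ?h M a)"
      using m by (intro sum_GT_fock) simp
    finally show ?thesis .
  qed
  let ?S = "\<lambda>M. \<Sum>a\<in>fock m n. ?h M a"
  have "filt m n k n0 x g = (\<Sum>M\<in>?G. ?g M (n0, n0) * (?S M / of_nat (mfact m x))) / slam m n k"
    unfolding filt_expand[OF m k n0 x] sum_divide_distrib by (simp add: mult.commute)
  also have "\<dots> = (1 / slam m n k) * (?s / of_nat (mfact m x)) * (\<Sum>M\<in>?G. (?s * ?g M (n0, n0)) * ?S M)"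
  proof -
    have t: "?s / f * ((?s * v) * S) = v * (S / f)" for f v S :: complex
    proof -
      have "?s / f * ((?s * v) * S) = (?s * ?s) * (v * (S / f))" by simp
      then show ?thesis by (simp add: sgn1_sq)
    qed
    have "(?s / of_nat (mfact m x)) * (\<Sum>M\<in>?G. (?s * ?g M (n0, n0)) * ?S M) = (\<Sum>M\<in>?G. ?g M (n0, n0) * (?S M / of_nat (mfact m x)))"
      unfolding sum_distrib_left[of "?s / of_nat (mfact m x)"] t ..
    then show ?thesis by (simp only: mult.assoc mult_1_left times_divide_eq_left)
  qed
  also have "(\<Sum>M\<in>?G. (?s * ?g M (n0, n0)) * ?S M) = (\<Sum>M\<in>?G. ?C M *
         (\<Sum>N'\<in>GT m (tauhw n). ?T M N'))"
    by (rule sum.cong[OF refl]) (simp only: CG0 inner)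
  finally show "filt m n k n0 x g =
      (1 / slam m n k) * (?s / of_nat (mfact m x)) *
      (\<Sum>M\<in>?G. ?C M *
         (\<Sum>N'\<in>GT m (tauhw n). ?T M N'))" .
qed

end
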